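(* Let $m\geq 1$ be an integer, let $1\leq s\leq q\leq 2$, and let $\mathbf{p}=(p_1,\dots,p_m)\in[1,+\infty]^m$ be such that $$\frac1s-\frac1q-\left|\frac{1}{\mathbf{p}}\right|\geq 0.$$ Let also $q_1,\dots,q_m\in[\lambda,2]$, where $$\lambda=\frac{1}{\frac12+\frac1s-\frac1q-\left|\frac1{\mathbf{p}}\right|}.$$ Then the following are equivalent: (1) There is a constant $C_{q_1\ldots q_m}\geq 1$ such that $$\left(\sum_{i_1=1}^{\infty}\left(\sum_{i_2=1}^{\infty}\left(\cdots\left(\sum_{i_{m-1}=1}^{\infty}\left(\sum_{i_m=1}^{\infty}\left\|A(e_{i_1},\dots,e_{i_m})\right\|_q^{q_m}\right)^{\frac{q_{m-1}}{q_m}}\right)^{\frac{q_{m-2}}{q_{m-1}}}\cdots\right)^{\frac{q_2}{q_3}}\right)^{\frac{q_1}{q_2}}\right)^{\frac{1}{q_1}}\leq C_{q_1\ldots q_m}\|A\|$$ for all continuous $m$-linear mappings $A:X_{p_1}\times\cdots\times X_{p_m}\to\ell_s$. (2) $\frac1{q_1}+\cdots+\frac1{q_m}\leq\frac m2+\frac1s-\frac1q-\left|\frac1{\mathbf{p}}\right|$.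
   Context: $\mathbb{K}$ denotes the field of real or complex scalars; all sequence spaces are over $\mathbb{K}$. For $\mathbf{p}=(p_1,\dots,p_m)\in[1,+\infty]^m$, $\left|\frac1{\mathbf{p}}\right|=\frac1{p_1}+\cdots+\frac1{p_m}$ (with $1/\infty=0$). $X_p=\ell_p$ for $1\le p<\infty$ and $X_\infty=c_0$; $(e_i)_{i\ge1}$ are the canonical unit vectors. $\|\cdot\|_q$ is the norm of $\ell_q$ (recall $\ell_s\subset\ell_q$ for $s\le q$). $\|A\|=\sup\{\|A(x_1,\dots,x_m)\|_s:\ \|x_j\|\le 1\text{ for all }j\}$. *)

theory Defs
  imports "HOL-Analysis.Analysis"
begin

text \<open>
  Sequences are indexed by the natural numbers starting from 0, and the coordinates of an
  \<open>m\<close>-tuple by \<open>j < m\<close>.  The scalar type \<open>'k\<close> is meant to be instantiated by \<open>real\<close> or \<open>complex\<close>.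
\<close>

definition ell :: "real \<Rightarrow> (nat \<Rightarrow> 'k::real_normed_field) set" where
  "ell r = {x. summable (\<lambda>n. norm (x n) powr r)}"

definition ell_norm :: "real \<Rightarrow> (nat \<Rightarrow> 'k::real_normed_field) \<Rightarrow> real" where
  "ell_norm r x = (\<Sum>n. norm (x n) powr r) powr (1 / r)"

definition X_space :: "ennreal \<Rightarrow> (nat \<Rightarrow> 'k::real_normed_field) set" where
  "X_space p = (if p = \<infinity> then {x. x \<longlonglongrightarrow> 0} else ell (enn2real p))"

definition X_norm :: "ennreal \<Rightarrow> (nat \<Rightarrow> 'k::real_normed_field) \<Rightarrow> real" where
  "X_norm p x = (if p = \<infinity> then (SUP n. norm (x n)) else ell_norm (enn2real p) x)"

definition X_prod :: "nat \<Rightarrow> (nat \<Rightarrow> ennreal) \<Rightarrow> (nat \<Rightarrow> nat \<Rightarrow> 'k::real_normed_field) set" where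
  "X_prod m p = (\<Pi>\<^sub>E j\<in>{..<m}. X_space (p j))"

definition unit_seq :: "nat \<Rightarrow> nat \<Rightarrow> 'k::real_normed_field" where
  "unit_seq i n = (if n = i then 1 else 0)"

definition unit_tuple :: "nat \<Rightarrow> nat list \<Rightarrow> nat \<Rightarrow> nat \<Rightarrow> 'k::real_normed_field" where
  "unit_tuple m is = (\<lambda>j\<in>{..<m}. unit_seq (is ! j))"

definition recip_sum :: "nat \<Rightarrow> (nat \<Rightarrow> ennreal) \<Rightarrow> real" where
  "recip_sum m p = (\<Sum>j<m. enn2real (1 / p j))"

definition multilinear_into_ell ::
  "nat \<Rightarrow> (nat \<Rightarrow> ennreal) \<Rightarrow> real \<Rightarrow>
   ((nat \<Rightarrow> nat \<Rightarrow> 'k::real_normed_field) \<Rightarrow> nat \<Rightarrow> 'k) \<Rightarrow> bool" where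
  "multilinear_into_ell m p s A \<longleftrightarrow>
     (\<forall>x\<in>X_prod m p. A x \<in> ell s) \<and>
     (\<forall>x\<in>X_prod m p. \<forall>j<m. \<forall>y\<in>X_space (p j). \<forall>z\<in>X_space (p j).
        A (x(j := \<lambda>n. y n + z n)) = (\<lambda>n. A (x(j := y)) n + A (x(j := z)) n)) \<and>
     (\<forall>x\<in>X_prod m p. \<forall>j<m. \<forall>y\<in>X_space (p j). \<forall>c.
        A (x(j := \<lambda>n. c * y n)) = (\<lambda>n. c * A (x(j := y)) n))"

text \<open>Joint continuity for the product of the norm topologies.\<close>

definition continuous_into_ell ::
  "nat \<Rightarrow> (nat \<Rightarrow> ennreal) \<Rightarrow> real \<Rightarrow>
   ((nat \<Rightarrow> nat \<Rightarrow> 'k::real_normed_field) \<Rightarrow> nat \<Rightarrow> 'k) \<Rightarrow> bool" where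
  "continuous_into_ell m p s A \<longleftrightarrow>
     (\<forall>x\<in>X_prod m p. \<forall>\<epsilon>>0. \<exists>\<delta>>0. \<forall>y\<in>X_prod m p.
        (\<forall>j<m. X_norm (p j) (\<lambda>n. y j n - x j n) < \<delta>) \<longrightarrow>
        ell_norm s (\<lambda>n. A y n - A x n) < \<epsilon>)"

definition mult_norm ::
  "nat \<Rightarrow> (nat \<Rightarrow> ennreal) \<Rightarrow> real \<Rightarrow>
   ((nat \<Rightarrow> nat \<Rightarrow> 'k::real_normed_field) \<Rightarrow> nat \<Rightarrow> 'k) \<Rightarrow> real" where
  "mult_norm m p s A =
     Sup {ell_norm s (A x) | x. x \<in> X_prod m p \<and> (\<forall>j<m. X_norm (p j) (x j) \<le> 1)}"

text \<open>Powers in \<open>[0, \<infinity>]\<close>; only used for exponents \<open>r > 0\<close>.\<close>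

definition epowr :: "ennreal \<Rightarrow> real \<Rightarrow> ennreal" where
  "epowr a r = (if a = \<infinity> then \<infinity> else ennreal (enn2real a powr r))"

text \<open>
  For exponents \<open>qs = [q\<^sub>1, \<dots>, q\<^sub>m]\<close> and a family \<open>a\<close> indexed by multi-indices
  \<open>[i\<^sub>1, \<dots>, i\<^sub>m]\<close>, the head of the list belongs to the outermost sum. The value for the
  empty list is immaterial.
\<close>

fun nested_sum :: "real list \<Rightarrow> (nat list \<Rightarrow> ennreal) \<Rightarrow> ennreal" where
  "nested_sum [] a = a []"
| "nested_sum [q] a = (\<Sum>i. epowr (a [i]) q)"
| "nested_sum (q # r # qs) a =
     (\<Sum>i. epowr (nested_sum (r # qs) (\<lambda>is. a (i # is))) (q / r))"

definition mixed_sum :: "nat \<Rightarrow> (nat \<Rightarrow> real) \<Rightarrow> (nat list \<Rightarrow> ennreal) \<Rightarrow> ennreal" where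
  "mixed_sum m qs a = epowr (nested_sum (map qs [0..<m]) a) (1 / qs 0)"

end

theory Submission
  imports Defs "HOL-Real_Asymp.Real_Asymp"
begin

text \<open>
  Sufficiency. Regard \<open>A\<close>, restricted to finitely many coordinates, as a scalar array \<open>a\<close> with the
  coordinate of \<open>\<ell>\<^sub>s\<close> as an additional index, that is, as an \<open>(m + 1)\<close>-linear form whose last
  argument lies in the dual of \<open>\<ell>\<^sub>s\<close>. Multiplying each argument by a weight from the unit ball of
  its space gives a form on \<open>c\<^sub>0\<close>'s, and Khinchine's inequality bounds
  \<open>\<Sum>\<^bsub>i\<^sub>k\<^esub> (\<Sum> \<bar>a\<bar>\<^sup>2 \<Prod> weights\<^sup>2)\<^bsup>1/2\<^esup>\<close> for every \<open>k\<close>. The weights are removed one at a time,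
  each removal of a weight from \<open>\<ell>\<^sub>p\<close> lowering the reciprocal of the outer exponent by \<open>1/p\<close>. Once
  all are gone, the outer exponent is \<open>1/\<kappa>\<close> with \<open>\<kappa> = 1/s - \<bar>1/p\<bar>\<close>, and Hoelder's inequality with
  powers of the marginal sums \<open>\<alpha>\<^sub>k(t) = \<Sum>\<^bsub>i\<^sub>k = t\<^esub> \<bar>a\<bar>\<^sup>2\<close> as multipliers yields every mixed norm
  whose exponents have reciprocals in the convex hull of the points \<open>(1/2, \<dots>, \<kappa>, \<dots>, 1/2)\<close>.

  Necessity. A random choice of signs gives an array of \<open>\<plusminus>1\<close> of side \<open>n\<close> all of whose box sums obey
  square root cancellation. Indicator functions are replaced by \<open>\<ell>\<^sub>2\<close> vectors one argument at a
  time, at the cost of a logarithm each: coefficients whose sums over sets \<open>R\<close> are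
  \<open>O(\<bar>R\<bar>\<^bsup>1/2\<^esup>)\<close> have square sum at most a harmonic number. So the norm of the form on \<open>\<ell>\<^sub>2\<close>'s is
  \<open>n\<^bsup>1/2\<^esup>\<close> up to logarithms. As
  \<open>\<bar>1/p\<bar> \<le> 1/2\<close> forces all \<open>p\<^sub>j \<ge> 2\<close>, comparing powers of \<open>n\<close> gives the condition on the exponents.
\<close>

section \<open>Random signs and Khinchine's inequality\<close>

lemma sum_PiE_insert:
  assumes "l \<notin> D"
  shows "(\<Sum>i\<in>PiE (insert l D) T. f i) = (\<Sum>t\<in>T l. \<Sum>i\<in>PiE D T. f (i(l := t)))"
proof -
  have "(\<Sum>i\<in>PiE (insert l D) T. f i) = (\<Sum>(t, i)\<in>T l \<times> PiE D T. f (i(l := t)))"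
    unfolding PiE_insert_eq using assms
    by (subst sum.reindex[OF inj_combinator]) (auto simp: o_def case_prod_beta)
  then show ?thesis
    by (simp add: sum.cartesian_product)
qed

text \<open>Young's inequality, applied term by term after both sums are normalised to 1. The
  exponents are the reciprocals of a conjugate pair, so the endpoints 0 and 1 are included; terms
  with a vanishing factor contribute 0 there too, because \<open>0 powr 0 = 0\<close>.\<close>

lemma Holder_sum_powr:
  fixes f g :: "'a \<Rightarrow> real"
  assumes "finite X" "\<And>x. x \<in> X \<Longrightarrow> 0 \<le> f x" "\<And>x. x \<in> X \<Longrightarrow> 0 \<le> g x"
    and "0 \<le> a" "0 \<le> b" "a + b = 1"
  shows "(\<Sum>x\<in>X. f x powr a * g x powr b) \<le> (\<Sum>x\<in>X. f x) powr a * (\<Sum>x\<in>X. g x) powr b"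
proof (cases "sum f X = 0 \<or> sum g X = 0")
  case True
  then have "f x powr a * g x powr b = 0" if "x \<in> X" for x
    using assms(1-3) that sum_nonneg_eq_0_iff[of X f] sum_nonneg_eq_0_iff[of X g] by auto
  then show ?thesis
    using assms(1-3) by (subst sum.neutral) (auto intro: mult_nonneg_nonneg)
next
  case False
  define F where "F = sum f X"
  define G where "G = sum g X"
  have pos: "F > 0" "G > 0"
    using False sum_nonneg[of X f] sum_nonneg[of X g] assms unfolding F_def G_def by fastforce+
  have "f x powr a * g x powr b \<le> F powr a * G powr b * (a * (f x / F) + b * (g x / G))"
    if x: "x \<in> X" for x
  proof (cases "f x = 0 \<or> g x = 0")
    case True
    then show ?thesis using assms(2,3)[OF x] assms(4,5) pos by auto
  next
    case False
    then have fg: "f x > 0" "g x > 0" using assms(2,3)[OF x] by auto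
    have "(f x / F) powr a * (g x / G) powr b \<le> a * (f x / F) + b * (g x / G)"
      using Youngs_inequality_0[of a b "f x / F" "g x / G"] assms fg pos by simp
    then have "F powr a * G powr b * ((f x / F) powr a * (g x / G) powr b)
        \<le> F powr a * G powr b * (a * (f x / F) + b * (g x / G))"
      using pos by (intro mult_left_mono) auto
    moreover have "F powr a * G powr b * ((f x / F) powr a * (g x / G) powr b) = f x powr a * g x powr b"
      using fg pos by (simp add: powr_divide)
    ultimately show ?thesis by simp
  qed
  then have "(\<Sum>x\<in>X. f x powr a * g x powr b)
      \<le> (\<Sum>x\<in>X. F powr a * G powr b * (a * (f x / F) + b * (g x / G)))"
    by (rule sum_mono)
  also have "\<dots> = F powr a * G powr b * (a * ((\<Sum>x\<in>X. f x) / F) + b * ((\<Sum>x\<in>X. g x) / G))"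
    by (simp add: sum_distrib_left sum.distrib sum_divide_distrib distrib_left)
  also have "\<dots> = F powr a * G powr b"
    using pos assms(6) by (simp flip: F_def G_def)
  finally show ?thesis by (simp add: F_def G_def)
qed

text \<open>Jensen's inequality for \<open>exp\<close> at the points
  \<open>ln (x i)\<close>.\<close>

lemma prod_powr_le_weighted_sum:
  fixes w x :: "'a \<Rightarrow> real"
  assumes "finite S" "\<And>i. i \<in> S \<Longrightarrow> 0 \<le> w i" "(\<Sum>i\<in>S. w i) = 1" "\<And>i. i \<in> S \<Longrightarrow> 0 < x i"
  shows "(\<Prod>i\<in>S. x i powr w i) \<le> (\<Sum>i\<in>S. w i * x i)"
proof -
  have ne: "S \<noteq> {}" using assms(3) by auto
  have "exp (\<Sum>i\<in>S. w i *\<^sub>R ln (x i)) \<le> (\<Sum>i\<in>S. w i * exp (ln (x i)))"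
    using assms ne exp_convex by (intro convex_on_sum[where C = UNIV]) auto
  moreover have "exp (\<Sum>i\<in>S. w i *\<^sub>R ln (x i)) = (\<Prod>i\<in>S. x i powr w i)"
    unfolding real_scaleR_def exp_sum[OF assms(1)]
    using assms(4) by (intro prod.cong refl) (force simp: powr_def)
  ultimately show ?thesis using assms(4) by simp
qed

section \<open>Averages over independent random signs\<close>

definition sign_avg :: "'a set \<Rightarrow> (('a \<Rightarrow> real) \<Rightarrow> real) \<Rightarrow> real" where
  "sign_avg U F = (\<Sum>\<epsilon>\<in>PiE U (\<lambda>_. {-1, 1}). F \<epsilon>) / 2 ^ card U"

lemma sign_avg_empty [simp]: "sign_avg {} F = F (\<lambda>_. undefined)"
  by (simp add: sign_avg_def)

text \<open>Averaging over the sign of \<open>u\<close> with the other signs fixed; the inductions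
  on the set of signs rest on this.\<close>

lemma sign_avg_insert:
  assumes "finite U" "u \<notin> U"
  shows "sign_avg (insert u U) F = sign_avg U (\<lambda>\<epsilon>. (F (\<epsilon>(u := 1)) + F (\<epsilon>(u := -1))) / 2)"
  using assms by (simp add: sign_avg_def sum_PiE_insert sum.distrib add_divide_distrib
      flip: sum_divide_distrib)

lemma sign_avg_mono:
  assumes "\<And>\<epsilon>. \<epsilon> \<in> PiE U (\<lambda>_. {-1, 1}) \<Longrightarrow> F \<epsilon> \<le> G \<epsilon>"
  shows "sign_avg U F \<le> sign_avg U G"
  unfolding sign_avg_def using assms by (intro divide_right_mono sum_mono) auto

lemma sign_avg_const [simp]: "finite U \<Longrightarrow> sign_avg U (\<lambda>_. c) = c"
  by (simp add: sign_avg_def card_PiE)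

lemma sign_avg_add: "sign_avg U (\<lambda>\<epsilon>. F \<epsilon> + G \<epsilon>) = sign_avg U F + sign_avg U G"
  by (simp add: sign_avg_def sum.distrib add_divide_distrib)

lemma sign_avg_mult: "sign_avg U (\<lambda>\<epsilon>. c * F \<epsilon>) = c * sign_avg U F"
  by (simp add: sign_avg_def flip: sum_distrib_left)

lemma sign_avg_sum: "sign_avg U (\<lambda>\<epsilon>. \<Sum>i\<in>I. F i \<epsilon>) = (\<Sum>i\<in>I. sign_avg U (F i))"
  unfolding sign_avg_def sum_divide_distrib by (rule sum.swap)

lemma sign_avg_cong:
  assumes "\<And>\<epsilon>. \<epsilon> \<in> PiE U (\<lambda>_. {-1, 1}) \<Longrightarrow> F \<epsilon> = G \<epsilon>"
  shows "sign_avg U F = sign_avg U G"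
  unfolding sign_avg_def using assms by simp

text \<open>\<open>N\<close> is the squared norm of the Hilbert space of families indexed by
  \<open>Z\<close>. When a vector is added, the average over its sign kills the term linear in the
  inner product \<open>ip\<close>; the square of that term survives in the fourth moment and is
  absorbed by Cauchy-Schwarz.\<close>

lemma rademacher_moments:
  fixes v :: "'u \<Rightarrow> 'z \<Rightarrow> 'k::real_inner"
  assumes "finite U" "finite Z"
  defines "N \<equiv> \<lambda>x :: 'z \<Rightarrow> 'k. \<Sum>z\<in>Z. (norm (x z))\<^sup>2"
  shows "sign_avg U (\<lambda>\<epsilon>. N (\<lambda>z. \<Sum>u\<in>U. \<epsilon> u *\<^sub>R v u z)) = (\<Sum>u\<in>U. N (v u))"
    and "sign_avg U (\<lambda>\<epsilon>. (N (\<lambda>z. \<Sum>u\<in>U. \<epsilon> u *\<^sub>R v u z))\<^sup>2) \<le> 3 * (\<Sum>u\<in>U. N (v u))\<^sup>2"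
  using assms(1)
proof (induction U rule: finite_induct)
  case empty
  { case 1 show ?case by (simp add: N_def) }
  { case 2 show ?case by (simp add: N_def) }
next
  case (insert u U)
  define x where "x = (\<lambda>\<epsilon> z. \<Sum>i\<in>U. \<epsilon> i *\<^sub>R v i z)"
  define V where "V = (\<Sum>i\<in>U. N (v i))"
  have upd: "(\<Sum>i\<in>insert u U. (\<epsilon>(u := c)) i *\<^sub>R v i z) = x \<epsilon> z + c *\<^sub>R v u z" for \<epsilon> c z
    using insert.hyps by (auto simp: x_def add.commute intro!: sum.cong)
  define ip where "ip = (\<lambda>\<epsilon>. \<Sum>z\<in>Z. x \<epsilon> z \<bullet> v u z)"
  have plus: "N (\<lambda>z. x \<epsilon> z + 1 *\<^sub>R v u z) = N (x \<epsilon>) + N (v u) + 2 * ip \<epsilon>" for \<epsilon>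
    unfolding N_def ip_def sum.distrib[symmetric] sum_distrib_left
    by (intro sum.cong refl) (simp add: power2_norm_eq_inner algebra_simps inner_commute)
  have minus: "N (\<lambda>z. x \<epsilon> z + (-1) *\<^sub>R v u z) = N (x \<epsilon>) + N (v u) - 2 * ip \<epsilon>" for \<epsilon>
    unfolding N_def ip_def sum.distrib[symmetric] sum_subtractf[symmetric] sum_distrib_left
    by (intro sum.cong refl) (simp add: power2_norm_eq_inner algebra_simps inner_commute)
  have cs: "(ip \<epsilon>)\<^sup>2 \<le> N (x \<epsilon>) * N (v u)" for \<epsilon>
  proof -
    have "\<bar>ip \<epsilon>\<bar> \<le> (\<Sum>z\<in>Z. norm (x \<epsilon> z) * norm (v u z))"
      unfolding ip_def by (rule order_trans[OF sum_abs]) (intro sum_mono Cauchy_Schwarz_ineq2)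
    then have "(ip \<epsilon>)\<^sup>2 \<le> (\<Sum>z\<in>Z. norm (x \<epsilon> z) * norm (v u z))\<^sup>2"
      by (metis abs_ge_zero power2_abs power_mono)
    also have "\<dots> \<le> N (x \<epsilon>) * N (v u)"
      unfolding N_def by (rule Cauchy_Schwarz_ineq_sum)
    finally show ?thesis .
  qed
  have sumV: "(\<Sum>i\<in>insert u U. N (v i)) = V + N (v u)"
    using insert.hyps by (simp add: V_def)
  have IH1: "sign_avg U (\<lambda>\<epsilon>. N (x \<epsilon>)) = V"
    using insert.IH(1) unfolding x_def V_def .
  have IH2: "sign_avg U (\<lambda>\<epsilon>. (N (x \<epsilon>))\<^sup>2) \<le> 3 * V\<^sup>2"
    using insert.IH(2) unfolding x_def V_def .
  {
    case 1
    have "sign_avg (insert u U) (\<lambda>\<epsilon>. N (\<lambda>z. \<Sum>i\<in>insert u U. \<epsilon> i *\<^sub>R v i z))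
      = sign_avg U (\<lambda>\<epsilon>. N (x \<epsilon>) + N (v u))"
      unfolding sign_avg_insert[OF insert.hyps] upd plus minus by (rule sign_avg_cong) simp
    then show ?case
      unfolding sumV using insert.hyps IH1 by (simp add: sign_avg_add)
  }
  {
    case 2
    have "sign_avg (insert u U) (\<lambda>\<epsilon>. (N (\<lambda>z. \<Sum>i\<in>insert u U. \<epsilon> i *\<^sub>R v i z))\<^sup>2)
      = sign_avg U (\<lambda>\<epsilon>. (N (x \<epsilon>) + N (v u))\<^sup>2 + 4 * (ip \<epsilon>)\<^sup>2)"
      unfolding sign_avg_insert[OF insert.hyps] upd plus minus
      by (rule sign_avg_cong) (simp add: power2_eq_square algebra_simps)
    \<comment> \<open>The surviving \<open>4 * (ip \<epsilon>)\<^sup>2\<close> is at most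
      \<open>4 * N (x \<epsilon>) * N (v u)\<close>. With the mixed term of the square this makes
      the factor 6, which is the mixed term of \<open>3 * (V + N (v u))\<^sup>2\<close>; hence the
      constant 3.\<close>
    also have "\<dots> \<le> sign_avg U (\<lambda>\<epsilon>. (N (x \<epsilon>))\<^sup>2 + (6 * N (v u)) * N (x \<epsilon>) + (N (v u))\<^sup>2)"
    proof (rule sign_avg_mono)
      fix \<epsilon>
      show "(N (x \<epsilon>) + N (v u))\<^sup>2 + 4 * (ip \<epsilon>)\<^sup>2
          \<le> (N (x \<epsilon>))\<^sup>2 + (6 * N (v u)) * N (x \<epsilon>) + (N (v u))\<^sup>2"
        using cs[of \<epsilon>] by (simp add: power2_eq_square algebra_simps)
    qed
    also have "\<dots> \<le> 3 * V\<^sup>2 + 6 * N (v u) * V + (N (v u))\<^sup>2"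
      using insert.hyps IH1 IH2 by (simp add: sign_avg_add sign_avg_mult)
    also have "\<dots> \<le> 3 * (V + N (v u))\<^sup>2"
      by (simp add: power2_eq_square algebra_simps)
    finally show ?case unfolding sumV .
  }
qed

text \<open>A random variable whose fourth moment is at most 3 times the square of its second moment
  has a first absolute moment comparable to its L_2 norm. The values lie in a Hilbert space indexed
  by \<open>Z\<close>, so that the inequality can be iterated.\<close>

lemma khinchine_L1:
  fixes v :: "'u \<Rightarrow> 'z \<Rightarrow> 'k::real_inner"
  assumes "finite U" "finite Z"
  shows "sqrt (\<Sum>u\<in>U. \<Sum>z\<in>Z. (norm (v u z))\<^sup>2)
    \<le> sqrt 3 * sign_avg U (\<lambda>\<epsilon>. sqrt (\<Sum>z\<in>Z. (norm (\<Sum>u\<in>U. \<epsilon> u *\<^sub>R v u z))\<^sup>2))"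
proof -
  define V where "V = (\<Sum>u\<in>U. \<Sum>z\<in>Z. (norm (v u z))\<^sup>2)"
  define N where "N = (\<lambda>\<epsilon>. \<Sum>z\<in>Z. (norm (\<Sum>u\<in>U. \<epsilon> u *\<^sub>R v u z))\<^sup>2)"
  have N0: "N \<epsilon> \<ge> 0" for \<epsilon> unfolding N_def by (simp add: sum_nonneg)
  have V0: "V \<ge> 0" unfolding V_def by (simp add: sum_nonneg)
  have m2: "sign_avg U N = V" and m4: "sign_avg U (\<lambda>\<epsilon>. (N \<epsilon>)\<^sup>2) \<le> 3 * V\<^sup>2"
    using rademacher_moments[OF assms, of v] unfolding N_def V_def by auto
  show ?thesis
  proof (cases "V = 0")
    case True
    have "0 \<le> sign_avg U (\<lambda>\<epsilon>. sqrt (N \<epsilon>))"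
      unfolding sign_avg_def by (intro divide_nonneg_nonneg sum_nonneg) (auto simp: N0)
    then show ?thesis using True by (simp add: V_def N_def)
  next
    case False
    \<comment> \<open>The value that maximises the lower bound
      \<open>3 / (2 * r) * V - 3 * V\<^sup>2 / (2 * r ^ 3)\<close> for the first moment.\<close>
    define r where "r = sqrt (3 * V)"
    have r: "r > 0" "r\<^sup>2 = 3 * V" using False V0 by (auto simp: r_def)
    \<comment> \<open>the interpolating inequality \<open>y \<ge> 3y\<^sup>2/(2r) - y\<^sup>4/(2r\<^sup>3)\<close> replaces Hoelder's inequality\<close>
    have key: "3 / (2 * r) * N \<epsilon> + (- 1 / (2 * r ^ 3)) * (N \<epsilon>)\<^sup>2 \<le> sqrt (N \<epsilon>)" for \<epsilon>
    proof -
      define y where "y = sqrt (N \<epsilon>) / r"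
      have y0: "y \<ge> 0" using r N0 by (simp add: y_def)
      have "0 \<le> y * ((y - 1)\<^sup>2 * (y + 2))" using y0 by simp
      then have "3 * y\<^sup>2 - y ^ 4 \<le> 2 * y"
        by (simp add: power2_eq_square power4_eq_xxxx algebra_simps)
      then have "r * (3 * y\<^sup>2 - y ^ 4) \<le> r * (2 * y)"
        using r(1) by (intro mult_left_mono) auto
      moreover have ny: "N \<epsilon> = r\<^sup>2 * y\<^sup>2" "sqrt (N \<epsilon>) = r * y"
        using r(1) N0 by (auto simp: y_def power_divide)
      have "3 / (2 * r) * N \<epsilon> + (- 1 / (2 * r ^ 3)) * (N \<epsilon>)\<^sup>2 = r * (3 * y\<^sup>2 - y ^ 4) / 2"
        unfolding ny(1) using r(1) by (simp add: field_simps power2_eq_square power3_eq_cube power4_eq_xxxx)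
      ultimately show ?thesis unfolding ny(2) by simp
    qed
    have "3 / (2 * r) * V - 3 * V\<^sup>2 / (2 * r ^ 3)
        \<le> 3 / (2 * r) * sign_avg U N + (- 1 / (2 * r ^ 3)) * sign_avg U (\<lambda>\<epsilon>. (N \<epsilon>)\<^sup>2)"
      using m4 r(1) unfolding m2 by (simp add: divide_simps)
    also have "\<dots> = sign_avg U (\<lambda>\<epsilon>. 3 / (2 * r) * N \<epsilon> + (- 1 / (2 * r ^ 3)) * (N \<epsilon>)\<^sup>2)"
      by (simp only: sign_avg_add sign_avg_mult)
    also have "\<dots> \<le> sign_avg U (\<lambda>\<epsilon>. sqrt (N \<epsilon>))"
      by (intro sign_avg_mono key)
    finally have *: "3 / (2 * r) * V - 3 * V\<^sup>2 / (2 * r ^ 3) \<le> sign_avg U (\<lambda>\<epsilon>. sqrt (N \<epsilon>))" .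
    have r3: "r ^ 3 = 3 * V * r" using r(2) by (simp add: power2_eq_square power3_eq_cube)
    have "3 / (2 * r) * V - 3 * V\<^sup>2 / (2 * r ^ 3) = V / r"
      unfolding r3 using False r(1) by (simp add: field_simps power2_eq_square)
    also have "\<dots> = r / 3" using r by (simp add: field_simps power2_eq_square)
    finally have "sqrt 3 * (r / 3) \<le> sqrt 3 * sign_avg U (\<lambda>\<epsilon>. sqrt (N \<epsilon>))" using * by simp
    moreover have "sqrt 3 * (r / 3) = sqrt V"
      by (simp add: r_def real_sqrt_mult)
    ultimately show ?thesis unfolding V_def N_def by linarith
  qed
qed

section \<open>From weighted to unweighted marginal sums\<close>

text \<open>One application of Khinchine's inequality for each index in \<open>D\<close>, at the
  cost of \<open>sqrt 3\<close> each. An index released from its random sum becomes a coordinate of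
  the Hilbert space, stored in the lists in \<open>Z\<close>.\<close>

lemma khinchine_iterated:
  fixes a :: "'w \<Rightarrow> ('l \<Rightarrow> 't) \<Rightarrow> 't list \<Rightarrow> 'k::real_inner"
  assumes "finite D" "finite T" "finite Z"
    and "\<And>\<epsilon>. (\<And>l t. l \<in> D \<Longrightarrow> t \<in> T \<Longrightarrow> \<bar>\<epsilon> l t\<bar> = 1) \<Longrightarrow>
      (\<Sum>\<omega>\<in>W. sqrt (\<Sum>\<tau>\<in>Z. (norm (\<Sum>i\<in>PiE D (\<lambda>_. T). (\<Prod>l\<in>D. \<epsilon> l (i l)) *\<^sub>R a \<omega> i \<tau>))\<^sup>2)) \<le> B"
  shows "(\<Sum>\<omega>\<in>W. sqrt (\<Sum>i\<in>PiE D (\<lambda>_. T). \<Sum>\<tau>\<in>Z. (norm (a \<omega> i \<tau>))\<^sup>2)) \<le> sqrt 3 ^ card D * B"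
  using assms(1,3,4)
proof (induction D arbitrary: Z a B rule: finite_induct)
  case empty
  then show ?case by simp
next
  case (insert l D)
  define Z' where "Z' = (\<lambda>(t, \<tau>). t # \<tau>) ` (T \<times> Z)"
  define a' where "a' = (\<lambda>\<omega> i ts. a \<omega> (i(l := hd ts)) (tl ts))"
  have inj: "inj_on (\<lambda>(t, \<tau>). t # \<tau>) (T \<times> Z)" by (auto simp: inj_on_def)
  have sumZ': "(\<Sum>ts\<in>Z'. h ts) = (\<Sum>t\<in>T. \<Sum>\<tau>\<in>Z. h (t # \<tau>))" for h :: "'t list \<Rightarrow> real"
    unfolding Z'_def sum.reindex[OF inj] sum.cartesian_product by (simp add: case_prod_beta)
  have fin: "finite Z'" using assms(2) insert.prems(1) by (simp add: Z'_def)
  have "(\<Sum>\<omega>\<in>W. sqrt (\<Sum>i\<in>PiE D (\<lambda>_. T). \<Sum>\<tau>\<in>Z'. (norm (a' \<omega> i \<tau>))\<^sup>2))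
      \<le> sqrt 3 ^ card D * (sqrt 3 * B)"
  proof (rule insert.IH[OF fin])
    fix \<epsilon> :: "'l \<Rightarrow> 't \<Rightarrow> real"
    assume \<epsilon>: "\<And>l t. l \<in> D \<Longrightarrow> t \<in> T \<Longrightarrow> \<bar>\<epsilon> l t\<bar> = 1"
    define v where "v = (\<lambda>\<omega> t \<tau>. \<Sum>i\<in>PiE D (\<lambda>_. T). (\<Prod>l\<in>D. \<epsilon> l (i l)) *\<^sub>R a \<omega> (i(l := t)) \<tau>)"
    have "(\<Sum>\<omega>\<in>W. sqrt (\<Sum>\<tau>\<in>Z'. (norm (\<Sum>i\<in>PiE D (\<lambda>_. T). (\<Prod>l\<in>D. \<epsilon> l (i l)) *\<^sub>R a' \<omega> i \<tau>))\<^sup>2))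
       = (\<Sum>\<omega>\<in>W. sqrt (\<Sum>t\<in>T. \<Sum>\<tau>\<in>Z. (norm (v \<omega> t \<tau>))\<^sup>2))"
      unfolding sumZ' by (simp add: a'_def v_def)
    also have "\<dots> \<le> (\<Sum>\<omega>\<in>W. sqrt 3 * sign_avg T (\<lambda>\<delta>. sqrt (\<Sum>\<tau>\<in>Z. (norm (\<Sum>t\<in>T. \<delta> t *\<^sub>R v \<omega> t \<tau>))\<^sup>2)))"
      by (intro sum_mono khinchine_L1 assms insert.prems)
    also have "\<dots> = sqrt 3 * sign_avg T (\<lambda>\<delta>. \<Sum>\<omega>\<in>W. sqrt (\<Sum>\<tau>\<in>Z. (norm (\<Sum>t\<in>T. \<delta> t *\<^sub>R v \<omega> t \<tau>))\<^sup>2))"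
      by (simp add: sign_avg_sum sum_distrib_left)
    \<comment> \<open>Every choice \<open>\<delta>\<close> of signs for \<open>l\<close> extends
      \<open>\<epsilon>\<close> to an admissible choice on \<open>insert l D\<close>, so each term
      of the average is at most \<open>B\<close>.\<close>
    also have "\<dots> \<le> sqrt 3 * sign_avg T (\<lambda>_. B)"
    proof (intro mult_left_mono sign_avg_mono)
      fix \<delta> :: "'t \<Rightarrow> real" assume \<delta>: "\<delta> \<in> PiE T (\<lambda>_. {-1, 1})"
      have *: "(\<Sum>t\<in>T. \<delta> t *\<^sub>R v \<omega> t \<tau>)
        = (\<Sum>i\<in>PiE (insert l D) (\<lambda>_. T). (\<Prod>j\<in>insert l D. (\<epsilon>(l := \<delta>)) j (i j)) *\<^sub>R a \<omega> i \<tau>)" for \<omega> \<tau>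
      proof -
        have "(\<Prod>j\<in>D. (\<epsilon>(l := \<delta>)) j ((i(l := t)) j)) = (\<Prod>j\<in>D. \<epsilon> j (i j))" for i t
          using insert.hyps by (intro prod.cong) auto
        then show ?thesis
          using insert.hyps by (simp add: sum_PiE_insert v_def scaleR_sum_right)
      qed
      have "\<bar>(\<epsilon>(l := \<delta>)) j t\<bar> = 1" if "j \<in> insert l D" "t \<in> T" for j t
        using that \<epsilon> PiE_mem[OF \<delta>] by fastforce
      from insert.prems(2)[OF this]
      show "(\<Sum>\<omega>\<in>W. sqrt (\<Sum>\<tau>\<in>Z. (norm (\<Sum>t\<in>T. \<delta> t *\<^sub>R v \<omega> t \<tau>))\<^sup>2)) \<le> B"
        unfolding * by simp
    qed simp
    also have "\<dots> = sqrt 3 * B" using assms(2) by simp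
    finally show "(\<Sum>\<omega>\<in>W. sqrt (\<Sum>\<tau>\<in>Z'. (norm (\<Sum>i\<in>PiE D (\<lambda>_. T).
      (\<Prod>l\<in>D. \<epsilon> l (i l)) *\<^sub>R a' \<omega> i \<tau>))\<^sup>2)) \<le> sqrt 3 * B" .
  qed
  moreover have "(\<Sum>i\<in>PiE (insert l D) (\<lambda>_. T). \<Sum>\<tau>\<in>Z. (norm (a \<omega> i \<tau>))\<^sup>2)
      = (\<Sum>i\<in>PiE D (\<lambda>_. T). \<Sum>\<tau>\<in>Z'. (norm (a' \<omega> i \<tau>))\<^sup>2)" for \<omega>
    unfolding sumZ' sum_PiE_insert[OF insert.hyps(2)] by (subst sum.swap) (simp add: a'_def)
  ultimately show ?case using insert.hyps by (simp add: mult.assoc mult.commute)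
qed

lemma sum_PiE_fiber:
  assumes "finite K" "finite T" "k \<in> K" "t \<in> T"
  shows "(\<Sum>i\<in>{i \<in> PiE K (\<lambda>_. T). i k = t}. f i) = (\<Sum>i\<in>PiE (K - {k}) (\<lambda>_. T). f (i(k := t)))"
proof -
  have K: "insert k (K - {k}) = K" using assms by auto
  have "(\<Sum>i\<in>{i \<in> PiE K (\<lambda>_. T). i k = t}. f i)
      = (\<Sum>i\<in>PiE (insert k (K - {k})) (\<lambda>_. T). if i k = t then f i else 0)"
    unfolding K using assms by (simp add: sum.inter_filter finite_PiE)
  also have "\<dots> = (\<Sum>s\<in>T. if s = t then \<Sum>i\<in>PiE (K - {k}) (\<lambda>_. T). f (i(k := s)) else 0)"
    by (subst sum_PiE_insert) (auto intro!: sum.cong)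
  also have "\<dots> = (\<Sum>i\<in>PiE (K - {k}) (\<lambda>_. T). f (i(k := t)))"
    using assms by (simp add: sum.delta)
  finally show ?thesis .
qed

text \<open>The argument number \<open>k\<close> is chosen by duality, which yields the sum over
  \<open>t\<close> of the norms of the remaining forms. The other arguments are signs times weights,
  and averaging over the signs produces the square roots of sums of squares.\<close>

lemma khinchine_multilinear_form:
  fixes a :: "('l \<Rightarrow> 't) \<Rightarrow> 'k::{real_normed_field,real_inner}" and w :: "'l \<Rightarrow> 't \<Rightarrow> real"
  assumes "finite K" "finite T" "k \<in> K"
    and w: "\<And>l t. l \<in> K \<Longrightarrow> t \<in> T \<Longrightarrow> 0 \<le> w l t"
    and bound: "\<And>x. (\<And>l t. l \<in> K \<Longrightarrow> t \<in> T \<Longrightarrow> norm (x l t) \<le> w l t) \<Longrightarrow>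
      norm (\<Sum>i\<in>PiE K (\<lambda>_. T). a i * (\<Prod>l\<in>K. x l (i l))) \<le> B"
  shows "(\<Sum>t\<in>T. sqrt (\<Sum>i\<in>{i \<in> PiE K (\<lambda>_. T). i k = t}. (norm (a i) * (\<Prod>l\<in>K. w l (i l)))\<^sup>2))
    \<le> sqrt 3 ^ (card K - 1) * B"
proof -
  define D where "D = K - {k}"
  have K: "K = insert k D" "k \<notin> D" "finite D" using assms by (auto simp: D_def)
  define W where "W = (\<lambda>i. \<Prod>l\<in>K. w l (i l))"
  define a' where "a' = (\<lambda>t i (_ :: 't list). W (i(k := t)) *\<^sub>R a (i(k := t)))"
  have Wk: "W (i(k := t)) = w k t * (\<Prod>l\<in>D. w l (i l))" for i t
  proof -
    have "(\<Prod>l\<in>D. w l ((i(k := t)) l)) = (\<Prod>l\<in>D. w l (i l))"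
      using K by (intro prod.cong) auto
    then show ?thesis using K by (simp add: W_def)
  qed
  have "(\<Sum>t\<in>T. sqrt (\<Sum>i\<in>PiE D (\<lambda>_. T). \<Sum>\<tau>\<in>{[]}. (norm (a' t i \<tau>))\<^sup>2)) \<le> sqrt 3 ^ card D * B"
  proof (rule khinchine_iterated)
    fix \<epsilon> :: "'l \<Rightarrow> 't \<Rightarrow> real"
    assume \<epsilon>: "\<And>l t. l \<in> D \<Longrightarrow> t \<in> T \<Longrightarrow> \<bar>\<epsilon> l t\<bar> = 1"
    define c where "c = (\<lambda>t. \<Sum>i\<in>PiE D (\<lambda>_. T). (\<Prod>l\<in>D. \<epsilon> l (i l) * w l (i l)) *\<^sub>R a (i(k := t)))"
    \<comment> \<open>Multiplication by \<open>y t\<close> turns \<open>c t\<close> into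
      \<open>w k t * norm (c t)\<close>; where \<open>c t = 0\<close> the default value 0
      serves.\<close>
    define y where "y = (\<lambda>t. of_real (w k t) * (if c t = 0 then 0 else of_real (norm (c t)) / c t))"
    define x where "x = (\<lambda>l t. if l = k then y t else of_real (\<epsilon> l t * w l t))"
    have "norm (x l t) \<le> w l t" if "l \<in> K" "t \<in> T" for l t
    proof (cases "l = k")
      case True
      then show ?thesis
        using w[OF that] by (auto simp: x_def y_def norm_mult norm_divide)
    next
      case False
      then have "l \<in> D" using that K by auto
      then show ?thesis
        using w[OF that] \<epsilon>[of l t] that False by (simp add: x_def norm_mult)
    qed
    then have "norm (\<Sum>i\<in>PiE K (\<lambda>_. T). a i * (\<Prod>l\<in>K. x l (i l))) \<le> B" by (rule bound)
    also have "(\<Sum>i\<in>PiE K (\<lambda>_. T). a i * (\<Prod>l\<in>K. x l (i l))) = (\<Sum>t\<in>T. y t * c t)"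
    proof -
      have "(\<Prod>l\<in>D. x l ((i(k := t)) l)) = (\<Prod>l\<in>D. of_real (\<epsilon> l (i l) * w l (i l)))" for i t
        using K by (intro prod.cong) (auto simp: x_def)
      then have "a (i(k := t)) * (\<Prod>l\<in>K. x l ((i(k := t)) l))
          = y t * ((\<Prod>l\<in>D. \<epsilon> l (i l) * w l (i l)) *\<^sub>R a (i(k := t)))" for i t
        using K by (simp add: x_def scaleR_conv_of_real mult_ac)
      then show ?thesis
        unfolding K(1) sum_PiE_insert[OF K(2)]
        by (simp add: K(1)[symmetric] c_def sum_distrib_left)
    qed
    also have "(\<Sum>t\<in>T. y t * c t) = of_real (\<Sum>t\<in>T. w k t * norm (c t))"
      by (auto simp: y_def intro!: sum.cong)
    also have "norm (of_real (\<Sum>t\<in>T. w k t * norm (c t)) :: 'k) = (\<Sum>t\<in>T. w k t * norm (c t))"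
      using w assms(3) by (simp only: norm_of_real) (auto intro!: abs_of_nonneg sum_nonneg)
    also have "\<dots> = (\<Sum>t\<in>T. sqrt (\<Sum>\<tau>\<in>{[]}. (norm (\<Sum>i\<in>PiE D (\<lambda>_. T). (\<Prod>l\<in>D. \<epsilon> l (i l)) *\<^sub>R a' t i \<tau>))\<^sup>2))"
    proof (rule sum.cong[OF refl])
      fix t assume "t \<in> T"
      have "(\<Sum>i\<in>PiE D (\<lambda>_. T). (\<Prod>l\<in>D. \<epsilon> l (i l)) *\<^sub>R a' t i \<tau>) = w k t *\<^sub>R c t" for \<tau>
        by (simp add: a'_def c_def Wk scaleR_sum_right prod.distrib mult_ac)
      then show "w k t * norm (c t)
        = sqrt (\<Sum>\<tau>\<in>{[]}. (norm (\<Sum>i\<in>PiE D (\<lambda>_. T). (\<Prod>l\<in>D. \<epsilon> l (i l)) *\<^sub>R a' t i \<tau>))\<^sup>2)"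
        using w[OF assms(3) \<open>t \<in> T\<close>] by simp
    qed
    finally show "(\<Sum>t\<in>T. sqrt (\<Sum>\<tau>\<in>{[]}. (norm (\<Sum>i\<in>PiE D (\<lambda>_. T). (\<Prod>l\<in>D. \<epsilon> l (i l)) *\<^sub>R a' t i \<tau>))\<^sup>2)) \<le> B" .
  qed (use assms K in auto)
  moreover have "(\<Sum>i\<in>{i \<in> PiE K (\<lambda>_. T). i k = t}. (norm (a i) * (\<Prod>l\<in>K. w l (i l)))\<^sup>2)
      = (\<Sum>i\<in>PiE D (\<lambda>_. T). \<Sum>\<tau>\<in>{[]}. (norm (a' t i \<tau>))\<^sup>2)" if "t \<in> T" for t
    unfolding sum_PiE_fiber[OF assms(1-3) that] D_def[symmetric]
    by (simp add: a'_def W_def power_mult_distrib mult_ac)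
  ultimately show ?thesis
    using K by simp
qed

text \<open>
  Writing \<open>\<alpha>\<close> for the marginal sums along \<open>l\<close> and \<open>e = 1 / (2 (\<kappa>' - r))\<close>, the weight to test with is
  \<open>g = \<alpha>\<^sup>e / \<Sum> \<alpha>\<^sup>e\<close>. For \<open>k = l\<close> this is duality. For \<open>k \<noteq> l\<close> the marginal along \<open>k\<close> is split by
  Hoelder's inequality into a part weighted by a positive power of \<open>\<alpha>\<close>, which the hypothesis for
  this \<open>g\<close> controls, and one weighted by \<open>\<alpha>\<^bsup>e - 1\<^esup>\<close>, whose total is \<open>\<Sum> \<alpha>\<^sup>e\<close>.
\<close>

lemma drop_weight:
  fixes b :: "'x \<Rightarrow> real" and c :: "'l \<Rightarrow> 'x \<Rightarrow> 't" and r \<kappa>' D :: real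
  assumes fin: "finite X" "finite T"
    and b: "\<And>x. x \<in> X \<Longrightarrow> 0 \<le> b x"
    and c: "\<And>l x. l \<in> K \<Longrightarrow> x \<in> X \<Longrightarrow> c l x \<in> T"
    and l: "l \<in> K" and r: "0 \<le> r" and \<kappa>: "1 / 2 \<le> \<kappa>' - r" and D: "0 \<le> D"
    and bound: "\<And>g k. (\<And>t. t \<in> T \<Longrightarrow> 0 \<le> g t) \<Longrightarrow> (\<Sum>t\<in>T. g t) \<le> 1 \<Longrightarrow> k \<in> K \<Longrightarrow>
      (\<Sum>t\<in>T. (\<Sum>x\<in>{x \<in> X. c k x = t}. b x * (g (c l x) powr r)\<^sup>2) powr (1 / (2 * \<kappa>')))
        \<le> D powr (1 / \<kappa>')"
    and k: "k \<in> K"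
  shows "(\<Sum>t\<in>T. (\<Sum>x\<in>{x \<in> X. c k x = t}. b x) powr (1 / (2 * (\<kappa>' - r)))) \<le> D powr (1 / (\<kappa>' - r))"
proof -
  define \<kappa> where "\<kappa> = \<kappa>' - r"
  define e where "e = 1 / (2 * \<kappa>)"
  define e' where "e' = 1 / (2 * \<kappa>')"
  have pos: "\<kappa> > 0" "\<kappa>' > 0" "e > 0" "e' > 0" "\<kappa> \<ge> 1 / 2" "\<kappa>' \<ge> \<kappa>"
    using \<kappa> r by (auto simp: \<kappa>_def e_def e'_def)
  have e1: "e \<le> 1" using pos by (simp add: e_def)
  define \<alpha> where "\<alpha> = (\<lambda>t. \<Sum>x\<in>{x \<in> X. c l x = t}. b x)"
  define S where "S = (\<Sum>t\<in>T. \<alpha> t powr e)"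
  have \<alpha>0: "\<alpha> t \<ge> 0" for t unfolding \<alpha>_def using b by (auto intro!: sum_nonneg)
  have \<alpha>pos: "\<alpha> (c l x) > 0" if "x \<in> X" "b x \<noteq> 0" for x
  proof -
    have "b x \<le> \<alpha> (c l x)" unfolding \<alpha>_def using fin b that by (intro member_le_sum) auto
    then show ?thesis using b[OF that(1)] that(2) by simp
  qed
  have group: "(\<Sum>t\<in>T. \<Sum>x\<in>{x \<in> X. c j x = t}. h x) = (\<Sum>x\<in>X. h x)" if "j \<in> K" for j and h :: "'x \<Rightarrow> real"
    using fin c that by (intro sum.group) auto
  show ?thesis
  proof (cases "S = 0")
    case True
    have "b x = 0" if x: "x \<in> X" for x
    proof (rule ccontr)
      assume "b x \<noteq> 0"
      then have "0 < \<alpha> (c l x)" using \<alpha>pos x by simp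
      moreover have "\<alpha> (c l x) powr e = 0"
        using True fin c[OF l x] by (simp add: S_def sum_nonneg_eq_0_iff)
      ultimately show False by simp
    qed
    then show ?thesis by simp
  next
    case False
    then have S: "S > 0" unfolding S_def by (metis sum_nonneg powr_ge_zero less_eq_real_def)
    define g where "g = (\<lambda>t. \<alpha> t powr e / S)"
    have g0: "\<And>t. t \<in> T \<Longrightarrow> 0 \<le> g t" and g1: "(\<Sum>t\<in>T. g t) \<le> 1"
      using S by (auto simp: g_def S_def simp flip: sum_divide_distrib)
    have gr: "(g t powr r)\<^sup>2 = \<alpha> t powr (2 * r * e) * S powr (- (2 * r))" if "\<alpha> t > 0" for t
    proof -
      have "g t powr r = \<alpha> t powr (r * e) * S powr (- r)"
      proof -
        have "g t powr r = \<alpha> t powr (e * r) / S powr r"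
          using that S by (simp add: g_def powr_divide powr_powr)
        then show ?thesis by (simp add: powr_minus field_simps)
      qed
      then show ?thesis
        by (simp add: power2_eq_square powr_add[symmetric] mult_ac)
    qed
    have fibl: "(\<Sum>x\<in>{x \<in> X. c l x = t}. b x * h (c l x)) = \<alpha> t * h t" for t and h :: "'t \<Rightarrow> real"
      by (simp add: \<alpha>_def sum_distrib_right)
    have \<kappa>e: "1 + 2 * r * e = \<kappa>' / \<kappa>" "1 - 2 * r * e' = \<kappa> / \<kappa>'" "e' * (\<kappa>' / \<kappa>) = e"
      using pos by (auto simp: e_def e'_def \<kappa>_def field_simps)
    \<comment> \<open>The hypothesis for \<open>k = l\<close>: with this \<open>g\<close> each
      summand is \<open>\<alpha> t powr e\<close> times a power of \<open>S\<close>, so the left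
      side collapses to a power of \<open>S\<close>.\<close>
    have "S powr (\<kappa> / \<kappa>') = S * S powr (- (2 * r * e'))"
      unfolding \<kappa>e(2)[symmetric] using S by (simp add: powr_diff powr_minus divide_inverse)
    also have "\<dots> = (\<Sum>t\<in>T. \<alpha> t powr e * S powr (- (2 * r * e')))"
      unfolding sum_distrib_right[symmetric] S_def[symmetric] ..
    also have "\<dots> = (\<Sum>t\<in>T. (\<Sum>x\<in>{x \<in> X. c l x = t}. b x * (g (c l x) powr r)\<^sup>2) powr e')"
    proof (rule sum.cong[OF refl])
      fix t
      show "\<alpha> t powr e * S powr (- (2 * r * e')) = (\<Sum>x\<in>{x \<in> X. c l x = t}. b x * (g (c l x) powr r)\<^sup>2) powr e'"
      proof (cases "\<alpha> t = 0")
        case False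
        then have \<alpha>: "\<alpha> t > 0" using \<alpha>0[of t] by simp
        have "\<alpha> t * (g t powr r)\<^sup>2 = \<alpha> t powr (1 + 2 * r * e) * S powr (- (2 * r))"
          using \<alpha> by (simp add: gr powr_add)
        then have "(\<alpha> t * (g t powr r)\<^sup>2) powr e' = \<alpha> t powr (e' * (1 + 2 * r * e)) * S powr (- (2 * r * e'))"
          using \<alpha> S by (simp add: powr_mult powr_powr mult_ac)
        then show ?thesis unfolding \<kappa>e(1) \<kappa>e(3) fibl[where h = "\<lambda>t. (g t powr r)\<^sup>2"] by simp
      qed (unfold fibl[where h = "\<lambda>t. (g t powr r)\<^sup>2"], simp)
    qed
    also have "\<dots> \<le> D powr (1 / \<kappa>')"
      unfolding e'_def by (rule bound[OF g0 g1 l])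
    finally have "S powr (\<kappa> / \<kappa>') \<le> D powr (1 / \<kappa>')" .
    then have "(S powr (\<kappa> / \<kappa>')) powr (\<kappa>' / \<kappa>) \<le> (D powr (1 / \<kappa>')) powr (\<kappa>' / \<kappa>)"
      using pos by (intro powr_mono2) auto
    then have SD: "S \<le> D powr (2 * e)"
      using pos S by (simp add: powr_powr e_def)
    then have Dpos: "D > 0" using S D by (cases "D = 0") auto
    define B where "B = (\<lambda>t. \<Sum>x\<in>{x \<in> X. c k x = t}. b x)"
    have B0: "B t \<ge> 0" for t unfolding B_def using b by (auto intro!: sum_nonneg)
    have "(\<Sum>t\<in>T. B t powr e) \<le> D powr (2 * e)"
    proof (cases "e = 1")
      \<comment> \<open>Here \<open>\<kappa> = 1 / 2\<close>, and the marginal sums along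
        \<open>k\<close> and along \<open>l\<close> have the same total.\<close>
      case True
      then have "(\<Sum>t\<in>T. B t powr e) = (\<Sum>x\<in>X. b x)"
        using B0 group[OF k, of b] by (simp add: B_def)
      also have "\<dots> = S"
        using True \<alpha>0 group[OF l, of b] by (simp add: S_def \<alpha>_def)
      finally show ?thesis using SD by simp
    next
      case False
      then have "\<kappa> > 1 / 2" using pos by (auto simp: e_def less_eq_real_def)
      \<comment> \<open>\<open>\<tau>\<close> is the solution of \<open>id1\<close>: in the product
        of the two parts with exponents \<open>\<tau>\<close> and \<open>1 - \<tau>\<close> the
        powers of \<open>\<alpha>\<close> cancel. Then \<open>id2\<close> says that the exponents in
        the final use of Hoelder's inequality add up to 1.\<close>
      define \<tau> where "\<tau> = (2 * \<kappa> - 1) / (2 * \<kappa>' - 1)"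
      have \<tau>: "0 \<le> \<tau>" "\<tau> \<le> 1" "\<tau> * (2 * \<kappa>' - 1) = 2 * \<kappa> - 1"
        using \<open>\<kappa> > 1 / 2\<close> pos by (auto simp: \<tau>_def divide_simps)
      have id1: "\<tau> * (2 * r * e) + (1 - \<tau>) * (e - 1) = 0"
      proof -
        have "\<tau> * (2 * r * e) + (1 - \<tau>) * (e - 1) = (\<tau> * (2 * r + 2 * \<kappa> - 1) - (2 * \<kappa> - 1)) / (2 * \<kappa>)"
          using pos by (simp add: e_def field_simps)
        also have "\<dots> = 0" using \<tau>(3) by (simp add: \<kappa>_def)
        finally show ?thesis .
      qed
      have id2: "\<tau> * e / e' + (1 - \<tau>) * e = 1"
      proof -
        have "\<tau> * e / e' + (1 - \<tau>) * e = (\<tau> * (2 * \<kappa>' - 1) + 1) / (2 * \<kappa>)"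
          using pos by (simp add: e_def e'_def field_simps)
        also have "\<dots> = 1" unfolding \<tau>(3) using pos by simp
        finally show ?thesis .
      qed
      define u where "u = (\<lambda>t. \<Sum>x\<in>{x \<in> X. c k x = t}. b x * \<alpha> (c l x) powr (2 * r * e))"
      define v where "v = (\<lambda>t. \<Sum>x\<in>{x \<in> X. c k x = t}. b x * \<alpha> (c l x) powr (e - 1))"
      have u0: "u t \<ge> 0" and v0: "v t \<ge> 0" for t
        unfolding u_def v_def using b by (auto intro!: sum_nonneg)
      have Buv: "B t \<le> u t powr \<tau> * v t powr (1 - \<tau>)" for t
      proof -
        have "B t \<le> (\<Sum>x\<in>{x \<in> X. c k x = t}. (b x * \<alpha> (c l x) powr (2 * r * e)) powr \<tau>
            * (b x * \<alpha> (c l x) powr (e - 1)) powr (1 - \<tau>))"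
          unfolding B_def
        proof (intro sum_mono)
          fix x assume "x \<in> {x \<in> X. c k x = t}"
          then have x: "x \<in> X" by simp
          show "b x \<le> (b x * \<alpha> (c l x) powr (2 * r * e)) powr \<tau> * (b x * \<alpha> (c l x) powr (e - 1)) powr (1 - \<tau>)"
          proof (cases "b x = 0")
            case False
            then have p: "\<alpha> (c l x) > 0" "b x > 0" using \<alpha>pos x b[OF x] by auto
            have "(b x * \<alpha> (c l x) powr (2 * r * e)) powr \<tau> * (b x * \<alpha> (c l x) powr (e - 1)) powr (1 - \<tau>)
              = b x powr (\<tau> + (1 - \<tau>)) * \<alpha> (c l x) powr (\<tau> * (2 * r * e) + (1 - \<tau>) * (e - 1))"
              unfolding powr_add using p by (simp add: powr_mult powr_powr mult_ac)
            also have "\<dots> = b x" unfolding id1 using p by simp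
            finally show ?thesis by simp
          qed simp
        qed
        also have "\<dots> \<le> u t powr \<tau> * v t powr (1 - \<tau>)"
          unfolding u_def v_def using fin b \<tau> by (intro Holder_sum_powr) auto
        finally show ?thesis .
      qed
      have sumu: "(\<Sum>t\<in>T. u t powr e') \<le> D powr (2 * e') * S powr (2 * r * e')"
      proof -
        have "(\<Sum>x\<in>{x \<in> X. c k x = t}. b x * (g (c l x) powr r)\<^sup>2) = u t * S powr (- (2 * r))" for t
          unfolding u_def sum_distrib_right
        proof (rule sum.cong[OF refl])
          fix x assume "x \<in> {x \<in> X. c k x = t}"
          then show "b x * (g (c l x) powr r)\<^sup>2 = b x * \<alpha> (c l x) powr (2 * r * e) * S powr (- (2 * r))"
            using gr \<alpha>pos by (cases "b x = 0") auto
        qed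
        then have "(\<Sum>t\<in>T. (u t * S powr (- (2 * r))) powr e') \<le> D powr (1 / \<kappa>')"
          using bound[OF g0 g1 k] by (simp add: e'_def)
        then have "(\<Sum>t\<in>T. u t powr e') * S powr (- (2 * r * e')) \<le> D powr (2 * e')"
          using u0 S pos by (simp add: powr_mult powr_powr sum_distrib_right e'_def)
        then show ?thesis using S by (simp add: powr_minus divide_simps)
      qed
      have sumv: "(\<Sum>t\<in>T. v t) = S"
      proof -
        have "(\<Sum>t\<in>T. v t) = (\<Sum>x\<in>X. b x * \<alpha> (c l x) powr (e - 1))"
          unfolding v_def by (rule group[OF k])
        also have "\<dots> = (\<Sum>t\<in>T. \<Sum>x\<in>{x \<in> X. c l x = t}. b x * \<alpha> (c l x) powr (e - 1))"
          by (rule group[OF l, symmetric])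
        also have "\<dots> = (\<Sum>t\<in>T. \<alpha> t * \<alpha> t powr (e - 1))"
          by (simp only: fibl[where h = "\<lambda>t. \<alpha> t powr (e - 1)"])
        also have "\<dots> = S"
          unfolding S_def using \<alpha>0 by (intro sum.cong refl) (simp add: powr_mult_base)
        finally show ?thesis .
      qed
      have "(\<Sum>t\<in>T. B t powr e) \<le> (\<Sum>t\<in>T. (u t powr e') powr (\<tau> * e / e') * v t powr ((1 - \<tau>) * e))"
      proof (rule sum_mono)
        fix t
        have "B t powr e \<le> (u t powr \<tau> * v t powr (1 - \<tau>)) powr e"
          using Buv B0 pos by (intro powr_mono2) auto
        also have "\<dots> = (u t powr e') powr (\<tau> * e / e') * v t powr ((1 - \<tau>) * e)"
          using pos by (simp add: powr_mult powr_powr)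
        finally show "B t powr e \<le> (u t powr e') powr (\<tau> * e / e') * v t powr ((1 - \<tau>) * e)" .
      qed
      also have "\<dots> \<le> (\<Sum>t\<in>T. u t powr e') powr (\<tau> * e / e') * (\<Sum>t\<in>T. v t) powr ((1 - \<tau>) * e)"
        using fin v0 \<tau> pos id2 by (intro Holder_sum_powr) auto
      also have "\<dots> \<le> (D powr (2 * e') * S powr (2 * r * e')) powr (\<tau> * e / e') * S powr ((1 - \<tau>) * e)"
        unfolding sumv using sumu \<tau> pos by (intro mult_right_mono powr_mono2) (auto intro!: sum_nonneg)
      also have "\<dots> = D powr (2 * \<tau> * e) * S powr (2 * r * \<tau> * e + (1 - \<tau>) * e)"
        using pos by (simp add: powr_mult powr_powr powr_add mult_ac)
      \<comment> \<open>The exponent of \<open>S\<close> is nonnegative, so the bound on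
        \<open>S\<close> from the case \<open>k = l\<close> can be inserted; by \<open>id1\<close>
        this exponent equals \<open>1 - \<tau>\<close>.\<close>
      also have "\<dots> \<le> D powr (2 * \<tau> * e) * (D powr (2 * e)) powr (2 * r * \<tau> * e + (1 - \<tau>) * e)"
        using SD S \<tau> r pos by (intro mult_left_mono powr_mono2) auto
      also have "2 * r * \<tau> * e + (1 - \<tau>) * e = 1 - \<tau>"
        using id1 by (simp add: algebra_simps)
      also have "D powr (2 * \<tau> * e) * (D powr (2 * e)) powr (1 - \<tau>) = D powr (2 * e)"
        using Dpos by (simp add: powr_powr flip: powr_add) (simp add: algebra_simps)
      finally show ?thesis .
    qed
    moreover have "2 * e = 1 / \<kappa>" by (simp add: e_def)
    ultimately show ?thesis by (simp add: B_def e_def flip: \<kappa>_def)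
  qed
qed

text \<open>The family \<open>b\<close> is generalised in the induction: the squared weight of
  \<open>l\<close> is multiplied into \<open>b\<close>, the induction hypothesis removes the other
  weights, and \<open>drop_weight\<close> with \<open>\<kappa>' = \<kappa> - sum r L\<close> removes
  that of \<open>l\<close>. The bounds for all \<open>k\<close> are carried along because each
  removal uses those for \<open>k\<close> and for \<open>l\<close>.\<close>

lemma drop_weights:
  fixes b :: "'x \<Rightarrow> real" and c :: "'l \<Rightarrow> 'x \<Rightarrow> 't" and r :: "'l \<Rightarrow> real" and \<kappa> D :: real
  assumes "finite L" "L \<subseteq> K" "finite X" "finite T"
    and "\<And>x. x \<in> X \<Longrightarrow> 0 \<le> b x"
    and "\<And>l x. l \<in> K \<Longrightarrow> x \<in> X \<Longrightarrow> c l x \<in> T"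
    and "\<And>l. l \<in> L \<Longrightarrow> 0 \<le> r l" and "1 / 2 \<le> \<kappa> - sum r L" and "0 \<le> D"
    and "\<And>g k. (\<And>l t. l \<in> L \<Longrightarrow> t \<in> T \<Longrightarrow> 0 \<le> g l t) \<Longrightarrow> (\<And>l. l \<in> L \<Longrightarrow> (\<Sum>t\<in>T. g l t) \<le> 1) \<Longrightarrow> k \<in> K \<Longrightarrow>
      (\<Sum>t\<in>T. (\<Sum>x\<in>{x \<in> X. c k x = t}. b x * (\<Prod>l\<in>L. (g l (c l x) powr r l)\<^sup>2)) powr (1 / (2 * \<kappa>)))
        \<le> D powr (1 / \<kappa>)"
    and "k \<in> K"
  shows "(\<Sum>t\<in>T. (\<Sum>x\<in>{x \<in> X. c k x = t}. b x) powr (1 / (2 * (\<kappa> - sum r L)))) \<le> D powr (1 / (\<kappa> - sum r L))"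
  using assms(1,2,5,7,8,10,11)
proof (induction L arbitrary: b k rule: finite_induct)
  case empty
  from empty.prems(5)[of "\<lambda>_ _. 0" k] show ?case using empty.prems by simp
next
  case (insert l L)
  have sumr: "\<kappa> - sum r (insert l L) = (\<kappa> - sum r L) - r l" using insert.hyps by simp
  have \<kappa>L: "1 / 2 \<le> \<kappa> - sum r L"
    using insert.prems(3)[of l] insert.prems(4) unfolding sumr by simp
  show ?case unfolding sumr
  proof (rule drop_weight[where K = K and c = c and l = l])
    fix g :: "'t \<Rightarrow> real" and k
    assume g: "\<And>t. t \<in> T \<Longrightarrow> 0 \<le> g t" "(\<Sum>t\<in>T. g t) \<le> 1" and k: "k \<in> K"
    show "(\<Sum>t\<in>T. (\<Sum>x\<in>{x \<in> X. c k x = t}. b x * (g (c l x) powr r l)\<^sup>2) powr (1 / (2 * (\<kappa> - sum r L))))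
        \<le> D powr (1 / (\<kappa> - sum r L))"
    proof (rule insert.IH)
      fix h :: "'l \<Rightarrow> 't \<Rightarrow> real" and k
      assume h: "\<And>l t. l \<in> L \<Longrightarrow> t \<in> T \<Longrightarrow> 0 \<le> h l t" "\<And>l. l \<in> L \<Longrightarrow> (\<Sum>t\<in>T. h l t) \<le> 1" and k: "k \<in> K"
      have A: "0 \<le> (h(l := g)) j t" if "j \<in> insert l L" "t \<in> T" for j t
        using g h that by auto
      have B: "(\<Sum>t\<in>T. (h(l := g)) j t) \<le> 1" if "j \<in> insert l L" for j
        using g h that by auto
      have "(\<Prod>j\<in>L. (((h(l := g)) j) (c j x) powr r j)\<^sup>2) = (\<Prod>j\<in>L. (h j (c j x) powr r j)\<^sup>2)" for x
        using insert.hyps by (intro prod.cong) auto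
      then show "(\<Sum>t\<in>T. (\<Sum>x\<in>{x \<in> X. c k x = t}. b x * (g (c l x) powr r l)\<^sup>2 * (\<Prod>l\<in>L. (h l (c l x) powr r l)\<^sup>2)) powr (1 / (2 * \<kappa>)))
        \<le> D powr (1 / \<kappa>)"
        using insert.prems(5)[where g = "h(l := g)", OF A B k] insert.hyps by (simp add: mult_ac)
    qed (use insert.prems(1-3) \<kappa>L k in auto)
  qed (use insert.prems insert.hyps assms \<kappa>L in auto)
qed

section \<open>Mixed norms\<close>

text \<open>Unlike \<^const>\<open>nested_sum\<close>, this includes the outermost root, hence is homogeneous.\<close>

fun nest :: "real list \<Rightarrow> 't set \<Rightarrow> ('t list \<Rightarrow> real) \<Rightarrow> real" where
  "nest [] T a = a []"
| "nest (q # qs) T a = (\<Sum>t\<in>T. nest qs T (\<lambda>is. a (t # is)) powr q) powr (1 / q)"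

lemma nest_nonneg: "(\<And>is. 0 \<le> a is) \<Longrightarrow> 0 \<le> nest qs T a"
  by (cases qs) auto

lemma nest_mono:
  assumes "\<And>q. q \<in> set qs \<Longrightarrow> 0 < q" "\<And>is. 0 \<le> a is"
    and "\<And>is. set is \<subseteq> T \<Longrightarrow> length is = length qs \<Longrightarrow> a is \<le> b is"
  shows "nest qs T a \<le> nest qs T b"
  using assms
proof (induction qs arbitrary: a b)
  case (Cons q qs)
  have "nest qs T (\<lambda>is. a (t # is)) powr q \<le> nest qs T (\<lambda>is. b (t # is)) powr q" if "t \<in> T" for t
    using Cons.prems that by (intro powr_mono2 Cons.IH nest_nonneg) (auto simp: less_imp_le)
  then have "(\<Sum>t\<in>T. nest qs T (\<lambda>is. a (t # is)) powr q) \<le> (\<Sum>t\<in>T. nest qs T (\<lambda>is. b (t # is)) powr q)"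
    by (rule sum_mono)
  then show ?case
    using Cons.prems(1)[of q] by (auto intro!: powr_mono2 sum_nonneg)
qed simp

lemma nest_cong:
  assumes "\<And>is. set is \<subseteq> T \<Longrightarrow> length is = length qs \<Longrightarrow> a is = b is"
  shows "nest qs T a = nest qs T b"
  using assms
proof (induction qs arbitrary: a b)
  case (Cons q qs)
  have "nest qs T (\<lambda>is. a (t # is)) = nest qs T (\<lambda>is. b (t # is))" if "t \<in> T" for t
    using Cons.prems that by (intro Cons.IH) auto
  then show ?case by simp
qed simp

lemma nest_snoc:
  "nest (qs @ [q]) T a = nest qs T (\<lambda>is. (\<Sum>t\<in>T. a (is @ [t]) powr q) powr (1 / q))"
  by (induction qs arbitrary: a) auto

lemma sum_lists_Suc:
  "(\<Sum>is\<in>{is. set is \<subseteq> T \<and> length is = Suc n}. f is)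
    = (\<Sum>t\<in>T. \<Sum>is\<in>{is. set is \<subseteq> T \<and> length is = n}. f (t # is))"
proof -
  let ?L = "\<lambda>n. {is. set is \<subseteq> T \<and> length is = n}"
  have "?L (Suc n) = (\<lambda>(t, is). t # is) ` (T \<times> ?L n)"
    by (auto simp: image_iff length_Suc_conv)
  moreover have "inj_on (\<lambda>(t, is). t # is) (T \<times> ?L n)" by (auto simp: inj_on_def)
  ultimately show ?thesis
    by (simp only: sum.reindex sum.cartesian_product) (simp add: case_prod_beta)
qed

text \<open>Each \<open>g k\<close> is assumed to act by multiplication from l_2 to l_(qs k) with
  norm at most \<open>G k\<close>. The outermost coordinate is peeled off, the l_2 norm of its
  slices playing the role of \<open>F\<close>.\<close>

lemma nest_Holder:
  fixes g :: "nat \<Rightarrow> 't \<Rightarrow> real"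
  assumes "finite T" "\<And>k. k < M \<Longrightarrow> 0 < qs k" "\<And>k t. 0 \<le> g k t" "\<And>k. k < M \<Longrightarrow> 0 \<le> G k" "\<And>is. 0 \<le> f is"
    and "\<And>k F. k < M \<Longrightarrow> (\<And>t. 0 \<le> F t) \<Longrightarrow>
      (\<Sum>t\<in>T. (g k t * F t) powr qs k) powr (1 / qs k) \<le> G k * sqrt (\<Sum>t\<in>T. (F t)\<^sup>2)"
  shows "nest (map qs [0..<M]) T (\<lambda>is. f is * (\<Prod>k<M. g k (is ! k)))
    \<le> (\<Prod>k<M. G k) * sqrt (\<Sum>is\<in>{is. set is \<subseteq> T \<and> length is = M}. (f is)\<^sup>2)"
  using assms(2-)
proof (induction M arbitrary: qs g G f)
  case 0
  have "{is. set is \<subseteq> T \<and> length is = 0} = {[]}" by auto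
  then show ?case using 0 by simp
next
  case (Suc M)
  define F where "F = (\<lambda>t. sqrt (\<Sum>is\<in>{is. set is \<subseteq> T \<and> length is = M}. (f (t # is))\<^sup>2))"
  define P where "P = (\<Prod>k<M. G (Suc k))"
  have P0: "0 \<le> P" unfolding P_def using Suc.prems by (auto intro!: prod_nonneg)
  have F0: "0 \<le> F t" for t unfolding F_def by (simp add: sum_nonneg)
  have q0: "0 < qs 0" using Suc.prems by simp
  have map: "map qs [0..<Suc M] = qs 0 # map (\<lambda>k. qs (Suc k)) [0..<M]"
    by (simp add: upt_conv_Cons del: upt_Suc) (simp add: map_Suc_upt[symmetric] del: upt_Suc)
  have "nest (map (\<lambda>k. qs (Suc k)) [0..<M]) T (\<lambda>is. f (t # is) * g 0 t * (\<Prod>k<M. g (Suc k) (is ! k)))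
      \<le> P * (g 0 t * F t)" for t
  proof -
    have "nest (map (\<lambda>k. qs (Suc k)) [0..<M]) T (\<lambda>is. f (t # is) * g 0 t * (\<Prod>k<M. g (Suc k) (is ! k)))
      \<le> P * sqrt (\<Sum>is\<in>{is. set is \<subseteq> T \<and> length is = M}. (f (t # is) * g 0 t)\<^sup>2)"
      unfolding P_def by (rule Suc.IH) (use Suc.prems in auto)
    also have "sqrt (\<Sum>is\<in>{is. set is \<subseteq> T \<and> length is = M}. (f (t # is) * g 0 t)\<^sup>2) = g 0 t * F t"
      using Suc.prems(2)[of 0 t]
      by (simp add: F_def power_mult_distrib sum_distrib_right[symmetric] real_sqrt_mult)
    finally show ?thesis .
  qed
  then have "(\<Sum>t\<in>T. nest (map (\<lambda>k. qs (Suc k)) [0..<M]) T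
        (\<lambda>is. f (t # is) * g 0 t * (\<Prod>k<M. g (Suc k) (is ! k))) powr qs 0) powr (1 / qs 0)
      \<le> (\<Sum>t\<in>T. (P * (g 0 t * F t)) powr qs 0) powr (1 / qs 0)"
    using less_imp_le[OF q0] Suc.prems
    by (intro powr_mono2 sum_mono sum_nonneg) (auto intro!: nest_nonneg mult_nonneg_nonneg prod_nonneg)
  also have "\<dots> = P * (\<Sum>t\<in>T. (g 0 t * F t) powr qs 0) powr (1 / qs 0)"
    using P0 F0 q0 Suc.prems(2)
    by (simp add: powr_mult powr_powr sum_nonneg flip: sum_distrib_left)
  also have "\<dots> \<le> P * (G 0 * sqrt (\<Sum>t\<in>T. (F t)\<^sup>2))"
    using P0 F0 Suc.prems(5)[of 0 F] by (intro mult_left_mono) auto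
  also have "(\<Sum>t\<in>T. (F t)\<^sup>2) = (\<Sum>is\<in>{is. set is \<subseteq> T \<and> length is = Suc M}. (f is)\<^sup>2)"
    unfolding sum_lists_Suc by (simp add: F_def sum_nonneg)
  finally show ?case
    unfolding map nest.simps prod.lessThan_Suc_shift by (simp add: P_def mult_ac)
qed

lemma sum_lists_eq_sum_PiE:
  "(\<Sum>is\<in>{is. set is \<subseteq> T \<and> length is = M}. f (\<lambda>k\<in>{..<M}. is ! k)) = (\<Sum>i\<in>PiE {..<M} (\<lambda>_. T). f i)"
proof (rule sum.reindex_bij_witness[where i = "\<lambda>i. map i [0..<M]" and j = "\<lambda>is. \<lambda>k\<in>{..<M}. is ! k"])
  fix xs assume "xs \<in> {is. set is \<subseteq> T \<and> length is = M}"
  then show "map (\<lambda>k\<in>{..<M}. xs ! k) [0..<M] = xs" "(\<lambda>k\<in>{..<M}. xs ! k) \<in> PiE {..<M} (\<lambda>_. T)"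
    by (auto intro!: nth_equalityI)
next
  fix i assume "i \<in> PiE {..<M} (\<lambda>_. T)"
  then show "(\<lambda>k\<in>{..<M}. map i [0..<M] ! k) = i" "map i [0..<M] \<in> {is. set is \<subseteq> T \<and> length is = M}"
    by (auto simp: fun_eq_iff restrict_def PiE_iff extensional_def)
qed simp

lemma powr_eq_square_powr: "0 \<le> x \<Longrightarrow> x powr q = (x\<^sup>2) powr (q / 2)" for x q :: real
  by (cases "x = 0") (auto simp: powr_powr simp flip: powr_numeral)

text \<open>Interpolation by an explicit factorisation of \<open>a\<close> into \<open>f\<close> and
  the product of the \<open>g k\<close>. Each \<open>g k\<close> is a power of the marginal sums
  along \<open>k\<close> and multiplies l_2 into l_(Q k); the l_2 norm of \<open>f\<close>, which
  contains the inverse powers, is controlled because the weights \<open>w\<close> add up to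
  1.\<close>

lemma mixed_norm_bound:
  fixes a :: "(nat \<Rightarrow> 't) \<Rightarrow> real"
  assumes "finite T" and a0: "\<And>i. 0 \<le> a i" and \<kappa>: "1 / 2 \<le> \<kappa>" and "0 \<le> D"
    and w: "\<And>k. k < M \<Longrightarrow> 0 \<le> w k" "(\<Sum>k<M. w k) = 1"
    and Q: "\<And>k. k < M \<Longrightarrow> 1 / Q k = 1 / 2 + w k * (\<kappa> - 1 / 2)"
    and bound: "\<And>k. k < M \<Longrightarrow>
      (\<Sum>t\<in>T. (\<Sum>i\<in>{i \<in> PiE {..<M} (\<lambda>_. T). i k = t}. (a i)\<^sup>2) powr (1 / (2 * \<kappa>))) \<le> D powr (1 / \<kappa>)"
  shows "nest (map Q [0..<M]) T (\<lambda>is. a (\<lambda>k\<in>{..<M}. is ! k)) \<le> D"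
proof (rule dense_ge)
  \<comment> \<open>Any such \<open>D'\<close> is positive, so a product of its powers is again a
    power of it, also if \<open>D = 0\<close>.\<close>
  fix D' assume "D < D'"
  define X where "X = PiE {..<M} (\<lambda>_. T)"
  define e where "e = 1 / (2 * \<kappa>)"
  define \<delta> where "\<delta> = \<kappa> - 1 / 2"
  have D': "D' > 0" using \<open>D < D'\<close> assms(4) by simp
  have pos: "\<kappa> > 0" "e > 0" "\<delta> \<ge> 0" and e\<delta>: "1 + - (2 * e * \<delta>) = e"
    using \<kappa> by (auto simp: e_def \<delta>_def field_simps)
  have finX: "finite X" using assms(1) by (simp add: X_def finite_PiE)
  define \<alpha> where "\<alpha> = (\<lambda>k t. \<Sum>i\<in>{i \<in> X. i k = t}. (a i)\<^sup>2)"
  define S where "S = (\<lambda>k. \<Sum>t\<in>T. \<alpha> k t powr e)"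
  have \<alpha>0: "0 \<le> \<alpha> k t" for k t unfolding \<alpha>_def by (simp add: sum_nonneg)
  have \<alpha>pos: "0 < \<alpha> k (i k)" if "i \<in> X" "a i \<noteq> 0" for i k
  proof -
    have "(a i)\<^sup>2 \<le> \<alpha> k (i k)" unfolding \<alpha>_def using finX that by (intro member_le_sum) auto
    then show ?thesis using that(2) by (meson less_le_trans zero_less_power2)
  qed
  have SD: "S k \<le> D' powr (2 * e)" if "k < M" for k
  proof -
    have "S k \<le> D powr (2 * e)"
      using bound[OF that] by (simp add: S_def \<alpha>_def X_def e_def)
    also have "\<dots> \<le> D' powr (2 * e)"
      using \<open>D < D'\<close> assms(4) pos by (intro powr_mono2) auto
    finally show ?thesis .
  qed
  have S0: "0 \<le> S k" for k unfolding S_def by (simp add: sum_nonneg)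
  define g where "g = (\<lambda>k t. \<alpha> k t powr (e * (w k * \<delta>)))"
  define G where "G = (\<lambda>k. S k powr (w k * \<delta>))"
  \<comment> \<open>Where \<open>a i = 0\<close> the quotient is 0; elsewhere all marginals through
    \<open>i\<close> are positive, so the factorisation is exact.\<close>
  define f where "f = (\<lambda>i. a i / (\<Prod>k<M. g k (i k)))"
  have Q0: "0 < Q k" if "k < M" for k
  proof -
    have "0 < 1 / Q k" using Q[OF that] w(1)[OF that] pos(3) by (simp add: \<delta>_def add_pos_nonneg)
    then show ?thesis by simp
  qed
  have lists: "(\<lambda>k\<in>{..<M}. is ! k) \<in> X" if "set is \<subseteq> T" "length is = M" for "is"
    using that by (auto simp: X_def)
  have "nest (map Q [0..<M]) T (\<lambda>is. a (\<lambda>k\<in>{..<M}. is ! k))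
    = nest (map Q [0..<M]) T (\<lambda>is. f (\<lambda>k\<in>{..<M}. is ! k) * (\<Prod>k<M. g k (is ! k)))"
  proof (rule nest_cong)
    fix "is" :: "'t list" assume "set is \<subseteq> T" "length is = length (map Q [0..<M])"
    then have X: "(\<lambda>k\<in>{..<M}. is ! k) \<in> X" using lists by simp
    show "a (\<lambda>k\<in>{..<M}. is ! k) = f (\<lambda>k\<in>{..<M}. is ! k) * (\<Prod>k<M. g k (is ! k))"
    proof (cases "a (\<lambda>k\<in>{..<M}. is ! k) = 0")
      case False
      have "g k (is ! k) > 0" if "k < M" for k
        using \<alpha>pos[OF X False, of k] that by (simp add: g_def)
      then have "(\<Prod>k<M. g k (is ! k)) \<noteq> 0" by (fastforce simp: prod_zero_iff)
      then show ?thesis by (simp add: f_def)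
    qed (simp add: f_def)
  qed
  also have "\<dots> \<le> (\<Prod>k<M. G k) * sqrt (\<Sum>is\<in>{is. set is \<subseteq> T \<and> length is = M}. (f (\<lambda>k\<in>{..<M}. is ! k))\<^sup>2)"
  proof (rule nest_Holder)
    fix k and F :: "'t \<Rightarrow> real"
    assume k: "k < M" and F: "\<And>t. 0 \<le> F t"
    \<comment> \<open>Hoelder's inequality will be used with the exponents \<open>\<theta>\<close>
      and \<open>Q k / 2\<close>; that they add up to 1 is the relation \<open>Q\<close>.\<close>
    define \<theta> where "\<theta> = w k * \<delta> * Q k"
    have \<theta>: "0 \<le> \<theta>" "\<theta> + Q k / 2 = 1"
    proof -
      show "0 \<le> \<theta>" using w(1)[OF k] pos Q0[OF k] by (simp add: \<theta>_def)
      have "Q k * (1 / 2 + w k * \<delta>) = 1" using Q[OF k] Q0[OF k] by (metis \<delta>_def nonzero_mult_div_cancel_left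
          less_irrefl times_divide_eq_right mult.right_neutral)
      then show "\<theta> + Q k / 2 = 1" by (simp add: \<theta>_def algebra_simps)
    qed
    have "(\<Sum>t\<in>T. (g k t * F t) powr Q k) = (\<Sum>t\<in>T. (\<alpha> k t powr e) powr \<theta> * ((F t)\<^sup>2) powr (Q k / 2))"
    proof (rule sum.cong[OF refl])
      fix t
      have "F t powr Q k = ((F t)\<^sup>2) powr (Q k / 2)" using F by (rule powr_eq_square_powr)
      then show "(g k t * F t) powr Q k = (\<alpha> k t powr e) powr \<theta> * ((F t)\<^sup>2) powr (Q k / 2)"
        using F by (simp add: g_def powr_mult powr_powr \<theta>_def mult_ac)
    qed
    also have "\<dots> \<le> S k powr \<theta> * (\<Sum>t\<in>T. (F t)\<^sup>2) powr (Q k / 2)"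
      unfolding S_def using assms(1) \<theta> Q0[OF k] by (intro Holder_sum_powr) auto
    finally have "(\<Sum>t\<in>T. (g k t * F t) powr Q k) powr (1 / Q k)
        \<le> (S k powr \<theta> * (\<Sum>t\<in>T. (F t)\<^sup>2) powr (Q k / 2)) powr (1 / Q k)"
      using Q0[OF k] by (intro powr_mono2) (auto intro!: sum_nonneg)
    also have "\<dots> = G k * sqrt (\<Sum>t\<in>T. (F t)\<^sup>2)"
      using Q0[OF k] by (simp add: G_def powr_mult powr_powr \<theta>_def powr_half_sqrt sum_nonneg)
    finally show "(\<Sum>t\<in>T. (g k t * F t) powr Q k) powr (1 / Q k) \<le> G k * sqrt (\<Sum>t\<in>T. (F t)\<^sup>2)" .
  next
    show "0 \<le> f (\<lambda>k\<in>{..<M}. is ! k)" for "is"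
      using a0 by (simp add: f_def g_def prod_nonneg)
  qed (use assms(1) Q0 in \<open>auto simp: g_def G_def\<close>)
  also have "(\<Sum>is\<in>{is. set is \<subseteq> T \<and> length is = M}. (f (\<lambda>k\<in>{..<M}. is ! k))\<^sup>2) = (\<Sum>i\<in>X. (f i)\<^sup>2)"
    unfolding X_def by (rule sum_lists_eq_sum_PiE)
  also have "(\<Prod>k<M. G k) * sqrt (\<Sum>i\<in>X. (f i)\<^sup>2) \<le> D' powr (2 * e * \<delta>) * sqrt (D' powr (2 * e))"
  proof (intro mult_mono real_sqrt_le_mono)
    have "(\<Prod>k<M. G k) \<le> (\<Prod>k<M. (D' powr (2 * e)) powr (w k * \<delta>))"
      unfolding G_def using SD S0 w pos by (intro prod_mono) (auto intro!: powr_mono2)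
    also have "\<dots> = D' powr (\<Sum>k<M. 2 * e * (w k * \<delta>))"
      using D' by (simp add: powr_sum powr_powr)
    also have "(\<Sum>k<M. 2 * e * (w k * \<delta>)) = 2 * e * \<delta>"
      using w(2) by (simp flip: sum_distrib_left sum_distrib_right)
    finally show "(\<Prod>k<M. G k) \<le> D' powr (2 * e * \<delta>)" .
    \<comment> \<open>The square of \<open>f i\<close> contains the product of the
      \<open>\<alpha> k (i k) powr (- (2 * e * \<delta>))\<close> to the powers \<open>w k\<close>,
      which is at most their weighted mean. Summed over a fibre, each becomes \<open>\<alpha> k t
      powr (1 - 2 * e * \<delta>) = \<alpha> k t powr e\<close>, a term of
      \<open>S k\<close>.\<close>
    have "(\<Sum>i\<in>X. (f i)\<^sup>2) \<le> (\<Sum>i\<in>X. \<Sum>k<M. w k * ((a i)\<^sup>2 * \<alpha> k (i k) powr (- (2 * e * \<delta>))))"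
    proof (rule sum_mono)
      fix i assume i: "i \<in> X"
      show "(f i)\<^sup>2 \<le> (\<Sum>k<M. w k * ((a i)\<^sup>2 * \<alpha> k (i k) powr (- (2 * e * \<delta>))))"
      proof (cases "a i = 0")
        case False
        have \<alpha>: "0 < \<alpha> k (i k)" for k using \<alpha>pos[OF i False] .
        have "(f i)\<^sup>2 = (a i)\<^sup>2 * (\<Prod>k<M. inverse ((g k (i k))\<^sup>2))"
          by (simp add: f_def power_mult_distrib power_inverse divide_inverse prod_power_distrib prod_inversef[symmetric] o_def)
        also have "(\<Prod>k<M. inverse ((g k (i k))\<^sup>2)) = (\<Prod>k<M. (\<alpha> k (i k) powr (- (2 * e * \<delta>))) powr w k)"
        proof (rule prod.cong[OF refl])
          fix k
          have eq: "e * (w k * \<delta>) + e * (w k * \<delta>) = 2 * e * \<delta> * w k" by simp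
          have "inverse ((g k (i k))\<^sup>2) = inverse (\<alpha> k (i k) powr (2 * e * \<delta> * w k))"
            by (simp add: g_def power2_eq_square eq flip: powr_add)
          then show "inverse ((g k (i k))\<^sup>2) = (\<alpha> k (i k) powr (- (2 * e * \<delta>))) powr w k"
            by (simp only: powr_powr mult_minus_left) (simp only: powr_minus)
        qed
        also have "(a i)\<^sup>2 * \<dots> \<le> (a i)\<^sup>2 * (\<Sum>k<M. w k * \<alpha> k (i k) powr (- (2 * e * \<delta>)))"
          using w \<alpha> by (intro mult_left_mono prod_powr_le_weighted_sum) (auto simp: less_imp_neq[symmetric])
        also have "\<dots> = (\<Sum>k<M. w k * ((a i)\<^sup>2 * \<alpha> k (i k) powr (- (2 * e * \<delta>))))"
          by (simp add: sum_distrib_left mult_ac)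
        finally show ?thesis .
      qed (simp add: f_def)
    qed
    also have "\<dots> = (\<Sum>k<M. w k * (\<Sum>i\<in>X. (a i)\<^sup>2 * \<alpha> k (i k) powr (- (2 * e * \<delta>))))"
      unfolding sum_distrib_left by (rule sum.swap)
    also have "\<dots> = (\<Sum>k<M. w k * S k)"
    proof (intro sum.cong refl arg_cong2[where f = "(*)"])
      fix k assume "k \<in> {..<M}"
      then have "(\<Sum>i\<in>X. (a i)\<^sup>2 * \<alpha> k (i k) powr (- (2 * e * \<delta>)))
         = (\<Sum>t\<in>T. \<Sum>i\<in>{i \<in> X. i k = t}. (a i)\<^sup>2 * \<alpha> k (i k) powr (- (2 * e * \<delta>)))"
        using finX assms(1) by (intro sum.group[symmetric]) (auto simp: X_def)
      also have "\<dots> = (\<Sum>t\<in>T. \<alpha> k t * \<alpha> k t powr (- (2 * e * \<delta>)))"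
        by (simp add: \<alpha>_def sum_distrib_right)
      also have "\<dots> = S k"
        unfolding S_def using \<alpha>0 e\<delta> by (intro sum.cong refl) (simp add: powr_mult_base)
      finally show "(\<Sum>i\<in>X. (a i)\<^sup>2 * \<alpha> k (i k) powr (- (2 * e * \<delta>))) = S k" .
    qed
    also have "\<dots> \<le> (\<Sum>k<M. w k * D' powr (2 * e))"
      using SD w by (intro sum_mono mult_left_mono) auto
    also have "\<dots> = D' powr (2 * e)"
      using w(2) by (simp flip: sum_distrib_right)
    finally show "(\<Sum>i\<in>X. (f i)\<^sup>2) \<le> D' powr (2 * e)" .
  qed (auto intro!: sum_nonneg)
  also have "\<dots> = D' powr (2 * e * \<delta> + e)"
    by (simp add: powr_add powr_half_sqrt[symmetric] powr_powr)
  also have "\<dots> = D'" using e\<delta> D' by (simp add: algebra_simps)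
  finally show "nest (map Q [0..<M]) T (\<lambda>is. a (\<lambda>k\<in>{..<M}. is ! k)) \<le> D'" .
qed

section \<open>Powers and nested sums with values in [0, \<infinity>]\<close>

lemma epowr_ennreal: "0 \<le> x \<Longrightarrow> epowr (ennreal x) r = ennreal (x powr r)"
  by (simp add: epowr_def)

lemma epowr_0 [simp]: "epowr 0 r = 0"
  by (simp add: epowr_def)

lemma epowr_epowr: "epowr (epowr a r) r' = epowr a (r * r')"
  by (simp add: epowr_def powr_powr)

lemma epowr_1 [simp]: "epowr a 1 = a"
  by (cases a) (auto simp: epowr_def)

lemma epowr_mono:
  assumes "0 \<le> r" "a \<le> b"
  shows "epowr a r \<le> epowr b r"
proof (cases "b = \<infinity>")
  case False
  then have "a < \<infinity>" "b < \<infinity>" using assms(2) by (auto simp: less_top[symmetric] top_unique)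
  then show ?thesis
    using assms by (auto simp: epowr_def intro!: ennreal_leI powr_mono2 enn2real_mono)
qed (simp add: epowr_def)

text \<open>For \<open>r > 0\<close> the power is an order isomorphism of [0, \<infinity>], with
  inverse exponent \<open>1 / r\<close>, and so commutes with suprema.\<close>

lemma epowr_SUP:
  assumes "0 < r"
  shows "epowr (SUP n. f n) r = (SUP n. epowr (f n) r)"
proof (rule antisym)
  have inv: "epowr (epowr x r) (1 / r) = x" "epowr (epowr x (1 / r)) r = x" for x
    using assms by (simp_all add: epowr_epowr)
  have "(SUP n. f n) \<le> epowr (SUP n. epowr (f n) r) (1 / r)"
  proof (rule SUP_least)
    fix n
    have "epowr (epowr (f n) r) (1 / r) \<le> epowr (SUP n. epowr (f n) r) (1 / r)"
      using assms by (intro epowr_mono SUP_upper) auto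
    then show "f n \<le> epowr (SUP n. epowr (f n) r) (1 / r)" by (simp add: inv)
  qed
  then have "epowr (SUP n. f n) r \<le> epowr (epowr (SUP n. epowr (f n) r) (1 / r)) r"
    using assms by (intro epowr_mono) auto
  then show "epowr (SUP n. f n) r \<le> (SUP n. epowr (f n) r)" by (simp add: inv)
  show "(SUP n. epowr (f n) r) \<le> epowr (SUP n. f n) r"
    using assms by (intro SUP_least epowr_mono SUP_upper) auto
qed

lemma nested_sum_mono:
  assumes "\<And>q. q \<in> set qs \<Longrightarrow> 0 < q" "\<And>is. length is = length qs \<Longrightarrow> a is \<le> b is"
  shows "nested_sum qs a \<le> nested_sum qs b"
  using assms
proof (induction qs arbitrary: a b rule: induct_list012)
  case (2 q)
  then show ?case by (auto intro!: suminf_le epowr_mono simp: less_imp_le)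
next
  case (3 q r qs)
  have "nested_sum (r # qs) (\<lambda>is. a (i # is)) \<le> nested_sum (r # qs) (\<lambda>is. b (i # is))" for i
    using "3.prems" by (intro "3.IH"(2)) auto
  moreover have "0 \<le> q / r" using "3.prems"(1) by (simp add: less_imp_le)
  ultimately show ?case by (auto intro!: suminf_le epowr_mono)
qed simp

text \<open>Monotone convergence at every level; it reduces the infinite sums to finite
  truncations.\<close>

lemma nested_sum_SUP:
  fixes f :: "nat \<Rightarrow> nat list \<Rightarrow> ennreal"
  assumes "\<And>q. q \<in> set qs \<Longrightarrow> 0 < q" "\<And>is. incseq (\<lambda>n. f n is)"
  shows "nested_sum qs (\<lambda>is. SUP n. f n is) = (SUP n. nested_sum qs (f n))"
  using assms
proof (induction qs arbitrary: f rule: induct_list012)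
  case (2 q)
  have "incseq (\<lambda>n. epowr (f n [i]) q)" for i
    using 2 by (auto simp: incseq_def less_imp_le intro!: epowr_mono)
  then show ?case
    using 2 by (simp add: epowr_SUP ennreal_suminf_SUP_eq)
next
  case (3 q r qs)
  have pos: "0 < q / r" using "3.prems"(1) by simp
  have "incseq (\<lambda>n. nested_sum (r # qs) (\<lambda>is. f n (i # is)))" for i
    using "3.prems" unfolding incseq_def by (intro allI impI nested_sum_mono) auto
  then have "incseq (\<lambda>n. epowr (nested_sum (r # qs) (\<lambda>is. f n (i # is))) (q / r))" for i
    using pos by (auto simp: incseq_def less_imp_le simp del: nested_sum.simps intro!: epowr_mono)
  moreover have "nested_sum (r # qs) (\<lambda>is. SUP n. f n (i # is)) = (SUP n. nested_sum (r # qs) (\<lambda>is. f n (i # is)))" for i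
    using "3.prems" by (intro "3.IH"(2)) auto
  ultimately show ?case
    using pos by (simp add: epowr_SUP ennreal_suminf_SUP_eq)
qed simp

text \<open>Restricting the entries to numbers below \<open>n\<close> makes every sum finite. The
  outermost root, which \<open>nested_sum\<close> omits and \<open>nest\<close> includes, is the one
  with \<open>hd qs\<close>.\<close>

lemma nested_sum_truncate:
  assumes "qs \<noteq> []" "\<And>q. q \<in> set qs \<Longrightarrow> 0 < q" "\<And>is. 0 \<le> h is"
  shows "epowr (nested_sum qs (\<lambda>is. if set is \<subseteq> {..<n} then ennreal (h is) else 0)) (1 / hd qs)
    = ennreal (nest qs {..<n} h)"
  using assms
proof (induction qs arbitrary: h rule: induct_list012)
  case (2 q)
  have "(\<Sum>i. epowr (if set [i] \<subseteq> {..<n} then ennreal (h [i]) else 0) q)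
      = (\<Sum>i<n. epowr (if set [i] \<subseteq> {..<n} then ennreal (h [i]) else 0) q)"
    by (rule suminf_finite) auto
  also have "\<dots> = ennreal (\<Sum>i<n. h [i] powr q)"
    using 2 by (simp add: epowr_ennreal)
  finally show ?case using 2 by (simp add: epowr_ennreal sum_nonneg)
next
  case (3 q r qs)
  have pos: "0 < q" "0 < r" using 3 by auto
  have zero: "nested_sum qs (\<lambda>is. 0) = 0" for qs
    by (induction qs rule: induct_list012) auto
  define N where "N = (\<lambda>i. nested_sum (r # qs) (\<lambda>is. if set (i # is) \<subseteq> {..<n} then ennreal (h (i # is)) else 0))"
  have N1: "N i = 0" if "\<not> i < n" for i using that by (simp add: N_def zero del: nested_sum.simps)
  \<comment> \<open>The exponent \<open>q / r\<close> is the omitted root \<open>1 / r\<close> of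
    the inner sum followed by the power \<open>q\<close>.\<close>
  have N2: "epowr (N i) (q / r) = ennreal (nest (r # qs) {..<n} (\<lambda>is. h (i # is)) powr q)" if "i < n" for i
  proof -
    have "epowr (N i) (1 / r) = ennreal (nest (r # qs) {..<n} (\<lambda>is. h (i # is)))"
      using "3.IH"(2)[of "\<lambda>is. h (i # is)"] 3(4,5) that by (simp add: N_def)
    then have "epowr (epowr (N i) (1 / r)) q = ennreal (nest (r # qs) {..<n} (\<lambda>is. h (i # is)) powr q)"
      using 3(5) by (simp add: epowr_ennreal)
    then show ?thesis by (simp add: epowr_epowr)
  qed
  have "(\<Sum>i. epowr (N i) (q / r)) = (\<Sum>i<n. epowr (N i) (q / r))"
    by (rule suminf_finite) (auto simp: N1)
  also have "\<dots> = ennreal (\<Sum>i<n. nest (r # qs) {..<n} (\<lambda>is. h (i # is)) powr q)"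
    using N2 by simp
  finally have "epowr (\<Sum>i. epowr (N i) (q / r)) (1 / q)
      = ennreal ((\<Sum>i<n. nest (r # qs) {..<n} (\<lambda>is. h (i # is)) powr q) powr (1 / q))"
    by (simp only: epowr_ennreal[OF sum_nonneg[OF powr_ge_zero]])
  then show ?case
    unfolding nested_sum.simps(3) nest.simps(2)[of q] N_def list.sel .
qed simp

section \<open>Multilinear maps on sequence spaces\<close>

lemma enn2real_one_divide:
  assumes "1 \<le> p" "p \<noteq> \<infinity>"
  shows "1 \<le> enn2real p" "enn2real (1 / p) = 1 / enn2real p"
proof -
  obtain P where P: "p = ennreal P" "0 \<le> P" using assms(2) by (cases p) auto
  then have "1 \<le> P" using assms(1) by simp
  then show "1 \<le> enn2real p" "enn2real (1 / p) = 1 / enn2real p"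
    using P divide_ennreal[of 1 P] by auto
qed

lemma X_space_finite_support:
  assumes "\<And>t. n \<le> t \<Longrightarrow> x t = 0"
  shows "x \<in> X_space p"
proof -
  have "summable (\<lambda>t. norm (x t) powr enn2real p)"
    using assms by (intro summable_finite[of "{..<n}"]) (auto simp: not_less)
  moreover have "x \<longlonglongrightarrow> 0"
    using assms by (intro tendsto_eventually eventually_sequentiallyI[of n])
  ultimately show ?thesis by (simp add: X_space_def ell_def)
qed

lemma X_space_mult:
  assumes "x \<in> X_space p"
  shows "(\<lambda>n. c * x n) \<in> X_space p"
  using assms tendsto_mult_left[of x 0 sequentially c]
  by (auto simp: X_space_def ell_def norm_mult powr_mult intro: summable_mult split: if_splits)

lemma norm_le_X_norm_c0:
  assumes "x \<in> X_space \<infinity>"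
  shows "norm (x n) \<le> (SUP n. norm (x n))"
proof -
  have "x \<longlonglongrightarrow> 0" using assms by (simp add: X_space_def)
  then have "bounded (range x)" by (rule convergent_imp_bounded)
  then have "bdd_above (range (\<lambda>n. norm (x n)))"
    by (auto simp: bounded_iff intro: bdd_aboveI)
  then show ?thesis by (intro cSUP_upper) auto
qed

lemma ell_norm_mult:
  assumes "1 \<le> r" "x \<in> ell r"
  shows "ell_norm r (\<lambda>n. c * x n) = norm c * ell_norm r x"
proof -
  have "(\<Sum>n. norm (x n) powr r) \<ge> 0"
    using assms by (intro suminf_nonneg) (auto simp: ell_def)
  then show ?thesis
    using assms by (simp add: ell_norm_def ell_def norm_mult powr_mult suminf_mult powr_powr)
qed

lemma X_norm_mult_le:
  assumes "1 \<le> p" "x \<in> X_space p"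
  shows "X_norm p (\<lambda>n. c * x n) \<le> norm c * X_norm p x"
proof (cases "p = \<infinity>")
  case True
  then show ?thesis
    using norm_le_X_norm_c0[of x] assms
    by (auto simp: X_norm_def norm_mult intro!: cSUP_least mult_left_mono)
next
  case False
  then show ?thesis
    using assms enn2real_one_divide(1)[OF assms(1) False] by (simp add: X_norm_def X_space_def ell_norm_mult)
qed

text \<open>One vector \<open>g\<close> from the unit ball of l_1 serves all exponents, since it
  dominates \<open>norm (x t) powr p\<close>. For \<open>p = \<infinity>\<close> the exponent is 0
  and the right side of the bound is at most 1.\<close>

lemma X_norm_le_1:
  fixes x :: "nat \<Rightarrow> 'k::real_normed_field"
  assumes "1 \<le> p" and supp: "\<And>t. n \<le> t \<Longrightarrow> x t = 0"
    and g: "\<And>t. t < n \<Longrightarrow> 0 \<le> g t" "(\<Sum>t<n. g t) \<le> 1"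
    and x: "\<And>t. t < n \<Longrightarrow> norm (x t) \<le> g t powr enn2real (1 / p)"
  shows "X_norm p x \<le> 1"
proof (cases "p = \<infinity>")
  case True
  have "norm (x t) \<le> 1" for t
    using x[of t] supp[of t] True by (cases "t < n") (auto simp: top_ereal_def split: if_splits)
  then show ?thesis using True by (auto simp: X_norm_def intro: cSUP_least)
next
  case False
  define P where "P = enn2real p"
  have P: "1 \<le> P" "enn2real (1 / p) = 1 / P"
    using enn2real_one_divide[OF assms(1) False] by (auto simp: P_def)
  have "(\<Sum>t. norm (x t) powr P) = (\<Sum>t<n. norm (x t) powr P)"
    using supp by (intro suminf_finite) (auto simp: not_less)
  also have "\<dots> \<le> (\<Sum>t<n. g t)"
  proof (rule sum_mono)
    fix t assume "t \<in> {..<n}"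
    then have "norm (x t) powr P \<le> (g t powr (1 / P)) powr P"
      using x[of t] P by (intro powr_mono2) auto
    also have "\<dots> = g t" using P g(1)[of t] \<open>t \<in> {..<n}\<close> by (simp add: powr_powr)
    finally show "norm (x t) powr P \<le> g t" .
  qed
  finally have "(\<Sum>t. norm (x t) powr P) \<le> 1" using g(2) by simp
  moreover have "0 \<le> (\<Sum>t. norm (x t) powr P)"
    using supp by (intro suminf_nonneg summable_finite[of "{..<n}"]) (auto simp: not_less)
  ultimately have "(\<Sum>t. norm (x t) powr P) powr (1 / P) \<le> 1 powr (1 / P)"
    using P by (intro powr_mono2) auto
  then show ?thesis using False by (simp add: X_norm_def ell_norm_def P_def)
qed

lemma ell_mono:
  assumes "0 < s" "s \<le> q" "x \<in> ell s"
  shows "x \<in> ell q"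
proof -
  have sm: "summable (\<lambda>n. norm (x n) powr s)" using assms by (simp add: ell_def)
  from summable_LIMSEQ_zero[OF sm] have "eventually (\<lambda>n. norm (x n) powr s < 1) sequentially"
    by (rule order_tendstoD) simp
  then have "eventually (\<lambda>n. norm (norm (x n) powr q) \<le> norm (x n) powr s) sequentially"
  proof eventually_elim
    case (elim n)
    have "norm (x n) \<le> 1"
    proof (rule ccontr)
      assume "\<not> norm (x n) \<le> 1"
      then have "1 \<le> norm (x n) powr s" using assms by (intro ge_one_powr_ge_zero) auto
      then show False using elim by simp
    qed
    then show ?case using assms powr_mono'[of s q "norm (x n)"] by simp
  qed
  then show ?thesis
    unfolding ell_def using sm by (auto intro: summable_comparison_test_ev)
qed

text \<open>The coordinates are scaled one after the other; in \<open>y k\<close> the first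
  \<open>k\<close> of them are scaled.\<close>

lemma multilinear_scale:
  fixes A :: "(nat \<Rightarrow> nat \<Rightarrow> 'k::real_normed_field) \<Rightarrow> nat \<Rightarrow> 'k"
  assumes A: "multilinear_into_ell m p s A" and x: "x \<in> X_prod m p"
  shows "A (\<lambda>j\<in>{..<m}. \<lambda>n. c * x j n) = (\<lambda>n. c ^ m * A x n)"
proof -
  define y where "y = (\<lambda>k. \<lambda>j\<in>{..<m}. if j < k then (\<lambda>n. c * x j n) else x j)"
  have xj: "x j \<in> X_space (p j)" if "j < m" for j
    using x that by (auto simp: X_prod_def)
  have y: "y k \<in> X_prod m p" for k
    using xj by (auto simp: y_def X_prod_def intro!: X_space_mult[OF xj])
  have "k \<le> m \<Longrightarrow> A (y k) = (\<lambda>n. c ^ k * A x n)" for k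
  proof (induction k)
    case 0
    have "y 0 = x" using x by (auto simp: y_def X_prod_def PiE_def extensional_def fun_eq_iff)
    then show ?case by simp
  next
    case (Suc k)
    have "y (Suc k) = (y k)(k := \<lambda>n. c * x k n)" "(y k)(k := x k) = y k"
      using Suc.prems by (auto simp: y_def fun_eq_iff)
    moreover have "A ((y k)(k := \<lambda>n. c * x k n)) = (\<lambda>n. c * A ((y k)(k := x k)) n)"
      using A y[of k] xj[of k] Suc.prems by (simp add: multilinear_into_ell_def)
    ultimately show ?case using Suc by (simp add: mult.assoc del: fun_upd_apply)
  qed
  from this[of m] show ?thesis by (simp add: y_def cong: restrict_cong)
qed

text \<open>A real \<open>Sup\<close> is an upper bound only of a bounded set, so this is what makes
  \<open>mult_norm\<close> usable. Continuity at the zero tuple bounds \<open>A\<close> on a small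
  ball, and homogeneity of degree \<open>m\<close> carries the bound over to the unit ball.\<close>

lemma bdd_above_unit_ball_image:
  fixes A :: "(nat \<Rightarrow> nat \<Rightarrow> 'k::real_normed_field) \<Rightarrow> nat \<Rightarrow> 'k"
  assumes "1 \<le> m" "1 \<le> s" and p: "\<And>j. j < m \<Longrightarrow> 1 \<le> p j"
    and A: "multilinear_into_ell m p s A" and cont: "continuous_into_ell m p s A"
  shows "bdd_above {ell_norm s (A x) | x. x \<in> X_prod m p \<and> (\<forall>j<m. X_norm (p j) (x j) \<le> 1)}"
proof -
  define z :: "nat \<Rightarrow> nat \<Rightarrow> 'k" where "z = (\<lambda>j\<in>{..<m}. \<lambda>n. 0)"
  have z: "z \<in> X_prod m p"
    by (auto simp: z_def X_prod_def intro: X_space_finite_support)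
  have "z = (\<lambda>j\<in>{..<m}. \<lambda>n. 0 * z j n)" by (auto simp: z_def)
  then have Az: "A z = (\<lambda>n. 0)"
    using multilinear_scale[OF A z, of 0] assms(1) by (simp add: power_0_left)
  have "\<exists>\<delta>>0. \<forall>y\<in>X_prod m p. (\<forall>j<m. X_norm (p j) (\<lambda>n. y j n - z j n) < \<delta>) \<longrightarrow>
      ell_norm s (\<lambda>n. A y n - A z n) < 1"
    using cont z zero_less_one unfolding continuous_into_ell_def by blast
  then obtain \<delta> where \<delta>: "\<delta> > 0"
    "\<And>y. y \<in> X_prod m p \<Longrightarrow> (\<And>j. j < m \<Longrightarrow> X_norm (p j) (\<lambda>n. y j n - z j n) < \<delta>) \<Longrightarrow>
      ell_norm s (\<lambda>n. A y n - A z n) < 1"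
    by blast
  \<comment> \<open>Half of \<open>\<delta>\<close>, because the unit ball is closed while
    continuity asks for strict inequality.\<close>
  define c :: 'k where "c = of_real (\<delta> / 2)"
  have c: "norm c = \<delta> / 2" using \<delta>(1) by (simp add: c_def)
  have "ell_norm s (A x) \<le> 1 / norm c ^ m"
    if x: "x \<in> X_prod m p" "\<And>j. j < m \<Longrightarrow> X_norm (p j) (x j) \<le> 1" for x
  proof -
    define y where "y = (\<lambda>j\<in>{..<m}. \<lambda>n. c * x j n)"
    have xj: "x j \<in> X_space (p j)" if "j < m" for j
      using x that by (auto simp: X_prod_def)
    have y: "y \<in> X_prod m p"
      using xj by (auto simp: y_def X_prod_def intro!: X_space_mult[OF xj])
    have "X_norm (p j) (\<lambda>n. y j n - z j n) < \<delta>" if "j < m" for j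
    proof -
      have "X_norm (p j) (\<lambda>n. c * x j n) \<le> norm c * X_norm (p j) (x j)"
        using p xj that by (intro X_norm_mult_le)
      also have "\<dots> \<le> norm c * 1" using x(2)[OF that] by (intro mult_left_mono) auto
      also have "\<dots> < \<delta>" using c \<delta>(1) by simp
      finally show ?thesis using that by (simp add: y_def z_def)
    qed
    then have "ell_norm s (A y) < 1" using \<delta>(2)[OF y] Az by simp
    moreover have "A y = (\<lambda>n. c ^ m * A x n)"
      unfolding y_def by (rule multilinear_scale[OF A x(1)])
    moreover have "A x \<in> ell s" using A x by (simp add: multilinear_into_ell_def)
    ultimately have "norm c ^ m * ell_norm s (A x) < 1"
      using assms(2) by (simp add: ell_norm_mult norm_power)
    moreover have "0 < norm c ^ m" unfolding c using \<delta>(1) by simp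
    ultimately show ?thesis by (simp only: pos_le_divide_eq mult.commute less_imp_le)
  qed
  then show ?thesis by (intro bdd_aboveI[of _ "1 / norm c ^ m"]) auto
qed

lemma multilinear_sum_unit_seq:
  fixes A :: "(nat \<Rightarrow> nat \<Rightarrow> 'k::real_normed_field) \<Rightarrow> nat \<Rightarrow> 'k"
  assumes A: "multilinear_into_ell m p s A" and y: "y \<in> X_prod m p" and l: "l < m"
  shows "A (y(l := \<lambda>u. \<Sum>t<n. c t * unit_seq t u)) = (\<lambda>j. \<Sum>t<n. c t * A (y(l := unit_seq t)) j)"
proof (induction n)
  case 0
  have sp: "unit_seq 0 \<in> X_space (p l)"
    by (rule X_space_finite_support[of "Suc 0"]) (auto simp: unit_seq_def)
  have "A (y(l := \<lambda>u. 0 * unit_seq 0 u)) = (\<lambda>j. 0 * A (y(l := unit_seq 0)) j)"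
    using A y l sp unfolding multilinear_into_ell_def by blast
  then show ?case by (simp only: mult_zero_left lessThan_0 sum.empty)
next
  case (Suc n)
  have sp: "unit_seq t \<in> X_space (p l)" for t
    by (rule X_space_finite_support[of "Suc t"]) (auto simp: unit_seq_def)
  have sp2: "(\<lambda>u. \<Sum>t<n. c t * unit_seq t u) \<in> X_space (p l)"
    by (rule X_space_finite_support[of n]) (auto simp: unit_seq_def)
  have add: "A (y(l := \<lambda>n. u n + v n)) = (\<lambda>n. A (y(l := u)) n + A (y(l := v)) n)"
    if "u \<in> X_space (p l)" "v \<in> X_space (p l)" for u v
    using A y l that unfolding multilinear_into_ell_def by blast
  have "A (y(l := \<lambda>u. (\<Sum>t<n. c t * unit_seq t u) + c n * unit_seq n u))
    = (\<lambda>j. A (y(l := \<lambda>u. \<Sum>t<n. c t * unit_seq t u)) j + A (y(l := \<lambda>u. c n * unit_seq n u)) j)"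
    by (rule add[OF sp2 X_space_mult[OF sp]])
  moreover have "A (y(l := \<lambda>u. c n * unit_seq n u)) = (\<lambda>j. c n * A (y(l := unit_seq n)) j)"
    using A y l sp unfolding multilinear_into_ell_def by blast
  ultimately show ?case using Suc by (simp del: fun_upd_apply)
qed

text \<open>In \<open>y D i\<close> the coordinates in \<open>D\<close> are unit sequences, the
  others those of \<open>x\<close>; each step of the induction on \<open>D\<close> expands one more
  coordinate. Extensionality of \<open>x\<close> makes the tuple for empty \<open>D\<close> equal to
  \<open>x\<close>.\<close>

lemma multilinear_expand:
  fixes A :: "(nat \<Rightarrow> nat \<Rightarrow> 'k::real_normed_field) \<Rightarrow> nat \<Rightarrow> 'k"
  assumes A: "multilinear_into_ell m p s A" and x: "x \<in> extensional {..<m}"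
    and supp: "\<And>k t. k < m \<Longrightarrow> n \<le> t \<Longrightarrow> x k t = 0"
  shows "A x j = (\<Sum>i\<in>PiE {..<m} (\<lambda>_. {..<n}). (\<Prod>k<m. x k (i k)) * A (unit_tuple m (map i [0..<m])) j)"
proof -
  define y where "y = (\<lambda>D i. \<lambda>k\<in>{..<m}. if k \<in> D then unit_seq (i k) else x k)"
  have y: "y D i \<in> X_prod m p" for D i
    unfolding y_def X_prod_def
  proof (intro restrict_PiE_iff[THEN iffD2] ballI)
    fix k assume "k \<in> {..<m}"
    then show "(if k \<in> D then unit_seq (i k) else x k) \<in> X_space (p k)"
      using supp[of k] by (auto simp: unit_seq_def intro: X_space_finite_support[of n] X_space_finite_support[of "Suc (i k)"])
  qed
  have "A x j = (\<Sum>i\<in>PiE D (\<lambda>_. {..<n}). (\<Prod>k\<in>D. x k (i k)) * A (y D i) j)" if "finite D" "D \<subseteq> {..<m}" for D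
    using that
  proof (induction D rule: finite_induct)
    case empty
    have "y {} i = x" for i using x by (auto simp: y_def extensional_def fun_eq_iff)
    then show ?case by simp
  next
    case (insert l D)
    have l: "l < m" using insert.prems by auto
    have xl: "x l = (\<lambda>u. \<Sum>t<n. x l t * unit_seq t u)"
    proof
      fix u
      have "(\<Sum>t<n. x l t * unit_seq t u) = (\<Sum>t<n. if u = t then x l t else 0)"
        by (intro sum.cong) (auto simp: unit_seq_def)
      then show "x l u = (\<Sum>t<n. x l t * unit_seq t u)" using supp[OF l, of u] by (auto simp: sum.delta')
    qed
    have "y D i l = x l" for i
      using insert.hyps l by (simp add: y_def)
    then have yx: "(y D i)(l := \<lambda>u. \<Sum>t<n. x l t * unit_seq t u) = y D i" for i
      unfolding xl[symmetric] by (metis fun_upd_triv)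
    have yt: "(y D i)(l := unit_seq t) = y (insert l D) (i(l := t))" for i t
    proof (rule ext)
      fix k
      show "((y D i)(l := unit_seq t)) k = y (insert l D) (i(l := t)) k"
        using l by (cases "k = l") (simp_all add: y_def restrict_def)
    qed
    have "A (y D i) j = (\<Sum>t<n. x l t * A (y (insert l D) (i(l := t))) j)" for i
      using multilinear_sum_unit_seq[OF A y[of D i] l, where n = n and c = "x l"] by (simp add: yx yt)
    then have "A x j = (\<Sum>i\<in>PiE D (\<lambda>_. {..<n}). \<Sum>t<n. x l t * ((\<Prod>k\<in>D. x k (i k)) * A (y (insert l D) (i(l := t))) j))"
      using insert by (simp add: sum_distrib_left mult_ac)
    also have "\<dots> = (\<Sum>t<n. \<Sum>i\<in>PiE D (\<lambda>_. {..<n}). x l t * ((\<Prod>k\<in>D. x k (i k)) * A (y (insert l D) (i(l := t))) j))"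
      by (rule sum.swap)
    also have "\<dots> = (\<Sum>i\<in>PiE (insert l D) (\<lambda>_. {..<n}). (\<Prod>k\<in>insert l D. x k (i k)) * A (y (insert l D) i) j)"
    proof -
      have "(\<Prod>k\<in>D. x k ((i(l := t)) k)) = (\<Prod>k\<in>D. x k (i k))" for i t
        using insert.hyps by (intro prod.cong) auto
      then show ?thesis using insert.hyps by (simp add: sum_PiE_insert mult.assoc)
    qed
    finally show ?case .
  qed
  moreover have "y {..<m} i = unit_tuple m (map i [0..<m])" for i
    by (auto simp: y_def unit_tuple_def fun_eq_iff)
  ultimately show ?thesis by (metis (no_types, lifting) finite_lessThan order_refl sum.cong)
qed

text \<open>The entry \<open>x m\<close> acts as a functional on l_s: \<open>1 - 1 / s\<close> is
  the reciprocal of the conjugate exponent, and Hoelder's inequality pairs it with the value of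
  \<open>A\<close>. Bounds by powers of vectors from the l_1 unit ball are the form that
  \<open>drop_weights\<close> expects.\<close>

lemma form_bound:
  fixes A :: "(nat \<Rightarrow> nat \<Rightarrow> 'k::real_normed_field) \<Rightarrow> nat \<Rightarrow> 'k"
  assumes "1 \<le> m" and s: "1 \<le> s" and p: "\<And>j. j < m \<Longrightarrow> 1 \<le> p j"
    and A: "multilinear_into_ell m p s A" and cont: "continuous_into_ell m p s A"
    and g: "\<And>k t. k < Suc m \<Longrightarrow> t < n \<Longrightarrow> 0 \<le> g k t" "\<And>k. k < Suc m \<Longrightarrow> (\<Sum>t<n. g k t) \<le> 1"
    and x: "\<And>k t. k < m \<Longrightarrow> t < n \<Longrightarrow> norm (x k t) \<le> g k t powr enn2real (1 / p k)"
      "\<And>t. t < n \<Longrightarrow> norm (x m t) \<le> g m t powr (1 - 1 / s)"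
  shows "norm (\<Sum>i\<in>PiE {..<Suc m} (\<lambda>_. {..<n}). A (unit_tuple m (map i [0..<m])) (i m) * (\<Prod>k<Suc m. x k (i k)))
    \<le> mult_norm m p s A"
proof -
  \<comment> \<open>The cut-off at \<open>n\<close> gives finite support, hence membership in every
    \<open>X_space\<close>, without changing the entries that occur in the sum.\<close>
  define X where "X = (\<lambda>k\<in>{..<m}. \<lambda>t. if t < n then x k t else 0)"
  have X: "X \<in> X_prod m p" "X_norm (p j) (X j) \<le> 1" if "j < m" for j
  proof -
    show "X \<in> X_prod m p" unfolding X_def X_prod_def
      by (auto intro!: X_space_finite_support[of n])
    show "X_norm (p j) (X j) \<le> 1"
      using that p g x by (intro X_norm_le_1[of _ n _ "g j"]) (auto simp: X_def)
  qed
  have "(\<Sum>i\<in>PiE {..<Suc m} (\<lambda>_. {..<n}). A (unit_tuple m (map i [0..<m])) (i m) * (\<Prod>k<Suc m. x k (i k)))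
    = (\<Sum>t<n. \<Sum>i\<in>PiE {..<m} (\<lambda>_. {..<n}). A (unit_tuple m (map i [0..<m])) t * (x m t * (\<Prod>k<m. x k (i k))))"
  proof -
    have "map (i(m := t)) [0..<m] = map i [0..<m]" for i :: "nat \<Rightarrow> nat" and t by auto
    moreover have "(\<Prod>k<Suc m. x k ((i(m := t)) k)) = x m t * (\<Prod>k<m. x k (i k))" for i t
      by simp
    ultimately show ?thesis
      unfolding lessThan_Suc by (subst sum_PiE_insert) (simp_all add: mult_ac flip: lessThan_Suc)
  qed
  also have "\<dots> = (\<Sum>t<n. x m t * A X t)"
  proof (rule sum.cong[OF refl])
    fix t
    have "A X t = (\<Sum>i\<in>PiE {..<m} (\<lambda>_. {..<n}). (\<Prod>k<m. X k (i k)) * A (unit_tuple m (map i [0..<m])) t)"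
      by (rule multilinear_expand[OF A]) (auto simp: X_def)
    also have "\<dots> = (\<Sum>i\<in>PiE {..<m} (\<lambda>_. {..<n}). (\<Prod>k<m. x k (i k)) * A (unit_tuple m (map i [0..<m])) t)"
    proof (rule sum.cong[OF refl])
      fix i assume "i \<in> PiE {..<m} (\<lambda>_. {..<n})"
      then have "(\<Prod>k<m. X k (i k)) = (\<Prod>k<m. x k (i k))"
        by (intro prod.cong) (auto simp: X_def PiE_iff)
      then show "(\<Prod>k<m. X k (i k)) * A (unit_tuple m (map i [0..<m])) t
        = (\<Prod>k<m. x k (i k)) * A (unit_tuple m (map i [0..<m])) t" by simp
    qed
    finally show "(\<Sum>i\<in>PiE {..<m} (\<lambda>_. {..<n}). A (unit_tuple m (map i [0..<m])) t * (x m t * (\<Prod>k<m. x k (i k)))) = x m t * A X t"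
      by (simp add: sum_distrib_left mult_ac)
  qed
  also have "norm \<dots> \<le> (\<Sum>t<n. (norm (A X t) powr s) powr (1 / s) * g m t powr (1 - 1 / s))"
  proof (intro sum_norm_le)
    fix t assume "t \<in> {..<n}"
    then show "norm (x m t * A X t) \<le> (norm (A X t) powr s) powr (1 / s) * g m t powr (1 - 1 / s)"
      using x(2)[of t] s by (simp add: norm_mult powr_powr mult.commute mult_left_mono)
  qed
  also have "\<dots> \<le> (\<Sum>t<n. norm (A X t) powr s) powr (1 / s) * (\<Sum>t<n. g m t) powr (1 - 1 / s)"
    using g s by (intro Holder_sum_powr) auto
  also have "\<dots> \<le> (\<Sum>t<n. norm (A X t) powr s) powr (1 / s) * 1"
  proof (intro mult_left_mono)
    have "(\<Sum>t<n. g m t) powr (1 - 1 / s) \<le> 1 powr (1 - 1 / s)"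
      using g s by (intro powr_mono2 sum_nonneg) auto
    then show "(\<Sum>t<n. g m t) powr (1 - 1 / s) \<le> 1" by simp
  qed simp
  also have "\<dots> \<le> ell_norm s (A X)"
  proof -
    have "A X \<in> ell s" using A X(1)[of 0] assms(1) by (simp add: multilinear_into_ell_def)
    then have "(\<Sum>t<n. norm (A X t) powr s) \<le> (\<Sum>t. norm (A X t) powr s)"
      by (intro sum_le_suminf) (auto simp: ell_def)
    then show ?thesis unfolding ell_norm_def using s by (auto intro!: powr_mono2 sum_nonneg)
  qed
  also have "\<dots> \<le> mult_norm m p s A"
    unfolding mult_norm_def
    using X assms(1) by (intro cSup_upper bdd_above_unit_ball_image[OF assms(1) s p A cont]) auto
  finally show ?thesis .
qed

section \<open>Sufficiency of the exponent condition\<close>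

lemma ell_norm_LIMSEQ:
  assumes "0 < q" "x \<in> ell q"
  shows "(\<lambda>n. (\<Sum>j<n. norm (x j) powr q) powr (1 / q)) \<longlonglongrightarrow> ell_norm q x"
proof -
  have "(\<lambda>n. \<Sum>j<n. norm (x j) powr q) \<longlonglongrightarrow> (\<Sum>j. norm (x j) powr q)"
    using assms by (intro summable_LIMSEQ) (simp add: ell_def)
  then show ?thesis unfolding ell_norm_def
    using assms by (intro tendsto_powr' tendsto_const) (auto simp: sum_nonneg)
qed

lemma sum_powr_antimono:
  fixes y :: "'a \<Rightarrow> real"
  assumes "finite T" "0 < q'" "q' \<le> q" "\<And>t. t \<in> T \<Longrightarrow> 0 \<le> y t"
  shows "(\<Sum>t\<in>T. y t powr q) powr (1 / q) \<le> (\<Sum>t\<in>T. y t powr q') powr (1 / q')"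
proof (cases "(\<Sum>t\<in>T. y t powr q') = 0")
  case True
  then have "y t = 0" if "t \<in> T" for t using assms that by (auto simp: sum_nonneg_eq_0_iff)
  then show ?thesis by simp
next
  case False
  define S where "S = (\<Sum>t\<in>T. y t powr q')"
  have S: "S > 0" using False by (simp add: S_def sum_nonneg less_le)
  have "(\<Sum>t\<in>T. y t powr q) \<le> (\<Sum>t\<in>T. S powr ((q - q') / q') * y t powr q')"
  proof (rule sum_mono)
    fix t assume t: "t \<in> T"
    have "y t powr q' \<le> S" unfolding S_def using assms t by (intro member_le_sum) auto
    then have "(y t powr q') powr ((q - q') / q') \<le> S powr ((q - q') / q')"
      using assms by (intro powr_mono2) auto
    then have "y t powr (q - q') \<le> S powr ((q - q') / q')"
      using assms by (simp add: powr_powr)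
    then have "y t powr (q - q') * y t powr q' \<le> S powr ((q - q') / q') * y t powr q'"
      by (intro mult_right_mono) auto
    then show "y t powr q \<le> S powr ((q - q') / q') * y t powr q'"
      by (simp flip: powr_add)
  qed
  also have "\<dots> = S powr ((q - q') / q' + 1)"
    using S by (simp add: powr_add flip: sum_distrib_left S_def)
  also have "(q - q') / q' + 1 = q / q'" using assms by (simp add: field_simps)
  finally have "(\<Sum>t\<in>T. y t powr q) powr (1 / q) \<le> (S powr (q / q')) powr (1 / q)"
    using assms by (intro powr_mono2) (auto simp: sum_nonneg)
  then show ?thesis using assms by (simp add: powr_powr S_def)
qed

text \<open>The coordinate of l_s is index number \<open>m\<close>. Its exponent \<open>Q m\<close>
  is forced by the others, as the weights must add up to 1, and the condition on \<open>qs\<close>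
  says exactly that \<open>Q m \<le> q\<close>; so the l_q norm is at most the l_(Q m) norm. The
  constant counts \<open>m\<close> uses of Khinchine's inequality.\<close>

lemma mixed_sum_le_mult_norm:
  fixes A :: "(nat \<Rightarrow> nat \<Rightarrow> 'k::{real_normed_field,real_inner}) \<Rightarrow> nat \<Rightarrow> 'k"
  assumes "1 \<le> m" and s: "1 \<le> s" "s \<le> q" "q \<le> 2" and p: "\<And>j. j < m \<Longrightarrow> 1 \<le> p j"
    and r: "0 \<le> 1 / s - 1 / q - recip_sum m p"
    and qs: "\<And>j. j < m \<Longrightarrow> 0 < qs j" "\<And>j. j < m \<Longrightarrow> qs j \<le> 2"
    and sum_qs: "(\<Sum>j<m. 1 / qs j) \<le> real m / 2 + 1 / s - 1 / q - recip_sum m p"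
    and A: "multilinear_into_ell m p s A" and cont: "continuous_into_ell m p s A"
  shows "mixed_sum m qs (\<lambda>is. ennreal (ell_norm q (A (unit_tuple m is)))) \<le> ennreal (sqrt 3 ^ m * mult_norm m p s A)"
proof -
  define D where "D = sqrt 3 ^ m * mult_norm m p s A"
  define \<kappa> where "\<kappa> = 1 / s - recip_sum m p"
  define \<delta> where "\<delta> = \<kappa> - 1 / 2"
  \<comment> \<open>The point with coordinates \<open>1 / Q k\<close> is the convex combination with
    weights \<open>w\<close> of the points having one coordinate \<open>\<kappa>\<close> and all
    others \<open>1 / 2\<close>. If \<open>\<delta> = 0\<close>, division by zero gives the weight 0
    for \<open>k < m\<close> and 1 for \<open>m\<close>.\<close>
  define w where "w = (\<lambda>k. if k < m then (1 / qs k - 1 / 2) / \<delta> else 1 - (\<Sum>j<m. (1 / qs j - 1 / 2) / \<delta>))"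
  define Q where "Q = (\<lambda>k. if k < m then qs k else 1 / (1 / 2 + w m * \<delta>))"
  \<comment> \<open>The reciprocals of the exponents of all \<open>m + 1\<close> arguments, the last
    of which lies in the dual of l_s.\<close>
  define r where "r = (\<lambda>k. if k < m then enn2real (1 / p k) else 1 - 1 / s)"
  have q2: "1 / 2 \<le> 1 / q" using s by (simp add: field_simps)
  have \<delta>0: "0 \<le> \<delta>" using r q2 by (simp add: \<delta>_def \<kappa>_def)
  have qs2: "0 \<le> 1 / qs k - 1 / 2" if "k < m" for k using qs[OF that] by (simp add: field_simps)
  have sum_qs': "(\<Sum>k<m. 1 / qs k - 1 / 2) \<le> 1 / s - 1 / q - recip_sum m p"
    using sum_qs by (simp add: sum_subtractf)
  \<comment> \<open>For \<open>\<delta> = 0\<close> the hypotheses force all \<open>qs k\<close> to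
    be 2, in agreement with the weights 0.\<close>
  have \<delta>z: "1 / qs k - 1 / 2 = 0" if "\<delta> = 0" "k < m" for k
  proof -
    have "1 / qs k - 1 / 2 \<le> (\<Sum>k<m. 1 / qs k - 1 / 2)"
      using qs2 that by (intro member_le_sum) auto
    also have "\<dots> \<le> 0" using sum_qs' that q2 by (simp add: \<delta>_def \<kappa>_def)
    finally show ?thesis using qs2[OF that(2)] by simp
  qed
  have w\<delta>: "w k * \<delta> = 1 / qs k - 1 / 2" if "k < m" for k
    using \<delta>z[OF _ that] that by (cases "\<delta> = 0") (auto simp: w_def)
  have wm\<delta>: "w m * \<delta> = \<delta> - (\<Sum>k<m. 1 / qs k - 1 / 2)"
    using w\<delta> by (simp add: w_def left_diff_distrib sum_distrib_right)
  have wm: "0 \<le> w m"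
  proof (cases "\<delta> = 0")
    case False
    have "0 \<le> w m * \<delta>" unfolding wm\<delta> using sum_qs' q2 by (simp add: \<delta>_def \<kappa>_def)
    then show ?thesis using False \<delta>0 by (simp add: zero_le_mult_iff)
  qed (simp add: w_def)
  have w0: "0 \<le> w k" if "k < Suc m" for k
    using wm qs2 \<delta>0 that by (cases "k = m") (auto simp: w_def)
  have w1: "(\<Sum>k<Suc m. w k) = 1" by (simp add: w_def)
  have Q: "1 / Q k = 1 / 2 + w k * (\<kappa> - 1 / 2)" if "k < Suc m" for k
    using w\<delta>[of k] that by (cases "k = m") (auto simp: Q_def \<delta>_def)
  have Qm: "0 < Q m" "Q m \<le> q"
  proof -
    have "0 < 1 / 2 + w m * \<delta>" using wm \<delta>0 by (simp add: add_pos_nonneg)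
    moreover have "1 / q \<le> 1 / 2 + w m * \<delta>"
      unfolding wm\<delta> using sum_qs' by (simp add: \<delta>_def \<kappa>_def)
    ultimately show "0 < Q m" "Q m \<le> q"
      using s by (simp_all add: Q_def field_simps)
  qed
  have sum_r: "1 - sum r {..<Suc m} = \<kappa>"
    by (simp add: r_def \<kappa>_def recip_sum_def)
  \<comment> \<open>The bound for the empty form, \<open>n = 0\<close>, shows that the norm is
    nonnegative.\<close>
  have D0: "0 \<le> D"
    unfolding D_def using form_bound[OF assms(1) s(1) p A cont, of 0 "\<lambda>_ _. 0" "\<lambda>_ _. 0"] s
    by (intro mult_nonneg_nonneg) (auto intro: order_trans[OF norm_ge_zero])
  have finite_bound: "nest (map qs [0..<m]) {..<n}
      (\<lambda>is. (\<Sum>j<n. norm (A (unit_tuple m is) j) powr q) powr (1 / q)) \<le> D" for n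
  proof -
    define a where "a = (\<lambda>i. norm (A (unit_tuple m (map i [0..<m])) (i m)))"
    let ?X = "PiE {..<Suc m} (\<lambda>_. {..<n})"
    have "(\<Sum>t<n. (\<Sum>i\<in>{i \<in> ?X. i k = t}. (a i)\<^sup>2) powr (1 / (2 * \<kappa>))) \<le> D powr (1 / \<kappa>)"
      if k: "k < Suc m" for k
      \<comment> \<open>The removal of weights starts from 1, where the hypothesis is Khinchine's
        bound for a sum of square roots; all weights together lower this to
        \<open>\<kappa>\<close>.\<close>
      unfolding sum_r[symmetric]
    proof (rule drop_weights[where K = "{..<Suc m}" and c = "\<lambda>k i. i k"])
      fix g :: "nat \<Rightarrow> nat \<Rightarrow> real" and k
      assume g: "\<And>l t. l \<in> {..<Suc m} \<Longrightarrow> t \<in> {..<n} \<Longrightarrow> 0 \<le> g l t"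
        "\<And>l. l \<in> {..<Suc m} \<Longrightarrow> (\<Sum>t<n. g l t) \<le> 1" and k: "k \<in> {..<Suc m}"
      have "(\<Sum>t<n. sqrt (\<Sum>i\<in>{i \<in> ?X. i k = t}. (a i * (\<Prod>l<Suc m. g l (i l) powr r l))\<^sup>2))
        \<le> sqrt 3 ^ (card {..<Suc m} - 1) * mult_norm m p s A"
        unfolding a_def
      proof (rule khinchine_multilinear_form[OF _ _ k])
        fix x :: "nat \<Rightarrow> nat \<Rightarrow> 'k"
        assume x: "\<And>l t. l \<in> {..<Suc m} \<Longrightarrow> t \<in> {..<n} \<Longrightarrow> norm (x l t) \<le> g l t powr r l"
        have "norm (x k t) \<le> g k t powr enn2real (1 / p k)" if "k < m" "t < n" for k t
          using x[of k t] that by (simp add: r_def)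
        moreover have "norm (x m t) \<le> g m t powr (1 - 1 / s)" if "t < n" for t
          using x[of m t] that by (simp add: r_def)
        ultimately show "norm (\<Sum>i\<in>?X. A (unit_tuple m (map i [0..<m])) (i m) * (\<Prod>l<Suc m. x l (i l)))
          \<le> mult_norm m p s A"
          using g by (intro form_bound[OF assms(1) s(1) p A cont, of n g]) auto
      qed auto
      moreover have "(a i * (\<Prod>l<Suc m. g l (i l) powr r l))\<^sup>2 = (a i)\<^sup>2 * (\<Prod>l<Suc m. (g l (i l) powr r l)\<^sup>2)" for i
        by (simp only: power_mult_distrib prod_power_distrib)
      ultimately show "(\<Sum>t<n. (\<Sum>i\<in>{i \<in> ?X. i k = t}. (a i)\<^sup>2 * (\<Prod>l<Suc m. (g l (i l) powr r l)\<^sup>2)) powr (1 / (2 * 1)))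
        \<le> D powr (1 / 1)"
        using D0 by (simp add: powr_half_sqrt sum_nonneg prod_nonneg D_def del: prod.lessThan_Suc)
    next
      show "1 / 2 \<le> 1 - sum r {..<Suc m}" unfolding sum_r using \<delta>0 by (simp add: \<delta>_def)
    qed (use D0 k s(1) in \<open>auto simp: finite_PiE r_def\<close>)
    then have "nest (map Q [0..<Suc m]) {..<n} (\<lambda>is. a (\<lambda>k\<in>{..<Suc m}. is ! k)) \<le> D"
      using \<delta>0 D0 w0 w1 Q by (intro mixed_norm_bound[of _ _ \<kappa> _ _ w]) (auto simp: a_def \<delta>_def)
    \<comment> \<open>As index \<open>m\<close> comes last, the sum over the coordinates of l_s is
      the innermost one.\<close>
    also have "nest (map Q [0..<Suc m]) {..<n} (\<lambda>is. a (\<lambda>k\<in>{..<Suc m}. is ! k))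
      = nest (map qs [0..<m]) {..<n} (\<lambda>is. (\<Sum>t<n. a (\<lambda>k\<in>{..<Suc m}. (is @ [t]) ! k) powr Q m) powr (1 / Q m))"
    proof -
      have "map Q [0..<Suc m] = map qs [0..<m] @ [Q m]" by (simp add: Q_def)
      then show ?thesis by (simp only: nest_snoc)
    qed
    also have "\<dots> = nest (map qs [0..<m]) {..<n}
        (\<lambda>is. (\<Sum>j<n. norm (A (unit_tuple m is) j) powr Q m) powr (1 / Q m))"
    proof (rule nest_cong)
      fix "is" :: "nat list" assume "set is \<subseteq> {..<n}" and len: "length is = length (map qs [0..<m])"
      then have "map (\<lambda>k\<in>{..<Suc m}. (is @ [t]) ! k) [0..<m] = is" for t
        by (intro nth_equalityI) (auto simp: nth_append)
      then show "(\<Sum>t<n. a (\<lambda>k\<in>{..<Suc m}. (is @ [t]) ! k) powr Q m) powr (1 / Q m)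
        = (\<Sum>j<n. norm (A (unit_tuple m is) j) powr Q m) powr (1 / Q m)"
        using len by (simp add: a_def nth_append)
    qed
    finally have "nest (map qs [0..<m]) {..<n}
        (\<lambda>is. (\<Sum>j<n. norm (A (unit_tuple m is) j) powr Q m) powr (1 / Q m)) \<le> D" .
    moreover have "nest (map qs [0..<m]) {..<n} (\<lambda>is. (\<Sum>j<n. norm (A (unit_tuple m is) j) powr q) powr (1 / q))
      \<le> nest (map qs [0..<m]) {..<n} (\<lambda>is. (\<Sum>j<n. norm (A (unit_tuple m is) j) powr Q m) powr (1 / Q m))"
      using qs Qm by (intro nest_mono sum_powr_antimono) auto
    ultimately show ?thesis by simp
  qed
  \<comment> \<open>The same \<open>n\<close> cuts off the coordinates of the value and, in
    \<open>f\<close>, the entries of the list, so that one increasing sequence exhausts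
    both.\<close>
  define h where "h = (\<lambda>n is. (\<Sum>j<n. norm (A (unit_tuple m is) j) powr q) powr (1 / q))"
  define f where "f = (\<lambda>n is. if set is \<subseteq> {..<n} then ennreal (h n is) else 0)"
  have inc: "incseq (\<lambda>n. f n is)" for "is"
  proof (intro incseq_SucI)
    fix n
    have "h n is \<le> h (Suc n) is"
      unfolding h_def using s by (intro powr_mono2) (auto simp: sum_nonneg)
    then show "f n is \<le> f (Suc n) is"
      by (auto simp: f_def intro!: ennreal_leI)
  qed
  have le: "ennreal (ell_norm q (A (unit_tuple m is))) \<le> (SUP n. f n is)" for "is"
  proof -
    have "unit_seq t \<in> X_space (p k)" for t k
      by (rule X_space_finite_support[of "Suc t"]) (auto simp: unit_seq_def)
    then have "unit_tuple m is \<in> X_prod m p"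
      by (auto simp: X_prod_def unit_tuple_def)
    then have "A (unit_tuple m is) \<in> ell q"
      using A s by (intro ell_mono[of s q]) (auto simp: multilinear_into_ell_def)
    then have "(\<lambda>n. ennreal (h n is)) \<longlonglongrightarrow> ennreal (ell_norm q (A (unit_tuple m is)))"
      unfolding h_def using s by (intro tendsto_ennrealI ell_norm_LIMSEQ) auto
    moreover have "ennreal (h n is) \<le> (SUP n. f n is)" if "n \<ge> Suc (Max (insert 0 (set is)))" for n
    proof -
      have "set is \<subseteq> {..<n}"
      proof
        fix i assume "i \<in> set is"
        then have "i \<le> Max (insert 0 (set is))" by simp
        then show "i \<in> {..<n}" using that by simp
      qed
      then have "ennreal (h n is) = f n is" by (simp add: f_def)
      also have "\<dots> \<le> (SUP n. f n is)" by (rule SUP_upper) simp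
      finally show ?thesis .
    qed
    ultimately show ?thesis by (intro LIMSEQ_le_const2) blast+
  qed
  have pos: "\<And>q. q \<in> set (map qs [0..<m]) \<Longrightarrow> 0 < q" using qs by auto
  have q0: "0 < qs 0" "map qs [0..<m] \<noteq> []" "hd (map qs [0..<m]) = qs 0"
    using qs(1)[of 0] assms(1) by (auto simp: hd_map)
  have "mixed_sum m qs (\<lambda>is. ennreal (ell_norm q (A (unit_tuple m is))))
    \<le> epowr (nested_sum (map qs [0..<m]) (\<lambda>is. SUP n. f n is)) (1 / qs 0)"
    unfolding mixed_sum_def using less_imp_le[OF q0(1)] pos le by (intro epowr_mono nested_sum_mono) auto
  also have "\<dots> = (SUP n. epowr (nested_sum (map qs [0..<m]) (f n)) (1 / qs 0))"
    using q0 by (simp only: nested_sum_SUP[OF pos inc]) (simp add: epowr_SUP)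
  also have "\<dots> \<le> ennreal D"
  proof (rule SUP_least)
    fix n
    have "epowr (nested_sum (map qs [0..<m]) (f n)) (1 / hd (map qs [0..<m])) = ennreal (nest (map qs [0..<m]) {..<n} (h n))"
      unfolding f_def using q0 pos by (intro nested_sum_truncate) (auto simp: h_def)
    then show "epowr (nested_sum (map qs [0..<m]) (f n)) (1 / qs 0) \<le> ennreal D"
      using finite_bound[of n] q0(3) by (simp add: h_def ennreal_leI)
  qed
  finally show ?thesis unfolding D_def .
qed

section \<open>Sign arrays with small norm\<close>

text \<open>A sub-Gaussian bound with a generous constant. Up to 1 quadratic estimates of
  \<open>exp y\<close> and \<open>exp (- y)\<close> suffice; beyond 1 already
  \<open>y \<le> y\<^sup>2\<close>.\<close>

lemma cosh_le_exp_square: "(exp x + exp (- x)) / 2 \<le> exp (x\<^sup>2)" for x :: real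
proof -
  have *: "(exp y + exp (- y)) / 2 \<le> exp (y\<^sup>2)" if "0 \<le> y" for y :: real
  proof (cases "y \<le> 1")
    case True
    have "exp (- y) = 1 / exp y" by (simp add: exp_minus divide_inverse)
    also have "\<dots> \<le> 1 / (1 + y)" using that by (intro divide_left_mono) auto
    also have "\<dots> \<le> 1 - y + y\<^sup>2"
    proof -
      have "1 \<le> (1 - y + y\<^sup>2) * (1 + y)" using that by (simp add: algebra_simps power2_eq_square)
      then show ?thesis using that by (simp add: divide_le_eq)
    qed
    finally have "(exp y + exp (- y)) / 2 \<le> 1 + y\<^sup>2" using exp_bound[OF that True] by simp
    also have "\<dots> \<le> exp (y\<^sup>2)" by (rule exp_ge_add_one_self)
    finally show ?thesis .
  next
    case False
    then have "y * 1 \<le> y * y" by (intro mult_left_mono) auto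
    moreover have "exp (- y) \<le> exp y" using that by simp
    ultimately have "exp y \<le> exp (y\<^sup>2)" by (simp add: power2_eq_square)
    have "(exp y + exp (- y)) / 2 \<le> (exp y + exp y) / 2"
      using \<open>exp (- y) \<le> exp y\<close> by (intro divide_right_mono add_left_mono) auto
    also have "\<dots> = exp y" by simp
    also note \<open>exp y \<le> exp (y\<^sup>2)\<close>
    finally show ?thesis .
  qed
  show ?thesis using *[of "\<bar>x\<bar>"] by (cases "0 \<le> x") (auto simp: add.commute)
qed

text \<open>The moment generating function of a random sum factorises, because the signs are
  independent.\<close>

lemma sign_avg_exp_le:
  assumes "finite X"
  shows "sign_avg X (\<lambda>\<epsilon>. exp (\<Sum>i\<in>X. c i * \<epsilon> i)) \<le> exp (\<Sum>i\<in>X. (c i)\<^sup>2)"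
  using assms
proof (induction X rule: finite_induct)
  case (insert u X)
  have "(\<Sum>i\<in>X. c i * (\<epsilon>(u := d)) i) = (\<Sum>i\<in>X. c i * \<epsilon> i)" for \<epsilon> d
    using insert.hyps by (intro sum.cong) auto
  then have "sign_avg (insert u X) (\<lambda>\<epsilon>. exp (\<Sum>i\<in>insert u X. c i * \<epsilon> i))
    = sign_avg X (\<lambda>\<epsilon>. (exp (c u) + exp (- c u)) / 2 * exp (\<Sum>i\<in>X. c i * \<epsilon> i))"
    using insert.hyps by (simp add: sign_avg_insert exp_add distrib_right add_divide_distrib)
  also have "\<dots> = (exp (c u) + exp (- c u)) / 2 * sign_avg X (\<lambda>\<epsilon>. exp (\<Sum>i\<in>X. c i * \<epsilon> i))"
    by (rule sign_avg_mult)
  also have "\<dots> \<le> exp ((c u)\<^sup>2) * exp (\<Sum>i\<in>X. (c i)\<^sup>2)"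
    using insert.IH by (intro mult_mono cosh_le_exp_square)
      (auto simp: sign_avg_def intro!: divide_nonneg_nonneg sum_nonneg)
  also have "\<dots> = exp (\<Sum>i\<in>insert u X. (c i)\<^sup>2)"
    using insert.hyps by (simp add: exp_add)
  finally show ?case .
qed simp

text \<open>Chernoff's bound for each set and a union bound over at most \<open>2 ^ N\<close> sets.
  \<open>F\<close> is a sum of exponentials, one of which exceeds 1 as soon as some set violates its
  bound; the average of \<open>F\<close> is less than 1, so some choice of signs violates
  none.\<close>

lemma exists_balanced_signs:
  fixes X :: "'a set"
  assumes X: "finite X" and \<T>: "\<And>T. T \<in> \<T> \<Longrightarrow> T \<subseteq> X" and N: "card \<T> \<le> 2 ^ N"
  shows "\<exists>\<epsilon>\<in>PiE X (\<lambda>_. {-1, 1 :: real}). \<forall>T\<in>\<T>. \<bar>\<Sum>i\<in>T. \<epsilon> i\<bar> \<le> 2 * sqrt (N + 2) * sqrt (card T)"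
proof -
  define u where "u = 2 * sqrt (N + 2)"
  have u: "u > 0" "u\<^sup>2 = 4 * (real N + 2)" by (auto simp: u_def power_mult_distrib)
  \<comment> \<open>The optimal parameter in Chernoff's bound: it minimises
    \<open>c\<^sup>2 * card T - c * u * sqrt (card T)\<close>, with minimum
    \<open>- u\<^sup>2 / 4\<close>. The empty set, where this would divide by zero, is left out of
    the family below.\<close>
  define t where "t = (\<lambda>T :: 'a set. u / (2 * sqrt (card T)))"
  define \<T>' where "\<T>' = \<T> - {{}}"
  have fin: "finite \<T>'" using \<T> X by (auto simp: \<T>'_def intro: finite_subset[of _ "Pow X"])
  have fin\<T>: "finite \<T>" using \<T> X by (auto intro: finite_subset[of _ "Pow X"])
  define E where "E = (\<lambda>(T :: 'a set) c \<epsilon>. exp (- u\<^sup>2 / 2) * exp (c * (\<Sum>i\<in>T. \<epsilon> i)))"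
  define F where "F = (\<lambda>\<epsilon>. \<Sum>T\<in>\<T>'. E T (t T) \<epsilon> + E T (- t T) \<epsilon>)"
  have E0: "0 < E T c \<epsilon>" for T c \<epsilon> by (simp add: E_def)
  have avgE: "sign_avg X (E T c) \<le> exp (- u\<^sup>2 / 4)" if T: "T \<in> \<T>'" "c\<^sup>2 = (t T)\<^sup>2" for T c
  proof -
    have "T \<subseteq> X" "T \<noteq> {}" using T \<T> by (auto simp: \<T>'_def)
    then have TX: "T \<subseteq> X" "card T > 0" "finite T"
      using finite_subset[OF _ X] by (auto simp: card_gt_0_iff)
    have sum_T: "(\<Sum>i\<in>X. if i \<in> T then h i else 0) = sum h T" for h :: "'a \<Rightarrow> real"
      using TX X by (simp add: sum.inter_restrict[symmetric] Int_absorb1)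
    have "sign_avg X (E T c) = exp (- u\<^sup>2 / 2) * sign_avg X (\<lambda>\<epsilon>. exp (\<Sum>i\<in>X. (if i \<in> T then c else 0) * \<epsilon> i))"
      unfolding E_def sign_avg_mult
      by (simp add: if_distrib[where f = "\<lambda>a. a * _"] sum_T sum_distrib_left cong: if_cong)
    also have "\<dots> \<le> exp (- u\<^sup>2 / 2) * exp (\<Sum>i\<in>X. (if i \<in> T then c else 0)\<^sup>2)"
      by (intro mult_left_mono sign_avg_exp_le X) auto
    also have "(\<Sum>i\<in>X. (if i \<in> T then c else 0)\<^sup>2) = card T * c\<^sup>2"
      using sum_T[of "\<lambda>_. c\<^sup>2"] by (simp add: if_distrib[where f = "\<lambda>a. a\<^sup>2"] cong: if_cong)
    also have "\<dots> = u\<^sup>2 / 4" unfolding T(2) using TX by (auto simp: t_def power_divide power_mult_distrib)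
    also have "exp (- u\<^sup>2 / 2) * exp (u\<^sup>2 / 4) = exp (- u\<^sup>2 / 4)"
      by (simp flip: exp_add)
    finally show ?thesis .
  qed
  have "sign_avg X F = (\<Sum>T\<in>\<T>'. sign_avg X (E T (t T)) + sign_avg X (E T (- t T)))"
    unfolding F_def sign_avg_sum sign_avg_add ..
  also have "\<dots> \<le> (\<Sum>T\<in>\<T>'. exp (- u\<^sup>2 / 4) + exp (- u\<^sup>2 / 4))"
    by (intro sum_mono add_mono avgE) auto
  also have "\<dots> = real (card \<T>') * (2 * exp (- u\<^sup>2 / 4))" by simp
  also have "\<dots> \<le> 2 ^ N * (2 * exp (- u\<^sup>2 / 4))"
  proof (intro mult_right_mono)
    have "card \<T>' \<le> 2 ^ N" using card_mono[OF fin\<T>, of \<T>'] N by (auto simp: \<T>'_def)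
    then have "real (card \<T>') \<le> real (2 ^ N)" by (rule of_nat_mono)
    then show "real (card \<T>') \<le> 2 ^ N" by simp
  qed simp
  \<comment> \<open>Here the choice of \<open>u\<close> enters:
    \<open>u\<^sup>2 / 4 = N + 2\<close>, and \<open>exp (N + 2)\<close> is at least
    \<open>2 ^ (N + 2)\<close>, more than the \<open>2 * 2 ^ N\<close> terms that \<open>F\<close>
    can have.\<close>
  also have "\<dots> < 1"
  proof -
    have "(2 :: real) ^ (N + 2) \<le> exp 1 ^ (N + 2)"
      using exp_ge_add_one_self[of 1] by (intro power_mono) auto
    also have "\<dots> = exp (real (N + 2))"
      by (simp only: exp_of_nat_mult[symmetric] mult_1_right)
    also have "real (N + 2) = u\<^sup>2 / 4" by (simp add: u)
    finally have "2 ^ N * 4 \<le> exp (u\<^sup>2 / 4)" by simp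
    then have "2 ^ N * 2 < exp (u\<^sup>2 / 4)" using zero_less_power[of "2 :: real" N] by linarith
    then show ?thesis by (simp add: exp_minus divide_simps)
  qed
  finally have "sign_avg X F < 1" .
  have "\<exists>\<epsilon>\<in>PiE X (\<lambda>_. {-1, 1}). F \<epsilon> < 1"
  proof (rule ccontr)
    assume "\<not> ?thesis"
    then have "sign_avg X (\<lambda>_. 1) \<le> sign_avg X F" by (intro sign_avg_mono) auto
    then show False using \<open>sign_avg X F < 1\<close> X by simp
  qed
  then obtain \<epsilon> where \<epsilon>: "\<epsilon> \<in> PiE X (\<lambda>_. {-1, 1})" "F \<epsilon> < 1" by blast
  have "\<bar>\<Sum>i\<in>T. \<epsilon> i\<bar> \<le> u * sqrt (card T)" if T: "T \<in> \<T>" for T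
  proof (cases "T = {}")
    case False
    then have T': "T \<in> \<T>'" using T by (simp add: \<T>'_def)
    have "card T > 0" using finite_subset[OF \<T>[OF T] X] False by (simp add: card_gt_0_iff)
    then have t: "t T > 0" using u by (simp add: t_def)
    have "E T (t T) \<epsilon> + E T (- t T) \<epsilon> \<le> F \<epsilon>"
      unfolding F_def using T' fin E0 by (intro member_le_sum) (auto simp: less_imp_le add_nonneg_nonneg)
    then have "E T (t T) \<epsilon> < 1" "E T (- t T) \<epsilon> < 1"
      using \<epsilon>(2) E0[of T "t T" \<epsilon>] E0[of T "- t T" \<epsilon>] by linarith+
    then have "t T * (\<Sum>i\<in>T. \<epsilon> i) < u\<^sup>2 / 2" "- (t T * (\<Sum>i\<in>T. \<epsilon> i)) < u\<^sup>2 / 2"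
      unfolding E_def by (simp_all flip: exp_add)
    then have "t T * \<bar>\<Sum>i\<in>T. \<epsilon> i\<bar> \<le> u\<^sup>2 / 2"
      using t by (simp add: abs_if)
    then have "\<bar>\<Sum>i\<in>T. \<epsilon> i\<bar> \<le> u\<^sup>2 / 2 / t T" using t by (simp add: field_simps)
    also have "\<dots> = u * sqrt (card T)" using u(1) by (simp add: t_def field_simps power2_eq_square)
    finally show ?thesis .
  qed simp
  then show ?thesis using \<epsilon>(1) unfolding u_def by blast
qed

text \<open>The smallest value \<open>c a\<close> is removed: the hypothesis for all of
  \<open>S\<close> bounds it by \<open>K / sqrt (card S)\<close>, and the squares of these bounds
  add up to a harmonic number.\<close>

lemma sum_squares_le_harm:
  fixes c :: "'a \<Rightarrow> real"
  assumes "finite S" "\<And>t. t \<in> S \<Longrightarrow> 0 \<le> c t" "\<And>R. R \<subseteq> S \<Longrightarrow> (\<Sum>t\<in>R. c t) \<le> K * sqrt (card R)"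
  shows "(\<Sum>t\<in>S. (c t)\<^sup>2) \<le> K\<^sup>2 * harm (card S)"
  using assms
proof (induction "card S" arbitrary: S)
  case 0
  then show ?case by (simp add: harm_nonneg)
next
  case (Suc N)
  have "S \<noteq> {}" using Suc.hyps by auto
  define a where "a = arg_min_on c S"
  have a: "a \<in> S" "\<And>t. t \<in> S \<Longrightarrow> c a \<le> c t"
    using Suc.prems(1) \<open>S \<noteq> {}\<close> arg_min_if_finite(1)[of S c] arg_min_least[of S _ c] by (auto simp: a_def)
  have "card S * c a \<le> (\<Sum>t\<in>S. c t)"
    using sum_mono[of S "\<lambda>_. c a" c] a by simp
  also have "\<dots> \<le> K * sqrt (card S)" by (rule Suc.prems(3)) simp
  finally have "(card S * c a)\<^sup>2 \<le> (K * sqrt (card S))\<^sup>2"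
    using Suc.prems(2)[OF a(1)] by (intro power_mono) auto
  then have "card S * (card S * (c a)\<^sup>2) \<le> card S * K\<^sup>2"
    by (simp add: power_mult_distrib power2_eq_square mult_ac)
  then have ca: "(c a)\<^sup>2 \<le> K\<^sup>2 * inverse (card S)"
    using Suc.hyps(2) by (simp add: divide_simps mult.commute del: of_nat_Suc)
  have cN: "card (S - {a}) = N" using Suc.hyps(2) Suc.prems(1) a by simp
  have "(\<Sum>t\<in>S - {a}. (c t)\<^sup>2) \<le> K\<^sup>2 * harm (card (S - {a}))"
    using Suc.hyps(2) Suc.prems a by (intro Suc.hyps(1)) auto
  then have "(\<Sum>t\<in>S. (c t)\<^sup>2) \<le> K\<^sup>2 * harm N + K\<^sup>2 * inverse (card S)"
    using ca Suc.prems(1) a unfolding cN by (simp add: sum.remove[of S a] del: of_nat_Suc)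
  also have "\<dots> = K\<^sup>2 * harm (card S)"
    unfolding Suc.hyps(2)[symmetric] harm_Suc by (simp add: distrib_left)
  finally show ?case .
qed

text \<open>Each real coordinate is split by its sign; on either part the absolute values add up to
  a subset sum, up to sign. Hence the factor 2 per coordinate.\<close>

lemma sum_norm_le_of_subset_sums:
  fixes c :: "'a \<Rightarrow> 'k::euclidean_space" and K :: real
  assumes "finite S" "\<And>R. R \<subseteq> S \<Longrightarrow> norm (\<Sum>t\<in>R. c t) \<le> K * sqrt (card R)" "0 \<le> K" "R \<subseteq> S"
  shows "(\<Sum>t\<in>R. norm (c t)) \<le> 2 * DIM('k) * K * sqrt (card R)"
proof -
  have R: "finite R" using assms by (auto intro: finite_subset)
  have *: "(\<Sum>t\<in>R. \<bar>c t \<bullet> b\<bar>) \<le> 2 * (K * sqrt (card R))" if "b \<in> Basis" for b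
  proof -
    have sub: "\<bar>(\<Sum>t\<in>R'. c t \<bullet> b)\<bar> \<le> K * sqrt (card R)" if "R' \<subseteq> R" for R'
    proof -
      have "\<bar>(\<Sum>t\<in>R'. c t \<bullet> b)\<bar> \<le> norm (\<Sum>t\<in>R'. c t)"
        using Basis_le_norm[OF \<open>b \<in> Basis\<close>, of "sum c R'"] by (simp add: inner_sum_left)
      also have "\<dots> \<le> K * sqrt (card R')" using assms(4) that by (intro assms(2)) auto
      also have "\<dots> \<le> K * sqrt (card R)"
        using card_mono[OF R that] assms(3) by (intro mult_left_mono) auto
      finally show ?thesis .
    qed
    define P where "P = {t \<in> R. 0 \<le> c t \<bullet> b}"
    have "(\<Sum>t\<in>R. \<bar>c t \<bullet> b\<bar>) = (\<Sum>t\<in>P. \<bar>c t \<bullet> b\<bar>) + (\<Sum>t\<in>R - P. \<bar>c t \<bullet> b\<bar>)"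
      using R by (subst add.commute, intro sum.subset_diff) (auto simp: P_def)
    also have "\<dots> = (\<Sum>t\<in>P. c t \<bullet> b) + (\<Sum>t\<in>R - P. - (c t \<bullet> b))"
      by (intro arg_cong2[where f = "(+)"] sum.cong) (auto simp: P_def)
    also have "\<dots> \<le> 2 * (K * sqrt (card R))"
      using sub[of P] sub[of "R - P"] by (simp add: P_def sum_negf)
    finally show ?thesis .
  qed
  have "(\<Sum>t\<in>R. norm (c t)) \<le> (\<Sum>t\<in>R. \<Sum>b\<in>Basis. \<bar>c t \<bullet> b\<bar>)"
    by (intro sum_mono norm_le_l1)
  also have "\<dots> = (\<Sum>b\<in>Basis. \<Sum>t\<in>R. \<bar>c t \<bullet> b\<bar>)" by (rule sum.swap)
  also have "\<dots> \<le> (\<Sum>b\<in>(Basis :: 'k set). 2 * (K * sqrt (card R)))" by (intro sum_mono *)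
  finally show ?thesis by (simp add: mult_ac)
qed

text \<open>Passes from indicator functions to l_2 vectors: the square sum of the coefficients is
  bounded by \<open>sum_squares_le_harm\<close>, and Cauchy-Schwarz does the rest.\<close>

lemma linear_form_bound_of_subset_sums:
  fixes c x :: "'a \<Rightarrow> 'k::{real_normed_field,euclidean_space}"
  assumes "finite S" "\<And>R. R \<subseteq> S \<Longrightarrow> norm (\<Sum>t\<in>R. c t) \<le> K * sqrt (card R)" "0 \<le> K"
  shows "norm (\<Sum>t\<in>S. x t * c t) \<le> K * (2 * DIM('k) * sqrt (harm (card S))) * sqrt (\<Sum>t\<in>S. (norm (x t))\<^sup>2)"
proof -
  define L where "L = 2 * DIM('k) * K"
  have "(\<Sum>t\<in>S. (norm (c t))\<^sup>2) \<le> L\<^sup>2 * harm (card S)"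
    unfolding L_def using sum_norm_le_of_subset_sums[OF assms] assms(1)
    by (intro sum_squares_le_harm) auto
  then have cS: "sqrt (\<Sum>t\<in>S. (norm (c t))\<^sup>2) \<le> L * sqrt (harm (card S))"
    using assms(3) by (simp add: real_le_lsqrt power_mult_distrib L_def harm_nonneg sum_nonneg)
  have "norm (\<Sum>t\<in>S. x t * c t) \<le> (\<Sum>t\<in>S. norm (x t) * norm (c t))"
    by (rule order_trans[OF norm_sum]) (simp add: norm_mult)
  also have "\<dots> \<le> sqrt ((\<Sum>t\<in>S. (norm (x t))\<^sup>2) * (\<Sum>t\<in>S. (norm (c t))\<^sup>2))"
    by (intro real_le_rsqrt Cauchy_Schwarz_ineq_sum)
  also have "\<dots> \<le> sqrt (\<Sum>t\<in>S. (norm (x t))\<^sup>2) * (L * sqrt (harm (card S)))"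
    unfolding real_sqrt_mult using cS by (intro mult_left_mono) (auto intro: sum_nonneg)
  finally show ?thesis by (simp add: L_def mult_ac)
qed

text \<open>Induction on the set \<open>D\<close> of arguments that are arbitrary, the others being
  indicator functions. Empty \<open>D\<close> is the hypothesis on boxes; each further argument
  costs one factor from \<open>linear_form_bound_of_subset_sums\<close>.\<close>

lemma multilinear_form_bound_of_box_sums:
  fixes a :: "('l \<Rightarrow> 't) \<Rightarrow> 'k::{real_normed_field,euclidean_space}"
  assumes K: "finite K" and T: "finite T" and u: "0 \<le> u"
    and box: "\<And>S. (\<And>k. k \<in> K \<Longrightarrow> S k \<subseteq> T) \<Longrightarrow> norm (\<Sum>i\<in>PiE K S. a i) \<le> u * (\<Prod>k\<in>K. sqrt (card (S k)))"
  shows "norm (\<Sum>i\<in>PiE K (\<lambda>_. T). a i * (\<Prod>k\<in>K. x k (i k)))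
    \<le> u * (2 * DIM('k) * sqrt (harm (card T))) ^ card K * (\<Prod>k\<in>K. sqrt (\<Sum>t\<in>T. (norm (x k t))\<^sup>2))"
proof -
  define c where "c = 2 * DIM('k) * sqrt (harm (card T))"
  have c0: "0 \<le> c" by (simp add: c_def harm_nonneg)
  define F where "F = (\<lambda>x. \<Sum>i\<in>PiE K (\<lambda>_. T). a i * (\<Prod>k\<in>K. x k (i k)))"
  define nr where "nr = (\<lambda>y :: 't \<Rightarrow> 'k. sqrt (\<Sum>t\<in>T. (norm (y t))\<^sup>2))"
  have nr0: "0 \<le> nr y" for y unfolding nr_def by (simp add: sum_nonneg)
  define ind where "ind = (\<lambda>(S :: 't set) t. if t \<in> S then 1 else 0 :: 'k)"
  have nr_ind: "nr (ind R) = sqrt (card R)" if "R \<subseteq> T" for R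
  proof -
    have "(\<Sum>t\<in>T. (norm (ind R t))\<^sup>2) = (\<Sum>t\<in>T. if t \<in> R then 1 else 0)"
      by (intro sum.cong) (auto simp: ind_def)
    then show ?thesis using that T by (simp add: nr_def sum.inter_restrict[symmetric] Int_absorb1)
  qed
  have "norm (F x) \<le> u * c ^ card D * (\<Prod>k\<in>K. nr (x k))"
    if "finite D" "D \<subseteq> K" "\<And>k. k \<in> K - D \<Longrightarrow> \<exists>S\<subseteq>T. x k = ind S" for D x
    using that
  proof (induction D arbitrary: x rule: finite_induct)
    case empty
    then obtain S where S: "\<And>k. k \<in> K \<Longrightarrow> S k \<subseteq> T" "\<And>k. k \<in> K \<Longrightarrow> x k = ind (S k)"
      by (metis Diff_empty)
    have "F x = (\<Sum>i\<in>PiE K (\<lambda>_. T). if i \<in> PiE K S then a i else 0)"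
      unfolding F_def
    proof (rule sum.cong[OF refl])
      fix i assume i: "i \<in> PiE K (\<lambda>_. T)"
      show "a i * (\<Prod>k\<in>K. x k (i k)) = (if i \<in> PiE K S then a i else 0)"
      proof (cases "i \<in> PiE K S")
        case True
        then have "(\<Prod>k\<in>K. x k (i k)) = 1" by (intro prod.neutral) (auto simp: S ind_def)
        then show ?thesis using True by simp
      next
        case False
        then obtain k where "k \<in> K" "i k \<notin> S k" using i by (auto simp: PiE_iff)
        then have "(\<Prod>k\<in>K. x k (i k)) = 0" using K by (intro prod_zero) (auto simp: S ind_def)
        then show ?thesis using False by simp
      qed
    qed
    also have "\<dots> = (\<Sum>i\<in>PiE K S. a i)"
    proof -
      have "PiE K S \<subseteq> PiE K (\<lambda>_. T)" using S(1) by (intro PiE_mono) auto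
      then show ?thesis using K T by (simp add: sum.inter_restrict[symmetric] finite_PiE Int_absorb1)
    qed
    finally have "norm (F x) \<le> u * (\<Prod>k\<in>K. sqrt (card (S k)))" using box[of S] S by simp
    then show ?case using nr_ind S by simp
  next
    case (insert l D)
    have l: "l \<in> K" and Kl: "insert l (K - {l}) = K" using insert.prems by auto
    \<comment> \<open>The coefficients of the form in its argument \<open>l\<close>, the others
      being fixed. Their sum over a set \<open>R\<close> is the value of the form at an indicator
      function, which the induction hypothesis bounds.\<close>
    define G where "G = (\<lambda>t. \<Sum>i\<in>PiE (K - {l}) (\<lambda>_. T). a (i(l := t)) * (\<Prod>k\<in>K - {l}. x k (i k)))"
    have FG: "F (x(l := y)) = (\<Sum>t\<in>T. y t * G t)" for y
    proof -
      have "(\<Prod>k\<in>K. (x(l := y)) k ((i(l := t)) k)) = y t * (\<Prod>k\<in>K - {l}. x k (i k))" for i t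
      proof -
        have "(\<Prod>k\<in>K. (x(l := y)) k ((i(l := t)) k)) = y t * (\<Prod>k\<in>K - {l}. (x(l := y)) k ((i(l := t)) k))"
          using K l by (simp add: prod.remove)
        also have "(\<Prod>k\<in>K - {l}. (x(l := y)) k ((i(l := t)) k)) = (\<Prod>k\<in>K - {l}. x k (i k))"
          by (intro prod.cong) auto
        finally show ?thesis .
      qed
      then have "F (x(l := y)) = (\<Sum>t\<in>T. \<Sum>i\<in>PiE (K - {l}) (\<lambda>_. T). a (i(l := t)) * (y t * (\<Prod>k\<in>K - {l}. x k (i k))))"
        unfolding F_def by (subst Kl[symmetric], subst sum_PiE_insert) simp_all
      then show ?thesis by (simp add: G_def sum_distrib_left mult_ac)
    qed
    define P where "P = u * c ^ card D * (\<Prod>k\<in>K - {l}. nr (x k))"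
    have P0: "0 \<le> P" using u c0 nr0 by (simp add: P_def prod_nonneg)
    have prod_nr: "(\<Prod>k\<in>K. nr ((x(l := y)) k)) = nr y * (\<Prod>k\<in>K - {l}. nr (x k))" for y
      using K l by (simp add: prod.remove[of K l])
    have "norm (\<Sum>t\<in>R. G t) \<le> P * sqrt (card R)" if R: "R \<subseteq> T" for R
    proof -
      have "(\<Sum>t\<in>R. G t) = (\<Sum>t\<in>T. if t \<in> R then G t else 0)"
        using T R by (simp add: sum.inter_restrict[symmetric] Int_absorb1)
      also have "\<dots> = F (x(l := ind R))"
        unfolding FG by (intro sum.cong) (auto simp: ind_def)
      finally have eq: "(\<Sum>t\<in>R. G t) = F (x(l := ind R))" .
      have "norm (F (x(l := ind R))) \<le> u * c ^ card D * (\<Prod>k\<in>K. nr ((x(l := ind R)) k))"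
        using insert.prems insert.hyps R by (intro insert.IH) auto
      then show ?thesis unfolding eq prod_nr nr_ind[OF R] by (simp add: P_def mult_ac)
    qed
    then have "norm (\<Sum>t\<in>T. x l t * G t) \<le> P * c * nr (x l)"
      unfolding c_def nr_def using T P0 by (intro linear_form_bound_of_subset_sums) auto
    moreover have "(\<Sum>t\<in>T. x l t * G t) = F x" using FG[of "x l"] by simp
    ultimately show ?case
      using insert.hyps prod_nr[of "x l"] by (simp add: P_def mult_ac)
  qed
  from this[of K x] show ?thesis using K by (simp add: F_def nr_def c_def)
qed

text \<open>Balanced signs for the family of all boxes in the cube of side \<open>n\<close>,
  followed by the passage from boxes to l_2 vectors. There are \<open>(2 ^ n) ^ M\<close> choices of
  the sides of a box, whence the term \<open>n * M\<close> under the root.\<close>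

lemma exists_sign_form:
  fixes M n :: nat
  shows "\<exists>\<epsilon> :: (nat \<Rightarrow> nat) \<Rightarrow> real. (\<forall>i\<in>PiE {..<M} (\<lambda>_. {..<n}). \<bar>\<epsilon> i\<bar> = 1) \<and>
    (\<forall>x :: nat \<Rightarrow> nat \<Rightarrow> 'k::{real_normed_field,euclidean_space}.
      norm (\<Sum>i\<in>PiE {..<M} (\<lambda>_. {..<n}). of_real (\<epsilon> i) * (\<Prod>k<M. x k (i k)))
      \<le> 2 * sqrt (n * M + 2) * (2 * DIM('k) * sqrt (harm n)) ^ M * (\<Prod>k<M. sqrt (\<Sum>t<n. (norm (x k t))\<^sup>2)))"
proof -
  let ?X = "PiE {..<M} (\<lambda>_. {..<n})"
  define \<T> where "\<T> = (\<lambda>S. PiE {..<M} S) ` (PiE {..<M} (\<lambda>_. Pow {..<n}))"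
  have "card \<T> \<le> card (PiE {..<M} (\<lambda>_. Pow {..<n}))"
    unfolding \<T>_def by (intro card_image_le finite_PiE) auto
  also have "\<dots> = 2 ^ (n * M)" by (simp add: card_PiE card_Pow power_mult)
  finally have card: "card \<T> \<le> 2 ^ (n * M)" .
  have "T \<subseteq> ?X" if "T \<in> \<T>" for T
    using that unfolding \<T>_def by (force simp: PiE_iff)
  from exists_balanced_signs[OF _ this card] obtain \<epsilon> :: "(nat \<Rightarrow> nat) \<Rightarrow> real" where
    \<epsilon>: "\<epsilon> \<in> PiE ?X (\<lambda>_. {-1, 1})" "\<And>T. T \<in> \<T> \<Longrightarrow> \<bar>\<Sum>i\<in>T. \<epsilon> i\<bar> \<le> 2 * sqrt (n * M + 2) * sqrt (card T)"
    by (auto simp: finite_PiE)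
  have "\<bar>\<epsilon> i\<bar> = 1" if "i \<in> ?X" for i using PiE_mem[OF \<epsilon>(1) that] by auto
  moreover have "norm (\<Sum>i\<in>PiE {..<M} S. of_real (\<epsilon> i) :: 'k) \<le> 2 * sqrt (n * M + 2) * (\<Prod>k<M. sqrt (card (S k)))"
    if S: "\<And>k. k \<in> {..<M} \<Longrightarrow> S k \<subseteq> {..<n}" for S
  proof -
    have "PiE {..<M} S = PiE {..<M} (restrict S {..<M})" by (intro PiE_cong) auto
    moreover have "restrict S {..<M} \<in> PiE {..<M} (\<lambda>_. Pow {..<n})" using S by auto
    ultimately have "PiE {..<M} S \<in> \<T>" unfolding \<T>_def by blast
    moreover have "sqrt (\<Prod>k<M. real (card (S k))) = (\<Prod>k<M. sqrt (card (S k)))"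
      by (induction M) (auto simp: real_sqrt_mult)
    ultimately show ?thesis
      using \<epsilon>(2)[of "PiE {..<M} S"] by (simp add: card_PiE flip: of_real_sum)
  qed
  then have "norm (\<Sum>i\<in>?X. of_real (\<epsilon> i) * (\<Prod>k<M. x k (i k)))
      \<le> 2 * sqrt (n * M + 2) * (2 * DIM('k) * sqrt (harm (card {..<n}))) ^ card {..<M}
        * (\<Prod>k<M. sqrt (\<Sum>t<n. (norm (x k t))\<^sup>2))" for x :: "nat \<Rightarrow> nat \<Rightarrow> 'k"
    by (intro multilinear_form_bound_of_box_sums) auto
  ultimately show ?thesis by (intro exI[of _ \<epsilon>]) simp
qed

section \<open>Necessity of the exponent condition\<close>

lemma power_mean_powr:
  fixes y :: "nat \<Rightarrow> real"
  assumes "0 < a" "a \<le> b" "\<And>t. 0 \<le> y t" "0 < n"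
  shows "(\<Sum>t<n. y t powr a) powr (1 / a) \<le> n powr (1 / a - 1 / b) * (\<Sum>t<n. y t powr b) powr (1 / b)"
proof -
  have "(\<Sum>t<n. y t powr a) = (\<Sum>t<n. (y t powr b) powr (a / b) * 1 powr (1 - a / b))"
    using assms by (simp add: powr_powr)
  also have "\<dots> \<le> (\<Sum>t<n. y t powr b) powr (a / b) * (\<Sum>t<n. 1) powr (1 - a / b)"
    using assms by (intro Holder_sum_powr) auto
  finally have "(\<Sum>t<n. y t powr a) powr (1 / a) \<le> ((\<Sum>t<n. y t powr b) powr (a / b) * n powr (1 - a / b)) powr (1 / a)"
    using assms by (intro powr_mono2) (auto simp: sum_nonneg)
  also have "\<dots> = (\<Sum>t<n. y t powr b) powr (1 / b) * n powr ((1 - a / b) * (1 / a))"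
    using assms by (simp add: powr_mult powr_powr)
  also have "(1 - a / b) * (1 / a) = 1 / a - 1 / b" using assms by (simp add: field_simps)
  finally show ?thesis by (simp add: mult.commute)
qed

lemma norm_le_X_norm:
  assumes "1 \<le> p" "x \<in> X_space p"
  shows "norm (x t) \<le> X_norm p x"
proof (cases "p = \<infinity>")
  case True
  then show ?thesis using norm_le_X_norm_c0[of x t] assms by (simp add: X_norm_def)
next
  case False
  define P where "P = enn2real p"
  have P: "1 \<le> P" using enn2real_one_divide[OF assms(1) False] by (simp add: P_def)
  have "summable (\<lambda>n. norm (x n) powr P)"
    using assms(2) False by (simp add: X_space_def ell_def P_def)
  then have "(\<Sum>n\<in>{t}. norm (x n) powr P) \<le> (\<Sum>n. norm (x n) powr P)"
    by (intro sum_le_suminf) auto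
  then have "(norm (x t) powr P) powr (1 / P) \<le> (\<Sum>n. norm (x n) powr P) powr (1 / P)"
    using P by (intro powr_mono2) auto
  then show ?thesis using P False by (simp add: X_norm_def ell_norm_def P_def powr_powr)
qed

lemma X_space_diff:
  assumes "1 \<le> p" "x \<in> X_space p" "y \<in> X_space p"
  shows "(\<lambda>n. y n - x n) \<in> X_space p"
proof (cases "p = \<infinity>")
  case True
  then show ?thesis using assms tendsto_diff[of y 0 sequentially x 0] by (simp add: X_space_def)
next
  case False
  define P where "P = enn2real p"
  have P: "1 \<le> P" using enn2real_one_divide[OF assms(1) False] by (simp add: P_def)
  have le: "norm (y n - x n) powr P \<le> 2 powr P * (norm (y n) powr P + norm (x n) powr P)" for n
  proof -
    define M where "M = max (norm (y n)) (norm (x n))"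
    have "norm (y n - x n) powr P \<le> (2 * M) powr P"
      using norm_triangle_ineq4[of "y n" "x n"] P by (intro powr_mono2) (auto simp: M_def)
    also have "\<dots> = 2 powr P * M powr P" by (rule powr_mult)
    also have "\<dots> \<le> 2 powr P * (norm (y n) powr P + norm (x n) powr P)"
      by (intro mult_left_mono) (auto simp: M_def max_def)
    finally show ?thesis .
  qed
  have "summable (\<lambda>n. 2 powr P * (norm (y n) powr P + norm (x n) powr P))"
    using assms False by (intro summable_mult summable_add) (auto simp: X_space_def ell_def P_def)
  then have "summable (\<lambda>n. norm (y n - x n) powr P)"
    by (rule summable_comparison_test'[where N = 0]) (use le in simp)
  then show ?thesis using False by (simp add: X_space_def ell_def P_def)
qed

text \<open>The norm of the identity from l_p to l_2 in dimension \<open>n\<close> for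
  \<open>p \<ge> 2\<close>, with reciprocal 0 for c_0.\<close>

lemma l2_norm_le_X_norm:
  assumes "1 \<le> p" "enn2real (1 / p) \<le> 1 / 2" "x \<in> X_space p" "X_norm p x \<le> 1" "0 < n"
  shows "sqrt (\<Sum>t<n. (norm (x t))\<^sup>2) \<le> n powr (1 / 2 - enn2real (1 / p))"
proof (cases "p = \<infinity>")
  case True
  have "(\<Sum>t<n. (norm (x t))\<^sup>2) \<le> (\<Sum>t<n. 1)"
  proof (rule sum_mono)
    fix t
    have "norm (x t) \<le> 1" using norm_le_X_norm[OF assms(1,3), of t] assms(4) by simp
    then show "(norm (x t))\<^sup>2 \<le> 1" by (simp add: power_le_one)
  qed
  then show ?thesis using True assms(5) by (simp add: powr_half_sqrt)
next
  case False
  define P where "P = enn2real p"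
  have P: "1 \<le> P" "enn2real (1 / p) = 1 / P" using enn2real_one_divide[OF assms(1) False] by (auto simp: P_def)
  then have "1 / P \<le> 1 / 2" using assms(2) by simp
  then have P2: "2 \<le> P" using P(1) by (simp add: field_simps)
  have sm: "summable (\<lambda>n. norm (x n) powr P)"
    using assms(3) False by (simp add: X_space_def ell_def P_def)
  have "sqrt (\<Sum>t<n. (norm (x t))\<^sup>2) = (\<Sum>t<n. norm (x t) powr 2) powr (1 / 2)"
    by (simp add: powr_half_sqrt sum_nonneg)
  also have "\<dots> \<le> n powr (1 / 2 - 1 / P) * (\<Sum>t<n. norm (x t) powr P) powr (1 / P)"
    using assms P2 by (intro power_mean_powr) auto
  also have "\<dots> \<le> n powr (1 / 2 - 1 / P) * 1"
  proof (intro mult_left_mono)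
    have "(\<Sum>t<n. norm (x t) powr P) \<le> (\<Sum>t. norm (x t) powr P)"
      using sm by (intro sum_le_suminf) auto
    then have "(\<Sum>t<n. norm (x t) powr P) powr (1 / P) \<le> X_norm p x"
      using P False by (auto simp: X_norm_def ell_norm_def P_def[symmetric] intro!: powr_mono2 sum_nonneg)
    then show "(\<Sum>t<n. norm (x t) powr P) powr (1 / P) \<le> 1" using assms(4) by simp
  qed simp
  finally show ?thesis unfolding P(2) by simp
qed

section \<open>Multilinear maps given by finite arrays\<close>

text \<open>The output coordinate is the entry at position \<open>m\<close> of the multi-index, so
  that one array describes both the map into l_s and the form in \<open>m + 1\<close>
  arguments.\<close>

definition array_map ::
  "nat \<Rightarrow> nat \<Rightarrow> ((nat \<Rightarrow> nat) \<Rightarrow> 'k::real_normed_field) \<Rightarrow> (nat \<Rightarrow> nat \<Rightarrow> 'k) \<Rightarrow> nat \<Rightarrow> 'k" where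
  "array_map m n a x j = (if j < n then
     \<Sum>i\<in>PiE {..<m} (\<lambda>_. {..<n}). a (i(m := j)) * (\<Prod>k<m. x k (i k)) else 0)"

lemma ell_norm_array:
  assumes "0 < r" "\<And>j. n \<le> j \<Longrightarrow> y j = 0"
  shows "ell_norm r y = (\<Sum>j<n. norm (y j) powr r) powr (1 / r)"
proof -
  have "(\<Sum>j. norm (y j) powr r) = (\<Sum>j<n. norm (y j) powr r)"
    using assms by (intro suminf_finite) (auto simp: not_less)
  then show ?thesis by (simp add: ell_norm_def)
qed

lemma array_map_multilinear: "multilinear_into_ell m p s (array_map m n a)"
proof -
  have upd: "(\<Prod>k<m. (x(l := y)) k (i k)) = y (i l) * (\<Prod>k\<in>{..<m} - {l}. x k (i k))"
    if "l < m" for x :: "nat \<Rightarrow> nat \<Rightarrow> 'a" and y l and i :: "nat \<Rightarrow> nat"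
  proof -
    have "(\<Prod>k<m. (x(l := y)) k (i k)) = y (i l) * (\<Prod>k\<in>{..<m} - {l}. (x(l := y)) k (i k))"
      using that by (simp add: prod.remove[of "{..<m}" l])
    also have "(\<Prod>k\<in>{..<m} - {l}. (x(l := y)) k (i k)) = (\<Prod>k\<in>{..<m} - {l}. x k (i k))"
      by (intro prod.cong) auto
    finally show ?thesis .
  qed
  have "array_map m n a x \<in> ell s" for x
    unfolding ell_def mem_Collect_eq
    by (intro summable_finite[of "{..<n}"]) (auto simp: array_map_def)
  then show ?thesis
    unfolding multilinear_into_ell_def
    by (auto simp: array_map_def upd fun_eq_iff distrib_left distrib_right sum.distrib sum_distrib_left mult_ac
        simp del: fun_upd_apply)
qed

text \<open>Argued by sequences: a small \<open>X_norm\<close> forces every coordinate to be small,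
  and the values are polynomials in finitely many coordinates.\<close>

lemma array_map_continuous:
  fixes a :: "(nat \<Rightarrow> nat) \<Rightarrow> 'k::real_normed_field"
  assumes p: "\<And>j. j < m \<Longrightarrow> 1 \<le> p j" and s: "1 \<le> s"
  shows "continuous_into_ell m p s (array_map m n a)"
  unfolding continuous_into_ell_def
proof (intro ballI allI impI)
  fix x :: "nat \<Rightarrow> nat \<Rightarrow> 'k" and e :: real
  assume x: "x \<in> X_prod m p" and e: "0 < e"
  let ?A = "array_map m n a"
  show "\<exists>\<delta>>0. \<forall>y\<in>X_prod m p. (\<forall>j<m. X_norm (p j) (\<lambda>n. y j n - x j n) < \<delta>) \<longrightarrow>
      ell_norm s (\<lambda>j. ?A y j - ?A x j) < e"
  proof (rule ccontr)
    assume "\<not> ?thesis"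
    then have far: "\<exists>y. y \<in> X_prod m p \<and> (\<forall>j<m. X_norm (p j) (\<lambda>n. y j n - x j n) < \<delta>) \<and>
      \<not> ell_norm s (\<lambda>j. ?A y j - ?A x j) < e" if "0 < \<delta>" for \<delta>
      using that by blast
    have "\<exists>y. \<forall>N. y N \<in> X_prod m p \<and> (\<forall>j<m. X_norm (p j) (\<lambda>n. y N j n - x j n) < inverse (Suc N)) \<and>
      \<not> ell_norm s (\<lambda>j. ?A (y N) j - ?A x j) < e"
      by (intro choice allI far) simp
    then obtain y where y: "\<And>N. y N \<in> X_prod m p"
      "\<And>N j. j < m \<Longrightarrow> X_norm (p j) (\<lambda>n. y N j n - x j n) < inverse (Suc N)"
      "\<And>N. \<not> ell_norm s (\<lambda>j. ?A (y N) j - ?A x j) < e" by blast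
    have coord: "(\<lambda>N. y N k t) \<longlonglongrightarrow> x k t" if "k < m" for k t
    proof -
      have sp: "y N k \<in> X_space (p k)" "x k \<in> X_space (p k)" for N
        using y(1)[of N] x that by (auto simp: X_prod_def)
      have "norm (y N k t - x k t) \<le> inverse (Suc N)" for N
        using norm_le_X_norm[OF p[OF that] X_space_diff[OF p[OF that] sp(2) sp(1)], of N t] y(2)[OF that, of N] by simp
      then have "(\<lambda>N. y N k t - x k t) \<longlonglongrightarrow> 0"
        by (intro Lim_null_comparison[OF _ LIMSEQ_inverse_real_of_nat]) auto
      then show ?thesis by (simp add: LIM_zero_iff)
    qed
    have "(\<lambda>N. ?A (y N) j) \<longlonglongrightarrow> ?A x j" for j
      unfolding array_map_def by (auto intro!: tendsto_intros coord)
    then have "(\<lambda>N. \<Sum>j<n. norm (?A (y N) j - ?A x j) powr s) \<longlonglongrightarrow> (\<Sum>j<n. norm (?A x j - ?A x j) powr s)"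
      using s by (intro tendsto_sum tendsto_powr' tendsto_norm tendsto_diff tendsto_const) auto
    then have "(\<lambda>N. (\<Sum>j<n. norm (?A (y N) j - ?A x j) powr s) powr (1 / s)) \<longlonglongrightarrow> 0 powr (1 / s)"
      using s by (intro tendsto_powr' tendsto_const) (auto simp: sum_nonneg)
    moreover have "ell_norm s (\<lambda>j. ?A (y N) j - ?A x j) = (\<Sum>j<n. norm (?A (y N) j - ?A x j) powr s) powr (1 / s)" for N
      using s by (intro ell_norm_array) (auto simp: array_map_def)
    ultimately have "(\<lambda>N. ell_norm s (\<lambda>j. ?A (y N) j - ?A x j)) \<longlonglongrightarrow> 0" by simp
    from order_tendstoD(2)[OF this e] show False
      using y(3) by (auto simp: eventually_sequentially)
  qed
qed

lemma array_map_unit_tuple: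
  assumes "set is \<subseteq> {..<n}" "length is = m" "j < n"
  shows "array_map m n a (unit_tuple m is) j = a ((\<lambda>k\<in>{..<m}. is ! k)(m := j))"
proof -
  let ?X = "PiE {..<m} (\<lambda>_. {..<n})"
  define i0 where "i0 = (\<lambda>k\<in>{..<m}. is ! k)"
  have i0: "i0 \<in> ?X" using assms by (auto simp: i0_def subset_iff)
  have "(\<Sum>i\<in>?X. a (i(m := j)) * (\<Prod>k<m. unit_tuple m is k (i k))) = (\<Sum>i\<in>?X. if i = i0 then a (i0(m := j)) else 0)"
  proof (rule sum.cong[OF refl])
    fix i assume i: "i \<in> ?X"
    show "a (i(m := j)) * (\<Prod>k<m. unit_tuple m is k (i k)) = (if i = i0 then a (i0(m := j)) else 0)"
    proof (cases "i = i0")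
      case True
      then have "(\<Prod>k<m. unit_tuple m is k (i k)) = (1 :: 'a)"
        by (intro prod.neutral) (auto simp: i0_def unit_tuple_def unit_seq_def)
      then show ?thesis using True by simp
    next
      case False
      then obtain k where "k < m" "i k \<noteq> is ! k"
        using i by (auto simp: i0_def PiE_iff extensional_def fun_eq_iff restrict_def split: if_splits)
      then have "(\<Prod>k<m. unit_tuple m is k (i k)) = (0 :: 'a)"
        by (intro prod_zero) (auto simp: unit_tuple_def unit_seq_def)
      then show ?thesis using False by simp
    qed
  qed
  then show ?thesis
    using assms(3) i0 by (simp add: array_map_def i0_def finite_PiE)
qed

lemma nest_const:
  assumes "finite T" "T \<noteq> {}" "0 \<le> c" "\<And>q. q \<in> set qs \<Longrightarrow> 0 < q"
  shows "nest qs T (\<lambda>_. c) = card T powr (\<Sum>q\<leftarrow>qs. 1 / q) * c"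
  using assms(4)
proof (induction qs)
  case Nil
  then show ?case using assms by simp
next
  case (Cons q qs)
  have "0 < q" "q \<noteq> 0" using Cons.prems by fastforce+
  then show ?case
    using Cons assms by (simp add: powr_mult powr_powr powr_add mult_ac)
qed

text \<open>On tuples with entries below \<open>n\<close> the value has \<open>n\<close> coordinates
  of modulus 1, hence l_q norm \<open>n powr (1 / q)\<close>. Dropping all other tuples leaves the
  mixed norm of a constant.\<close>

lemma mixed_sum_array_map_ge:
  fixes \<epsilon> :: "(nat \<Rightarrow> nat) \<Rightarrow> real" and a :: "(nat \<Rightarrow> nat) \<Rightarrow> 'k::real_normed_field"
  assumes "1 \<le> m" "0 < n" "0 < q" "\<And>j. j < m \<Longrightarrow> 0 < qs j"
    and a: "\<And>i. i \<in> PiE {..<Suc m} (\<lambda>_. {..<n}) \<Longrightarrow> norm (a i) = 1"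
  shows "ennreal (n powr ((\<Sum>j<m. 1 / qs j) + 1 / q))
    \<le> mixed_sum m qs (\<lambda>is. ennreal (ell_norm q (array_map m n a (unit_tuple m is))))"
proof -
  have e: "ell_norm q (array_map m n a (unit_tuple m is)) = n powr (1 / q)"
    if "is": "set is \<subseteq> {..<n}" "length is = m" for "is"
  proof -
    have "norm (array_map m n a (unit_tuple m is) j) = 1" if j: "j < n" for j
    proof -
      have "(\<lambda>k\<in>{..<m}. is ! k)(m := j) \<in> PiE {..<Suc m} (\<lambda>_. {..<n})"
        using "is" j by (auto simp: PiE_iff extensional_def less_Suc_eq subset_iff)
      then show ?thesis unfolding array_map_unit_tuple[OF "is" j] by (rule a)
    qed
    then show ?thesis
      using assms(3) by (subst ell_norm_array[of q n]) (auto simp: array_map_def)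
  qed
  have qs: "0 < r" if "r \<in> set (map qs [0..<m])" for r using that assms(4) by auto
  have hd: "hd (map qs [0..<m]) = qs 0" "map qs [0..<m] \<noteq> []" "0 < qs 0"
    using assms(1,4) by (auto simp: hd_map)
  have "(\<Sum>r\<leftarrow>map qs [0..<m]. 1 / r) = (\<Sum>j<m. 1 / qs j)"
    by (simp add: o_def interv_sum_list_conv_sum_set_nat atLeast0LessThan)
  then have "ennreal (n powr ((\<Sum>j<m. 1 / qs j) + 1 / q)) = ennreal (nest (map qs [0..<m]) {..<n} (\<lambda>_. n powr (1 / q)))"
    using assms(2) qs by (subst nest_const) (auto simp: powr_add)
  also have "\<dots> = epowr (nested_sum (map qs [0..<m])
      (\<lambda>is. if set is \<subseteq> {..<n} then ennreal (n powr (1 / q)) else 0)) (1 / qs 0)"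
    using nested_sum_truncate[OF hd(2) qs, of "\<lambda>_. n powr (1 / q)" n] unfolding hd(1) by simp
  also have "\<dots> \<le> mixed_sum m qs (\<lambda>is. ennreal (ell_norm q (array_map m n a (unit_tuple m is))))"
    unfolding mixed_sum_def using hd(3) qs e by (intro epowr_mono nested_sum_mono) auto
  finally show ?thesis .
qed

text \<open>Three estimates are chained: the arguments pass from l_p to l_2, the sign form is
  bounded on l_2, and the value passes from l_2 to l_s. Each contributes one factor.\<close>

lemma exists_array_map_small_norm:
  assumes "1 \<le> s" "s \<le> 2" "0 < n" and p: "\<And>j. j < m \<Longrightarrow> 1 \<le> p j" "\<And>j. j < m \<Longrightarrow> enn2real (1 / p j) \<le> 1 / 2"
  shows "\<exists>a :: (nat \<Rightarrow> nat) \<Rightarrow> 'k::{real_normed_field,euclidean_space}.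
    (\<forall>i\<in>PiE {..<Suc m} (\<lambda>_. {..<n}). norm (a i) = 1) \<and>
    mult_norm m p s (array_map m n a) \<le> n powr (1 / s - 1 / 2) *
      (2 * sqrt (n * Suc m + 2) * (2 * DIM('k) * sqrt (harm n)) ^ Suc m * n powr (m / 2 - recip_sum m p))"
proof -
  define H where "H = 2 * sqrt (n * Suc m + 2) * (2 * DIM('k) * sqrt (harm n)) ^ Suc m"
  have H0: "0 \<le> H" by (simp add: H_def harm_nonneg)
  obtain \<epsilon> :: "(nat \<Rightarrow> nat) \<Rightarrow> real" where \<epsilon>: "\<And>i. i \<in> PiE {..<Suc m} (\<lambda>_. {..<n}) \<Longrightarrow> \<bar>\<epsilon> i\<bar> = 1"
    "\<And>x :: nat \<Rightarrow> nat \<Rightarrow> 'k. norm (\<Sum>i\<in>PiE {..<Suc m} (\<lambda>_. {..<n}). of_real (\<epsilon> i) * (\<Prod>k<Suc m. x k (i k)))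
      \<le> H * (\<Prod>k<Suc m. sqrt (\<Sum>t<n. (norm (x k t))\<^sup>2))"
    unfolding H_def using exists_sign_form[of "Suc m" n, where 'k = 'k] by blast
  define a where "a = (\<lambda>i. of_real (\<epsilon> i) :: 'k)"
  let ?A = "array_map m n a"
  have bound: "ell_norm s (?A x) \<le> n powr (1 / s - 1 / 2) * (H * n powr (m / 2 - recip_sum m p))"
    if x: "x \<in> X_prod m p" "\<And>j. j < m \<Longrightarrow> X_norm (p j) (x j) \<le> 1" for x
  proof -
    define L where "L = sqrt (\<Sum>t<n. (norm (?A x t))\<^sup>2)"
    define P where "P = (\<Prod>k<m. sqrt (\<Sum>t<n. (norm (x k t))\<^sup>2))"
    \<comment> \<open>This plays the role of the complex conjugate of \<open>?A x t\<close>,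
      uniformly in the scalar field. Testing the form with it gives \<open>L\<^sup>2\<close> on the
      left and one factor \<open>L\<close> on the right.\<close>
    define y where "y = (\<lambda>t. if ?A x t = 0 then 0 else of_real ((norm (?A x t))\<^sup>2) / ?A x t)"
    have ny: "norm (y t) = norm (?A x t)" for t
      by (simp add: y_def norm_divide norm_mult power2_eq_square)
    have "(\<Sum>i\<in>PiE {..<Suc m} (\<lambda>_. {..<n}). a i * (\<Prod>k<Suc m. (x(m := y)) k (i k)))
      = (\<Sum>t<n. \<Sum>i\<in>PiE {..<m} (\<lambda>_. {..<n}). a (i(m := t)) * (y t * (\<Prod>k<m. x k (i k))))"
    proof -
      have "(\<Prod>k<m. (x(m := y)) k ((i(m := t)) k)) = (\<Prod>k<m. x k (i k))" for i t
        by (intro prod.cong) auto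
      then have "(\<Prod>k<Suc m. (x(m := y)) k ((i(m := t)) k)) = y t * (\<Prod>k<m. x k (i k))" for i t
        by (simp add: mult.commute)
      then show ?thesis
        unfolding lessThan_Suc by (subst sum_PiE_insert) (simp_all add: mult_ac flip: lessThan_Suc)
    qed
    also have "\<dots> = (\<Sum>t<n. y t * ?A x t)"
      by (intro sum.cong) (auto simp: array_map_def sum_distrib_left mult_ac)
    also have "\<dots> = (\<Sum>t<n. of_real ((norm (?A x t))\<^sup>2))"
      by (intro sum.cong) (auto simp: y_def)
    also have "\<dots> = of_real (L\<^sup>2)" by (simp add: L_def sum_nonneg)
    finally have "norm (of_real (L\<^sup>2) :: 'k) \<le> H * (\<Prod>k<Suc m. sqrt (\<Sum>t<n. (norm ((x(m := y)) k t))\<^sup>2))"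
      using \<epsilon>(2)[of "x(m := y)"] by (simp only: a_def)
    moreover have "(\<Prod>k<m. sqrt (\<Sum>t<n. (norm ((x(m := y)) k t))\<^sup>2)) = P"
      unfolding P_def by (intro prod.cong) auto
    then have "(\<Prod>k<Suc m. sqrt (\<Sum>t<n. (norm ((x(m := y)) k t))\<^sup>2)) = P * L"
      unfolding prod.lessThan_Suc L_def by (simp add: ny)
    ultimately have "L\<^sup>2 \<le> H * (P * L)" by (simp only: norm_of_real abs_power2)
    moreover have "0 \<le> L" by (simp add: L_def sum_nonneg)
    moreover have P0: "0 \<le> P" by (simp add: P_def prod_nonneg sum_nonneg)
    ultimately have "L \<le> H * P"
      using H0 by (cases "L = 0") (auto simp: power2_eq_square)
    also have "\<dots> \<le> H * (\<Prod>k<m. n powr (1 / 2 - enn2real (1 / p k)))"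
      unfolding P_def using H0 assms(3) p x
      by (intro mult_left_mono prod_mono conjI l2_norm_le_X_norm) (auto simp: sum_nonneg X_prod_def)
    also have "(\<Prod>k<m. n powr (1 / 2 - enn2real (1 / p k))) = n powr (m / 2 - recip_sum m p)"
      using assms(3) by (simp add: recip_sum_def sum_subtractf flip: powr_sum)
    finally have "L \<le> H * n powr (m / 2 - recip_sum m p)" .
    moreover have "ell_norm s (?A x) \<le> n powr (1 / s - 1 / 2) * L"
    proof -
      have "ell_norm s (?A x) = (\<Sum>t<n. norm (?A x t) powr s) powr (1 / s)"
        using assms by (intro ell_norm_array) (auto simp: array_map_def)
      also have "\<dots> \<le> n powr (1 / s - 1 / 2) * (\<Sum>t<n. norm (?A x t) powr 2) powr (1 / 2)"
        using assms by (intro power_mean_powr) auto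
      also have "(\<Sum>t<n. norm (?A x t) powr 2) powr (1 / 2) = L"
        by (simp add: L_def powr_half_sqrt sum_nonneg)
      finally show ?thesis .
    qed
    ultimately show ?thesis by (meson mult_left_mono order_trans powr_ge_zero)
  qed
  have "mult_norm m p s ?A \<le> n powr (1 / s - 1 / 2) * (H * n powr (m / 2 - recip_sum m p))"
    unfolding mult_norm_def
  proof (rule cSup_least)
    define z :: "nat \<Rightarrow> nat \<Rightarrow> 'k" where "z = (\<lambda>j\<in>{..<m}. \<lambda>n. 0)"
    have "z \<in> X_prod m p"
      by (auto simp: z_def X_prod_def intro: X_space_finite_support)
    moreover have "X_norm (p j) (z j) \<le> 1" if "j < m" for j
      using that p(1)[OF that] by (intro X_norm_le_1[of _ 0 _ "\<lambda>_. 0"]) (auto simp: z_def)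
    ultimately show "{ell_norm s (?A x) |x. x \<in> X_prod m p \<and> (\<forall>j<m. X_norm (p j) (x j) \<le> 1)} \<noteq> {}" by blast
  qed (use bound in blast)
  then show ?thesis
    using \<epsilon>(1) by (intro exI[of _ a]) (auto simp: a_def H_def)
qed

text \<open>Inserting the sign arrays of side \<open>n\<close> makes the left side at least
  \<open>n powr \<beta>\<close> and the right side at most \<open>n powr (\<gamma> + 1 / 2)\<close>
  times a power of a logarithm. If the condition failed, \<open>\<beta>\<close> would exceed
  \<open>\<gamma> + 1 / 2\<close>, which is impossible for large \<open>n\<close>.\<close>

lemma exponents_le_of_mixed_sum_le:
  fixes m :: nat
  assumes "1 \<le> m" and s: "1 \<le> s" "s \<le> q" "q \<le> 2" and p: "\<And>j. j < m \<Longrightarrow> 1 \<le> p j"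
    and r: "0 \<le> 1 / s - 1 / q - recip_sum m p"
    and qs: "\<And>j. j < m \<Longrightarrow> 0 < qs j"
    and C: "0 \<le> C" "\<And>A :: (nat \<Rightarrow> nat \<Rightarrow> 'k::{real_normed_field,euclidean_space}) \<Rightarrow> nat \<Rightarrow> 'k.
      multilinear_into_ell m p s A \<Longrightarrow> continuous_into_ell m p s A \<Longrightarrow>
      mixed_sum m qs (\<lambda>is. ennreal (ell_norm q (A (unit_tuple m is)))) \<le> ennreal (C * mult_norm m p s A)"
  shows "(\<Sum>j<m. 1 / qs j) \<le> m / 2 + 1 / s - 1 / q - recip_sum m p"
proof (rule ccontr)
  define \<beta> where "\<beta> = (\<Sum>j<m. 1 / qs j) + 1 / q"
  \<comment> \<open>The exponent of \<open>n\<close> in the norm bound apart from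
    \<open>sqrt (n * Suc m + 2)\<close>, which accounts for the additional
    \<open>1 / 2\<close>.\<close>
  define \<gamma> where "\<gamma> = m / 2 - recip_sum m p + (1 / s - 1 / 2)"
  define d where "d = real (2 * DIM('k))"
  assume "\<not> ?thesis"
  then have \<eta>: "0 < \<beta> - \<gamma> - 1 / 2" by (simp add: \<beta>_def \<gamma>_def)
  \<comment> \<open>All exponents \<open>p j\<close> are at least 2, because the sum of their
    reciprocals is at most \<open>1 / s - 1 / q\<close>, hence at most \<open>1 / 2\<close>; the
    comparison with l_2 relies on this.\<close>
  have p2: "enn2real (1 / p j) \<le> 1 / 2" if "j < m" for j
  proof -
    have "enn2real (1 / p j) \<le> recip_sum m p"
      unfolding recip_sum_def using that by (intro member_le_sum) auto
    moreover have "1 / s \<le> 1" "1 / 2 \<le> 1 / q" using s by (auto simp: field_simps)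
    ultimately show ?thesis using r by linarith
  qed
  have ineq: "n powr (\<beta> - \<gamma> - 1 / 2) \<le> C * (2 * sqrt (m + 3) * d ^ Suc m) * (1 + ln n) ^ Suc m" if n: "0 < n" for n :: nat
  proof -
    obtain a :: "(nat \<Rightarrow> nat) \<Rightarrow> 'k" where a: "\<And>i. i \<in> PiE {..<Suc m} (\<lambda>_. {..<n}) \<Longrightarrow> norm (a i) = 1"
      "mult_norm m p s (array_map m n a) \<le> n powr (1 / s - 1 / 2) *
        (2 * sqrt (n * Suc m + 2) * (2 * DIM('k) * sqrt (harm n)) ^ Suc m * n powr (m / 2 - recip_sum m p))"
      using exists_array_map_small_norm[where 'k = 'k, of s n m p] s n p p2 by fastforce
    define N where "N = n powr (1 / s - 1 / 2) *
        (2 * sqrt (n * Suc m + 2) * (2 * DIM('k) * sqrt (harm n)) ^ Suc m * n powr (m / 2 - recip_sum m p))"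
    have N0: "0 \<le> N" by (simp add: N_def harm_nonneg)
    have "ennreal (n powr \<beta>) \<le> mixed_sum m qs (\<lambda>is. ennreal (ell_norm q (array_map m n a (unit_tuple m is))))"
      unfolding \<beta>_def using assms(1) n s qs a(1) by (intro mixed_sum_array_map_ge) auto
    also have "\<dots> \<le> ennreal (C * mult_norm m p s (array_map m n a))"
      using p s by (intro C(2) array_map_multilinear array_map_continuous) auto
    also have "\<dots> \<le> ennreal (C * N)"
      using a(2) C(1) by (intro ennreal_leI mult_left_mono) (auto simp: N_def)
    finally have "n powr \<beta> \<le> C * N" using C(1) N0 by (simp add: ennreal_le_iff)
    also have "N \<le> n powr \<gamma> * (2 * (sqrt (m + 3) * n powr (1 / 2)) * (d * (1 + ln n)) ^ Suc m)"
    proof -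
      have "real (n * Suc m + 2) \<le> (m + 3) * n" using n by (simp add: algebra_simps)
      then have "sqrt (n * Suc m + 2) \<le> sqrt ((m + 3) * n)" by (simp only: real_sqrt_le_iff)
      then have 1: "sqrt (n * Suc m + 2) \<le> sqrt (m + 3) * n powr (1 / 2)"
        by (simp only: of_nat_mult real_sqrt_mult powr_half_sqrt of_nat_0_le_iff)
      have "harm n - ln (real n) \<le> harm 1 - ln (real 1)"
        using euler_mascheroni_sequence_decreasing[of 1 n] n by simp
      then have h: "harm n \<le> 1 + ln n" by (simp add: harm_expand)
      have "0 \<le> ln n" using n by simp
      \<comment> \<open>Squaring disposes of the root: \<open>sqrt (harm n) \<le> 1 + ln n\<close>
        is coarse, but any power of a logarithm will do.\<close>
      then have "1 + ln n \<le> (1 + ln n)\<^sup>2" by (simp add: power2_eq_square algebra_simps)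
      with h have "harm n \<le> (1 + ln n)\<^sup>2" by linarith
      then have "sqrt (harm n) \<le> 1 + ln n" using \<open>0 \<le> ln n\<close> by (intro real_le_lsqrt) (auto simp: harm_nonneg)
      then have 2: "(2 * DIM('k) * sqrt (harm n)) ^ Suc m \<le> (d * (1 + ln n)) ^ Suc m"
        by (intro power_mono) (auto simp: d_def harm_nonneg)
      have "N = n powr \<gamma> * (2 * sqrt (n * Suc m + 2) * (2 * DIM('k) * sqrt (harm n)) ^ Suc m)"
        by (simp add: N_def \<gamma>_def powr_add mult_ac)
      also have "\<dots> \<le> n powr \<gamma> * (2 * (sqrt (m + 3) * n powr (1 / 2)) * (d * (1 + ln n)) ^ Suc m)"
        using 1 2 by (intro mult_left_mono mult_mono) (auto simp: harm_nonneg)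
      finally show ?thesis .
    qed
    also have "\<dots> = n powr (\<gamma> + 1 / 2) * ((2 * sqrt (m + 3) * d ^ Suc m) * (1 + ln n) ^ Suc m)"
      by (simp only: powr_add power_mult_distrib) (simp add: mult_ac)
    finally have "n powr \<beta> \<le> C * (n powr (\<gamma> + 1 / 2) * ((2 * sqrt (m + 3) * d ^ Suc m) * (1 + ln n) ^ Suc m))"
      using C(1) by (simp add: mult_left_mono)
    then have "n powr \<beta> / n powr (\<gamma> + 1 / 2) \<le> C * (2 * sqrt (m + 3) * d ^ Suc m) * (1 + ln n) ^ Suc m"
      using n by (simp add: divide_le_eq mult_ac)
    then show ?thesis by (simp flip: powr_diff add: diff_diff_eq)
  qed
  define B where "B = C * (2 * sqrt (m + 3) * d ^ Suc m)"
  have "eventually (\<lambda>n :: nat. B * (1 + ln n) ^ Suc m < n powr (\<beta> - \<gamma> - 1 / 2)) sequentially"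
    using \<eta> by real_asymp
  then have "eventually (\<lambda>n :: nat. False) sequentially"
    using eventually_gt_at_top[of 0]
  proof eventually_elim
    case (elim n)
    then show ?case using ineq[of n] by (simp add: B_def)
  qed
  then show False by simp
qed

text \<open>Both \<open>real\<close> and \<open>complex\<close> belong to the type class, so the two
  halves of the theorem are instances of this one. Sufficiency holds with the constant
  \<open>sqrt 3 ^ m\<close>.\<close>

lemma mixed_sum_inequality_iff:
  fixes m :: nat
  assumes "1 \<le> m" and s: "1 \<le> s" "s \<le> q" "q \<le> 2" and p: "\<And>j. j < m \<Longrightarrow> 1 \<le> p j"
    and r: "0 \<le> 1 / s - 1 / q - recip_sum m p"
    and qs: "\<And>j. j < m \<Longrightarrow> qs j \<in> {1 / (1 / 2 + 1 / s - 1 / q - recip_sum m p)..2}"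
  shows "(\<exists>C::real. C \<ge> 1 \<and>
      (\<forall>A :: (nat \<Rightarrow> nat \<Rightarrow> 'k::{real_normed_field,euclidean_space}) \<Rightarrow> nat \<Rightarrow> 'k.
         multilinear_into_ell m p s A \<and> continuous_into_ell m p s A \<longrightarrow>
         mixed_sum m qs (\<lambda>is. ennreal (ell_norm q (A (unit_tuple m is)))) \<le> ennreal (C * mult_norm m p s A)))
    \<longleftrightarrow> (\<Sum>j<m. 1 / qs j) \<le> real m / 2 + 1 / s - 1 / q - recip_sum m p"
    (is "?inequality \<longleftrightarrow> ?exponents")
proof
  have pos: "0 < qs j" if "j < m" for j
  proof -
    have "0 < 1 / (1 / 2 + 1 / s - 1 / q - recip_sum m p)" using r by simp
    then show ?thesis using qs[OF that] by (meson atLeastAtMost_iff less_le_trans)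
  qed
  {
    assume ?inequality
    then obtain C where "1 \<le> C" "\<And>A :: (nat \<Rightarrow> nat \<Rightarrow> 'k) \<Rightarrow> nat \<Rightarrow> 'k.
         multilinear_into_ell m p s A \<Longrightarrow> continuous_into_ell m p s A \<Longrightarrow>
         mixed_sum m qs (\<lambda>is. ennreal (ell_norm q (A (unit_tuple m is)))) \<le> ennreal (C * mult_norm m p s A)"
      by blast
    then show ?exponents
      by (intro exponents_le_of_mixed_sum_le[where 'k = 'k and C = C] assms(1) s p r pos) auto
  }
  {
    assume ?exponents
    moreover have "qs j \<le> 2" if "j < m" for j using qs[OF that] by simp
    ultimately show ?inequality
      using mixed_sum_le_mult_norm[where 'k = 'k, OF assms(1) s p r pos]
      by (intro exI[of _ "sqrt 3 ^ m"]) (auto simp: one_le_power)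
  }
qed

theorem theorem1p2:
  fixes m :: nat and s q :: real and p :: "nat \<Rightarrow> ennreal" and qs :: "nat \<Rightarrow> real"
  assumes "m \<ge> 1"
    and "1 \<le> s" and "s \<le> q" and "q \<le> 2"
    and "\<And>j. j < m \<Longrightarrow> 1 \<le> p j"
    and "1 / s - 1 / q - recip_sum m p \<ge> 0"
    and "\<And>j. j < m \<Longrightarrow> qs j \<in> {1 / (1 / 2 + 1 / s - 1 / q - recip_sum m p)..2}"
  shows "((\<exists>C::real. C \<ge> 1 \<and>
            (\<forall>A :: (nat \<Rightarrow> nat \<Rightarrow> real) \<Rightarrow> nat \<Rightarrow> real.
               multilinear_into_ell m p s A \<and> continuous_into_ell m p s A \<longrightarrow>
               mixed_sum m qs (\<lambda>is. ennreal (ell_norm q (A (unit_tuple m is))))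
                 \<le> ennreal (C * mult_norm m p s A)))
          \<longleftrightarrow> (\<Sum>j<m. 1 / qs j) \<le> real m / 2 + 1 / s - 1 / q - recip_sum m p)
       \<and> ((\<exists>C::real. C \<ge> 1 \<and>
            (\<forall>A :: (nat \<Rightarrow> nat \<Rightarrow> complex) \<Rightarrow> nat \<Rightarrow> complex.
               multilinear_into_ell m p s A \<and> continuous_into_ell m p s A \<longrightarrow>
               mixed_sum m qs (\<lambda>is. ennreal (ell_norm q (A (unit_tuple m is))))
                 \<le> ennreal (C * mult_norm m p s A)))
          \<longleftrightarrow> (\<Sum>j<m. 1 / qs j) \<le> real m / 2 + 1 / s - 1 / q - recip_sum m p)"
  by (intro conjI mixed_sum_inequality_iff assms)

end
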